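(* Let $(\gamma,\nu):(I,t_0)\to\mathbb{R}^2\times S^1$ be a Legendre curve of the form $\gamma(t)=(x(t),z(t))$, $\nu(t)=(\cos\varphi(t),\sin\varphi(t))$ with curvature $(\dot\varphi,\beta)$. Assume that $\beta(t_0)=0$. Then the following hold. (1) $\gamma$ is a $3/2$-cusp at $t_0$ if and only if $\dot\beta(t_0)\dot\varphi(t_0)\neq0$. (2) $\gamma$ is a $5/2$-cusp at $t_0$ if and only if $\dot\beta(t_0)\neq0$, $\dot\varphi(t_0)=0$ and $\ddot\beta(t_0)\ddot\varphi(t_0)-\dot\beta(t_0)\dddot\varphi(t_0)\neq0$. (3) $\gamma$ is a $4/3$-cusp at $t_0$ if and only if $\dot\beta(t_0)=0$ and $\ddot\beta(t_0)\dot\varphi(t_0)\neq0$. (4) $\gamma$ is a $5/3$-cusp at $t_0$ if and only if $\dot\beta(t_0)=\dot\varphi(t_0)=0$ and $\ddot\beta(t_0)\ddot\varphi(t_0)\neq0$.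
   Context: All maps are $C^\infty$; $(I,t_0)$ is an interval with base point $t_0$. A Legendre curve is a smooth map $(\gamma,\nu):I\to\mathbb{R}^2\times S^1$ with $\dot\gamma\cdot\nu=0$. With $\boldsymbol{\mu}=(-\sin\varphi,\cos\varphi)$ (the rotation of $\nu=(\cos\varphi,\sin\varphi)$ by $\pi/2$, where $\varphi$ is smooth), its curvature is $(\dot\nu\cdot\boldsymbol{\mu},\dot\gamma\cdot\boldsymbol{\mu})=(\dot\varphi,\beta)$, so $\dot\gamma=\beta\boldsymbol{\mu}$. Two smooth map-germs $f,g$ between Euclidean spaces are $\mathcal{A}$-equivalent if $g=\Phi\circ f\circ\phi^{-1}$ for diffeomorphism germs $\phi$ of the source and $\Phi$ of the target (mapping base points to base points). For $(i,j)\in\{(2,3),(2,5),(3,4),(3,5)\}$, $\gamma$ at $t_0$ is a $j/i$-cusp if the germ of $\gamma$ at $t_0$ is $\mathcal{A}$-equivalent to the germ $t\mapsto(t^i,t^j)$ at the origin. *)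

theory Defs
  imports "HOL-Analysis.Analysis"
begin

text \<open>
  \<open>C_k_on k U f\<close> is meant for open \<open>U\<close>; in finite dimension, \<open>f\<close> is \<open>C\<^sup>k\<^sup>+\<^sup>1\<close> iff it is
  differentiable and all its directional derivatives are \<open>C\<^sup>k\<close>.
\<close>

primrec C_k_on ::
  "nat \<Rightarrow> 'a::euclidean_space set \<Rightarrow> ('a \<Rightarrow> 'b::euclidean_space) \<Rightarrow> bool"
where
  "C_k_on 0 U f \<longleftrightarrow> continuous_on U f"
| "C_k_on (Suc k) U f \<longleftrightarrow>
     (\<forall>x\<in>U. f differentiable (at x)) \<and>
     (\<forall>v. C_k_on k U (\<lambda>x. frechet_derivative f (at x) v))"

text \<open>
  On an arbitrary set (for instance an interval containing an endpoint), smooth means locally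
  extendable to a \<open>C\<^sup>\<infinity>\<close> map on an open set. For open sets this is the usual notion.
\<close>

definition smooth_on ::
  "'a::euclidean_space set \<Rightarrow> ('a \<Rightarrow> 'b::euclidean_space) \<Rightarrow> bool"
where
  "smooth_on S f \<longleftrightarrow>
     (\<forall>x\<in>S. \<exists>U g. open U \<and> x \<in> U \<and> (\<forall>k. C_k_on k U g) \<and> (\<forall>y\<in>S \<inter> U. f y = g y))"

text \<open>
  Germs are represented by total functions, of which only the values near the base point matter.
  \<open>diffeo_germ p q \<phi> \<psi>\<close>: \<open>\<phi>\<close> represents a diffeomorphism germ taking \<open>p\<close> to \<open>q\<close>, with inverse
  germ represented by \<open>\<psi>\<close>.
\<close>

definition diffeo_germ ::
  "'a::euclidean_space \<Rightarrow> 'b::euclidean_space \<Rightarrow> ('a \<Rightarrow> 'b) \<Rightarrow> ('b \<Rightarrow> 'a) \<Rightarrow> bool"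
where
  "diffeo_germ p q \<phi> \<psi> \<longleftrightarrow>
     \<phi> p = q \<and>
     (\<exists>U V. open U \<and> open V \<and> p \<in> U \<and> homeomorphism U V \<phi> \<psi> \<and>
            smooth_on U \<phi> \<and> smooth_on V \<psi>)"

text \<open>
  \<open>\<A>\<close>-equivalence of the germs of \<open>f\<close> at \<open>p\<close> and \<open>g\<close> at \<open>q\<close> (both understood to be smooth near
  their base points): \<open>g = \<Phi> \<circ> f \<circ> \<phi>\<^sup>-\<^sup>1\<close>, where \<open>\<psi>\<close> is \<open>\<phi>\<^sup>-\<^sup>1\<close>.
\<close>

definition A_equivalent ::
  "('a::euclidean_space \<Rightarrow> 'b::euclidean_space) \<Rightarrow> 'a \<Rightarrow>
   ('c::euclidean_space \<Rightarrow> 'd::euclidean_space) \<Rightarrow> 'c \<Rightarrow> bool"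
where
  "A_equivalent f p g q \<longleftrightarrow>
     (\<exists>\<phi> \<psi> \<Phi> \<Psi>. diffeo_germ p q \<phi> \<psi> \<and> diffeo_germ (f p) (g q) \<Phi> \<Psi> \<and>
        (\<forall>\<^sub>F s in nhds q. g s = (\<Phi> \<circ> f \<circ> \<psi>) s))"

text \<open>\<open>cusp j i \<gamma> t\<^sub>0\<close>: the curve \<open>\<gamma>\<close> is a \<open>j/i\<close>-cusp at \<open>t\<^sub>0\<close>.\<close>

definition cusp :: "nat \<Rightarrow> nat \<Rightarrow> (real \<Rightarrow> real \<times> real) \<Rightarrow> real \<Rightarrow> bool"
where
  "cusp j i \<gamma> t\<^sub>0 \<longleftrightarrow> A_equivalent \<gamma> t\<^sub>0 (\<lambda>t::real. (t ^ i, t ^ j)) 0"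

text \<open>The circle \<open>S\<^sup>1\<close> is the unit sphere of the Euclidean plane \<open>real \<times> real\<close>.\<close>

definition legendre_curve ::
  "real set \<Rightarrow> (real \<Rightarrow> real \<times> real) \<Rightarrow> (real \<Rightarrow> real \<times> real) \<Rightarrow> bool"
where
  "legendre_curve I \<gamma> \<nu> \<longleftrightarrow>
     smooth_on I \<gamma> \<and> smooth_on I \<nu> \<and> \<nu> ` I \<subseteq> sphere 0 1 \<and>
     (\<forall>t\<in>I. vector_derivative \<gamma> (at t within I) \<bullet> \<nu> t = 0)"

definition rot90 :: "real \<times> real \<Rightarrow> real \<times> real"
where
  "rot90 v = (- snd v, fst v)"

definition legendre_curvature ::
  "real set \<Rightarrow> (real \<Rightarrow> real \<times> real) \<Rightarrow> (real \<Rightarrow> real \<times> real) \<Rightarrow> real \<Rightarrow> real \<times> real"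
where
  "legendre_curvature I \<gamma> \<nu> t =
     (vector_derivative \<nu> (at t within I) \<bullet> rot90 (\<nu> t),
      vector_derivative \<gamma> (at t within I) \<bullet> rot90 (\<nu> t))"

end

theory Submission
  imports Defs
begin

text \<open>
  Write \<open>\<nu> = (cos \<phi>, sin \<phi>)\<close> and \<open>\<mu> = (- sin \<phi>, cos \<phi>)\<close>, so that \<open>\<gamma>' = \<beta> \<mu>\<close>. A change of parameter \<open>\<kappa>\<close>
  turns \<open>(\<beta>, \<phi>)\<close> into \<open>((\<beta> \<circ> \<kappa>) \<kappa>', \<phi> \<circ> \<kappa>)\<close>. As \<open>\<beta>\<close> vanishes at the base point, all four
  conditions are invariant under it (\<open>criteria_reparametrize\<close>). In both directions one may therefore work in the most convenient
  parameter.

  The conditions are necessary: if \<open>\<gamma>\<close> is a \<open>j/i\<close>-cusp, then in the parameter of the model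
  \<open>\<gamma> = \<Psi> (s\<^sup>i, s\<^sup>j)\<close> with a diffeomorphism \<open>\<Psi>\<close>. Hence \<open>\<gamma>' = s\<^sup>i\<^sup>-\<^sup>1 w\<close> with \<open>w = i \<Psi>\<^sub>u + j s\<^sup>j\<^sup>-\<^sup>i \<Psi>\<^sub>v\<close>, which is
  tangent to the curve and nonzero at the origin. So \<open>\<beta>\<close> is \<open>s\<^sup>i\<^sup>-\<^sup>1\<close> times a nonvanishing function,
  and \<open>\<phi>'\<close> is the rotation speed of \<open>w\<close>, whose first relevant term is \<open>s\<^sup>j\<^sup>-\<^sup>i\<^sup>-\<^sup>1\<close> with a coefficient
  proportional to the determinant of \<open>\<Psi>\<^sub>u\<close> and \<open>\<Psi>\<^sub>v\<close> (\<open>standard_cusp_data\<close>). From this the conditions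
  are read off.

  The conditions are sufficient: each of them implies that \<open>\<beta>\<close> vanishes to order exactly \<open>i - 1\<close>. The coordinate
  of the curve along its tangent line is then \<open>\<plusminus>s\<^sup>i\<close> in a suitable parameter \<open>s\<close> (\<open>straighten\<close>), and the
  other coordinate \<open>Y\<close> has derivative \<open>s\<^sup>i\<^sup>-\<^sup>1 M\<close> with \<open>M\<close> proportional to the tangent of \<open>\<phi> - \<phi> 0\<close>. It remains
  to bring a germ \<open>(s\<^sup>i, Y s)\<close> into normal form, given the relevant derivatives of \<open>Y\<close>.

  The tool for this is division by \<open>s\<^sup>i\<close>: every smooth germ is \<open>A\<^sub>0(s\<^sup>i) + \<dots> + s\<^sup>i\<^sup>-\<^sup>1 A\<^sub>i\<^sub>-\<^sub>1(s\<^sup>i)\<close> with smooth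
  \<open>A\<^sub>k\<close> (\<open>power_division\<close>). On the level of Taylor series this is trivial, and Borel's theorem realizes
  the series by functions. The error is flat, and flat functions remain smooth after the substitution
  of a root.

  For \<open>i = 2\<close> this gives \<open>Y = a(s\<^sup>2) + s\<^sup>j c(s\<^sup>2)\<close> with \<open>c 0 \<noteq> 0\<close>, and a shear of the plane finishes the
  proof. For \<open>i = 3\<close> a shear leaves \<open>y = t\<^sup>4 b(t\<^sup>3) + t\<^sup>5 c(t\<^sup>3)\<close> or \<open>y = t\<^sup>5 c(t\<^sup>3) + t\<^sup>7 b(t\<^sup>3)\<close>. Remainders of order
  at least \<open>6\<close> and \<open>8\<close>, respectively, are smooth functions of \<open>(t\<^sup>3, y)\<close> (\<open>absorb_order_6\<close>, \<open>absorb_order_8\<close>),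
  so they can be moved into the target diffeomorphism. Only one coefficient below these orders is left,
  and a polynomial change of parameter removes it.
\<close>

section \<open>Maps of class \<open>C\<^sup>k\<close>\<close>

lemma frechet_derivative_cong_open:
  assumes "open U" "x \<in> U" "\<And>y. y \<in> U \<Longrightarrow> f y = g y"
  shows "frechet_derivative f (at x) = frechet_derivative g (at x)"
proof -
  have "(f has_derivative f') (at x) \<longleftrightarrow> (g has_derivative f') (at x)" for f'
    using has_derivative_transform_within_open[OF _ assms(1,2), of f f' UNIV g]
      has_derivative_transform_within_open[OF _ assms(1,2), of g f' UNIV f] assms(3) by auto
  then show ?thesis unfolding frechet_derivative_def by simp
qed

lemma C_k_on_cong:
  assumes "open U" "\<And>y. y \<in> U \<Longrightarrow> f y = g y" "C_k_on k U f"
  shows "C_k_on k U g"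
  using assms(2,3)
proof (induction k arbitrary: f g)
  case 0
  then show ?case using continuous_on_cong by fastforce
next
  case (Suc k)
  have "g differentiable (at x)" if "x \<in> U" for x
    using Suc.prems that assms(1)
      has_derivative_transform_within_open[of f "frechet_derivative f (at x)" x UNIV U g]
    by (metis C_k_on.simps(2) differentiable_def frechet_derivative_works)
  moreover have "C_k_on k U (\<lambda>x. frechet_derivative g (at x) v)" for v
    by (rule Suc.IH[of "\<lambda>x. frechet_derivative f (at x) v"])
      (use Suc.prems(2) frechet_derivative_cong_open[OF assms(1) _ Suc.prems(1)] in auto)
  ultimately show ?case by simp
qed

lemma C_k_on_subset: "C_k_on k U f \<Longrightarrow> V \<subseteq> U \<Longrightarrow> C_k_on k V f"
  by (induction k arbitrary: f) (auto intro: continuous_on_subset)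

lemma C_k_on_SucD: "C_k_on (Suc k) U f \<Longrightarrow> C_k_on k U f"
proof (induction k arbitrary: f)
  case 0
  then show ?case
    by (auto intro!: continuous_at_imp_continuous_on differentiable_imp_continuous_within)
qed auto

lemma C_k_on_SucI:
  assumes "open U" "\<And>x. x \<in> U \<Longrightarrow> (f has_derivative f' x) (at x)"
    and "\<And>v. C_k_on k U (\<lambda>x. f' x v)"
  shows "C_k_on (Suc k) U f"
proof -
  have "f' x v = frechet_derivative f (at x) v" if "x \<in> U" for x v
    using frechet_derivative_at[OF assms(2)[OF that]] by simp
  then have "C_k_on k U (\<lambda>x. frechet_derivative f (at x) v)" for v
    by (intro C_k_on_cong[OF assms(1) _ assms(3)[of v]]) auto
  then show ?thesis using assms(2) by (auto simp: differentiable_def)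
qed

lemma C_k_on_local:
  assumes "\<And>x. x \<in> U \<Longrightarrow> \<exists>V. open V \<and> x \<in> V \<and> C_k_on k V f"
  shows "C_k_on k U f"
  using assms
proof (induction k arbitrary: f)
  case 0
  then have "isCont f x" if "x \<in> U" for x
    using that by (metis C_k_on.simps(1) continuous_on_eq_continuous_at)
  then show ?case by (simp add: continuous_at_imp_continuous_on)
next
  case (Suc k)
  have "f differentiable (at x)" if "x \<in> U" for x
    using Suc.prems[OF that] by auto
  moreover have "C_k_on k U (\<lambda>x. frechet_derivative f (at x) v)" for v
  proof (rule Suc.IH)
    fix x assume "x \<in> U"
    from Suc.prems[OF this] show "\<exists>V. open V \<and> x \<in> V \<and> C_k_on k V (\<lambda>x. frechet_derivative f (at x) v)"
      by auto
  qed
  ultimately show ?case by simp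
qed

lemma C_k_on_const: "C_k_on k U (\<lambda>x. c)"
proof (induction k arbitrary: c)
  case (Suc k)
  then show ?case using frechet_derivative_const by (simp)
qed auto

lemma C_k_on_bounded_linear_comp:
  assumes "bounded_linear L" "open U" "C_k_on k U f"
  shows "C_k_on k U (\<lambda>x. L (f x))"
  using assms(3)
proof (induction k arbitrary: f)
  case 0
  then show ?case
    using bounded_linear.continuous_on[OF assms(1)] by auto
next
  case (Suc k)
  show ?case
  proof (rule C_k_on_SucI[OF assms(2)])
    show "((\<lambda>x. L (f x)) has_derivative (\<lambda>v. L (frechet_derivative f (at x) v))) (at x)" if "x \<in> U" for x
      using Suc.prems that
      by (intro bounded_linear.has_derivative[OF assms(1)]) (auto simp: frechet_derivative_works)
  qed (use Suc in auto)
qed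

lemma C_k_on_id: "open U \<Longrightarrow> C_k_on k U (\<lambda>x. x)"
proof (cases k)
  case (Suc m)
  assume "open U"
  then show ?thesis unfolding Suc
    by (intro C_k_on_SucI[where f'="\<lambda>x v. v"]) (auto intro: C_k_on_const)
qed auto

lemma C_k_on_add:
  assumes "open U" "C_k_on k U f" "C_k_on k U g"
  shows "C_k_on k U (\<lambda>x. f x + g x)"
  using assms(2,3)
proof (induction k arbitrary: f g)
  case (Suc k)
  show ?case
  proof (rule C_k_on_SucI[OF assms(1)])
    show "((\<lambda>x. f x + g x) has_derivative
        (\<lambda>v. frechet_derivative f (at x) v + frechet_derivative g (at x) v)) (at x)" if "x \<in> U" for x
      using Suc.prems that
      by (intro has_derivative_add) (auto simp: frechet_derivative_works)
  qed (use Suc in auto)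
qed (auto intro: continuous_intros)

lemma C_k_on_sum:
  assumes "open U" "\<And>i. i \<in> A \<Longrightarrow> C_k_on k U (f i)"
  shows "C_k_on k U (\<lambda>x. \<Sum>i\<in>A. f i x)"
  using assms(2)
  by (induction A rule: infinite_finite_induct)
     (auto intro: C_k_on_const C_k_on_add[OF assms(1)])

lemma C_k_on_bilinear:
  assumes "bounded_bilinear b" "open U" "C_k_on k U f" "C_k_on k U g"
  shows "C_k_on k U (\<lambda>x. b (f x) (g x))"
  using assms(3,4)
proof (induction k arbitrary: f g)
  case 0
  then show ?case using bounded_bilinear.continuous_on[OF assms(1)] by auto
next
  case (Suc k)
  show ?case
  proof (rule C_k_on_SucI[OF assms(2)])
    show "((\<lambda>x. b (f x) (g x)) has_derivative
        (\<lambda>v. b (f x) (frechet_derivative g (at x) v) + b (frechet_derivative f (at x) v) (g x))) (at x)"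
      if "x \<in> U" for x
      using Suc.prems that
      by (intro bounded_bilinear.FDERIV[OF assms(1)]) (auto simp: frechet_derivative_works)
    show "C_k_on k U (\<lambda>x. b (f x) (frechet_derivative g (at x) v) + b (frechet_derivative f (at x) v) (g x))" for v
      using Suc.prems Suc.prems[THEN C_k_on_SucD]
      by (intro C_k_on_add[OF assms(2)] Suc.IH) (auto simp del: C_k_on.simps(1))
  qed
qed

lemmas C_k_on_mult = C_k_on_bilinear[OF bounded_bilinear_mult]

text \<open>
  Expanding the inner derivative in the standard basis turns the chain rule into a finite sum of
  products of maps of one order less, to which the induction hypothesis applies.
\<close>
lemma C_k_on_compose:
  fixes f :: "'a::euclidean_space \<Rightarrow> 'b::euclidean_space" and g :: "'b \<Rightarrow> 'c::euclidean_space"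
  assumes "open U" "open V" "f ` U \<subseteq> V" "C_k_on k U f" "C_k_on k V g"
  shows "C_k_on k U (\<lambda>x. g (f x))"
  using assms(4,5)
proof (induction k arbitrary: g)
  case 0
  then show ?case using continuous_on_compose2[of V g U f] assms(3) by simp
next
  case (Suc k)
  let ?Df = "\<lambda>x. frechet_derivative f (at x)" and ?Dg = "\<lambda>y. frechet_derivative g (at y)"
  show ?case
  proof (rule C_k_on_SucI[OF assms(1)])
    fix x assume x: "x \<in> U"
    have f: "(f has_derivative ?Df x) (at x)" using Suc.prems x frechet_derivative_works by auto
    have g: "(g has_derivative ?Dg (f x)) (at (f x))"
      using Suc.prems x assms(3) frechet_derivative_works by fastforce
    have "((\<lambda>x. g (f x)) has_derivative (\<lambda>v. ?Dg (f x) (?Df x v))) (at x)"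
      using has_derivative_compose[OF f g] .
    moreover have "?Dg (f x) (?Df x v) = (\<Sum>b\<in>Basis. (?Df x v \<bullet> b) *\<^sub>R ?Dg (f x) b)" for v
    proof -
      interpret bounded_linear "?Dg (f x)" using has_derivative_bounded_linear[OF g] .
      have "?Dg (f x) (?Df x v) = ?Dg (f x) (\<Sum>b\<in>Basis. (?Df x v \<bullet> b) *\<^sub>R b)"
        by (simp add: euclidean_representation)
      then show ?thesis by (simp add: sum scaleR)
    qed
    ultimately show "((\<lambda>x. g (f x)) has_derivative
        (\<lambda>v. \<Sum>b\<in>Basis. (?Df x v \<bullet> b) *\<^sub>R ?Dg (f x) b)) (at x)" by simp
  next
    fix v
    have "C_k_on k U (\<lambda>x. ?Df x v \<bullet> b)" for b
      using Suc.prems by (intro C_k_on_bounded_linear_comp[OF bounded_linear_inner_left assms(1)]) auto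
    moreover have "C_k_on k U (\<lambda>x. ?Dg (f x) b)" for b
      using Suc.prems C_k_on_SucD[of k U] by (intro Suc.IH[where g="\<lambda>y. ?Dg y b"]) auto
    ultimately show "C_k_on k U (\<lambda>x. \<Sum>b\<in>Basis. (?Df x v \<bullet> b) *\<^sub>R ?Dg (f x) b)"
      by (intro C_k_on_sum C_k_on_bilinear[OF bounded_bilinear_scaleR] assms(1))
  qed
qed

lemma C_k_on_real_SucI:
  fixes f :: "real \<Rightarrow> real"
  assumes "open U" "\<And>x. x \<in> U \<Longrightarrow> (f has_real_derivative f' x) (at x)" "C_k_on k U f'"
  shows "C_k_on (Suc k) U f"
proof (rule C_k_on_SucI[OF assms(1)])
  show "(f has_derivative (\<lambda>v. f' x * v)) (at x)" if "x \<in> U" for x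
    using assms(2)[OF that] by (simp add: has_field_derivative_def)
  show "C_k_on k U (\<lambda>x. f' x * v)" for v
    by (rule C_k_on_mult[OF assms(1,3) C_k_on_const])
qed

text \<open>
  Functions that are given by integrals or series come with a whole sequence of candidate
  derivatives; this is how their smoothness is recognized.
\<close>
lemma C_k_on_derivative_sequence:
  fixes F :: "nat \<Rightarrow> real \<Rightarrow> real"
  assumes "open U" "\<And>k x. x \<in> U \<Longrightarrow> (F k has_real_derivative F (Suc k) x) (at x)"
  shows "C_k_on n U (F j)"
proof (induction n arbitrary: j)
  case 0
  then show ?case
    using assms(2) by (auto intro!: continuous_at_imp_continuous_on DERIV_isCont)
next
  case (Suc n)
  then show ?case using C_k_on_real_SucI[OF assms(1) assms(2)] by auto
qed

lemma C_k_on_inverse: "C_k_on k (- {0::real}) inverse"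
proof (induction k)
  case 0
  then show ?case by (auto intro!: continuous_intros)
next
  case (Suc k)
  show ?case
  proof (rule C_k_on_real_SucI)
    show "(inverse has_real_derivative inverse x * inverse x * (-1)) (at x)" if "x \<in> - {0}" for x :: real
      using that by (auto intro!: derivative_eq_intros)
    show "C_k_on k (- {0::real}) (\<lambda>x. inverse x * inverse x * (-1))"
      by (rule C_k_on_mult[OF _ C_k_on_mult[OF _ Suc Suc] C_k_on_const]) auto
  qed auto
qed

lemma C_k_on_root:
  assumes "n > 0"
  shows "C_k_on k {0<..} (root n)"
proof (induction k)
  case 0
  then show ?case by (auto intro!: continuous_intros)
next
  case (Suc k)
  have pow: "C_k_on k {0<..} (\<lambda>x. root n x ^ m)" for m
  proof (induction m)
    case 0
    show ?case using C_k_on_const by simp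
  next
    case (Suc m)
    show ?case using C_k_on_mult[OF _ \<open>C_k_on k {0<..} (root n)\<close> Suc] by simp
  qed
  show ?case
  proof (rule C_k_on_real_SucI)
    show "(root n has_real_derivative inverse (real n * root n x ^ (n - Suc 0))) (at x)"
      if "x \<in> {0<..}" for x
      using DERIV_real_root[OF assms, of x] that by (simp only: greaterThan_iff)
    have "real n * root n x ^ (n - Suc 0) \<in> - {0}" if "x \<in> {0<..}" for x
      using that assms real_root_gt_zero[OF assms, of x] by simp
    then have "(\<lambda>x. real n * root n x ^ (n - Suc 0)) ` {0<..} \<subseteq> - {0}" by (rule image_subsetI)
    moreover have "C_k_on k {0<..} (\<lambda>x. real n * root n x ^ (n - Suc 0))"
      by (rule C_k_on_mult[OF open_greaterThan C_k_on_const pow])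
    moreover have "open (- {0 :: real})" by (simp add: open_Compl)
    ultimately show "C_k_on k {0<..} (\<lambda>x. inverse (real n * root n x ^ (n - Suc 0)))"
      by (intro C_k_on_compose[OF open_greaterThan _ _ _ C_k_on_inverse])
  qed simp
qed

lemma C_k_on_sin_cos:
  "C_k_on k UNIV (sin :: real \<Rightarrow> real)" "C_k_on k UNIV (cos :: real \<Rightarrow> real)"
proof -
  define F :: "nat \<Rightarrow> real \<Rightarrow> real" where "F j = (\<lambda>x. sin (x + of_nat j * pi / 2))" for j
  have F: "(F j has_real_derivative F (Suc j) x) (at x)" for j x
  proof -
    have "x + real (Suc j) * pi / 2 = (x + real j * pi / 2) + pi / 2"
      by (simp add: distrib_right add_divide_distrib)
    then have "F (Suc j) x = cos (x + real j * pi / 2)"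
      unfolding F_def by (simp only: sin_add cos_pi_half sin_pi_half)
    then show ?thesis unfolding F_def[of j] by (auto intro!: derivative_eq_intros)
  qed
  have "F 0 = sin" "F 1 = cos" by (simp_all add: F_def sin_add fun_eq_iff)
  then show "C_k_on k UNIV (sin :: real \<Rightarrow> real)" "C_k_on k UNIV (cos :: real \<Rightarrow> real)"
    using C_k_on_derivative_sequence[of UNIV F k, OF open_UNIV F] by metis+
qed

section \<open>Germs of smooth maps\<close>

text \<open>
  One neighbourhood has to serve all orders \<open>k\<close>. A neighbourhood that shrinks with \<open>k\<close> would not
  give a smooth representative.
\<close>
definition smooth_at :: "'a::euclidean_space \<Rightarrow> ('a \<Rightarrow> 'b::euclidean_space) \<Rightarrow> bool" where
  "smooth_at a f \<longleftrightarrow> (\<exists>U. open U \<and> a \<in> U \<and> (\<forall>k. C_k_on k U f))"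

lemma smooth_atI: "open U \<Longrightarrow> a \<in> U \<Longrightarrow> (\<And>k. C_k_on k U f) \<Longrightarrow> smooth_at a f"
  unfolding smooth_at_def by blast

lemma smooth_at_cong:
  assumes "smooth_at a f" "\<forall>\<^sub>F x in nhds a. f x = g x"
  shows "smooth_at a g"
proof -
  obtain U where U: "open U" "a \<in> U" "\<And>k. C_k_on k U f" using assms(1) unfolding smooth_at_def by blast
  obtain V where V: "open V" "a \<in> V" "\<And>x. x \<in> V \<Longrightarrow> f x = g x"
    using assms(2) unfolding eventually_nhds by blast
  show ?thesis
  proof (rule smooth_atI[of "U \<inter> V"])
    show "C_k_on k (U \<inter> V) g" for k
      by (rule C_k_on_cong[of _ f]) (use U V C_k_on_subset[OF U(3), of "U \<inter> V"] in auto)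
  qed (use U V in auto)
qed

lemma eventually_smooth_at:
  assumes "smooth_at a f" shows "\<forall>\<^sub>F x in nhds a. smooth_at x f"
  using assms unfolding smooth_at_def eventually_nhds by blast

lemma smooth_on_open_iff:
  assumes "open U"
  shows "smooth_on U f \<longleftrightarrow> (\<forall>x\<in>U. smooth_at x f)"
proof
  assume f: "smooth_on U f"
  show "\<forall>x\<in>U. smooth_at x f"
  proof
    fix x assume "x \<in> U"
    then obtain V g where V: "open V" "x \<in> V" "\<And>k. C_k_on k V g" "\<And>y. y \<in> U \<inter> V \<Longrightarrow> f y = g y"
      using f unfolding smooth_on_def by metis
    have "\<forall>\<^sub>F y in nhds x. g y = f y"
      unfolding eventually_nhds using V \<open>x \<in> U\<close> assms by (intro exI[of _ "U \<inter> V"]) auto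
    then show "smooth_at x f" using smooth_at_cong[OF smooth_atI[OF V(1-3)]] by blast
  qed
next
  assume "\<forall>x\<in>U. smooth_at x f"
  then show "smooth_on U f" unfolding smooth_on_def smooth_at_def by blast
qed

lemma smooth_at_differentiable: "smooth_at a f \<Longrightarrow> f differentiable (at a)"
  unfolding smooth_at_def by (metis C_k_on.simps(2))

lemma smooth_at_has_derivative: "smooth_at a f \<Longrightarrow> (f has_derivative frechet_derivative f (at a)) (at a)"
  using smooth_at_differentiable frechet_derivative_works by blast

lemma smooth_at_isCont: "smooth_at a f \<Longrightarrow> isCont f a"
  by (rule differentiable_imp_continuous_within[OF smooth_at_differentiable])

lemma smooth_at_eventually_compose:
  assumes "smooth_at a f" "\<forall>\<^sub>F y in nhds (f a). P y"
  shows "\<forall>\<^sub>F x in nhds a. P (f x)"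
proof -
  have "filterlim f (nhds (f a)) (nhds a)"
    using smooth_at_isCont[OF assms(1)] by (simp add: isCont_def tendsto_at_iff_tendsto_nhds)
  then show ?thesis using assms(2) by (simp add: filterlim_iff)
qed

lemma smooth_at_eventually_nonzero:
  "smooth_at a f \<Longrightarrow> f a \<noteq> 0 \<Longrightarrow> \<forall>\<^sub>F x in nhds a. f x \<noteq> 0"
  using smooth_at_eventually_compose[of a f "\<lambda>y. y \<noteq> 0"] t1_space_nhds by blast

lemma smooth_at_partial: "smooth_at a f \<Longrightarrow> smooth_at a (\<lambda>x. frechet_derivative f (at x) v)"
  unfolding smooth_at_def by (metis C_k_on.simps(2))

lemma smooth_at_const: "smooth_at a (\<lambda>x. c)"
  by (rule smooth_atI[of UNIV]) (auto intro: C_k_on_const)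

lemma smooth_at_id: "smooth_at a (\<lambda>x. x)"
  by (rule smooth_atI[of UNIV]) (auto intro: C_k_on_id)

lemma smooth_at_bounded_linear:
  assumes "bounded_linear L" "smooth_at a f" shows "smooth_at a (\<lambda>x. L (f x))"
  using assms unfolding smooth_at_def by (metis C_k_on_bounded_linear_comp)

lemma smooth_at_pairE:
  assumes "smooth_at a f" "smooth_at a g"
  obtains U where "open U" "a \<in> U" "\<And>k. C_k_on k U f" "\<And>k. C_k_on k U g"
proof -
  obtain U where U: "open U" "a \<in> U" "\<And>k. C_k_on k U f" using assms(1) unfolding smooth_at_def by blast
  obtain V where V: "open V" "a \<in> V" "\<And>k. C_k_on k V g" using assms(2) unfolding smooth_at_def by blast
  show ?thesis
    using that[of "U \<inter> V"] U V C_k_on_subset[OF U(3), of "U \<inter> V"] C_k_on_subset[OF V(3), of "U \<inter> V"]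
    by auto
qed

lemma smooth_at_bilinear:
  assumes "bounded_bilinear b" "smooth_at a f" "smooth_at a g"
  shows "smooth_at a (\<lambda>x. b (f x) (g x))"
  by (rule smooth_at_pairE[OF assms(2,3)])
     (rule smooth_atI, auto intro: C_k_on_bilinear[OF assms(1)])

lemma smooth_at_add:
  assumes "smooth_at a f" "smooth_at a g" shows "smooth_at a (\<lambda>x. f x + g x)"
  by (rule smooth_at_pairE[OF assms]) (rule smooth_atI, auto intro: C_k_on_add)

lemma smooth_at_compose:
  assumes f: "smooth_at a f" and g: "smooth_at (f a) g"
  shows "smooth_at a (\<lambda>x. g (f x))"
proof -
  obtain U where U: "open U" "a \<in> U" "\<And>k. C_k_on k U f" using f unfolding smooth_at_def by blast
  obtain V where V: "open V" "f a \<in> V" "\<And>k. C_k_on k V g" using g unfolding smooth_at_def by blast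
  have "continuous_on U f" using U(3)[of 0] by simp
  then have o: "open (f -` V \<inter> U)" using U V by (simp add: continuous_on_open_vimage)
  show ?thesis
    by (rule smooth_atI[OF o])
       (use U V in \<open>auto intro!: C_k_on_compose[OF o V(1) _ C_k_on_subset[OF U(3)] V(3)]\<close>)
qed

lemmas smooth_at_mult = smooth_at_bilinear[OF bounded_bilinear_mult]
lemmas smooth_at_scaleR = smooth_at_bilinear[OF bounded_bilinear_scaleR]
lemmas smooth_at_inner = smooth_at_bilinear[OF bounded_bilinear_inner]
lemmas smooth_at_fst = smooth_at_bounded_linear[OF bounded_linear_fst]
lemmas smooth_at_snd = smooth_at_bounded_linear[OF bounded_linear_snd]
lemmas smooth_at_minus = smooth_at_bounded_linear[OF bounded_linear_minus[OF bounded_linear_ident]]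

lemma smooth_at_diff: "smooth_at a f \<Longrightarrow> smooth_at a g \<Longrightarrow> smooth_at a (\<lambda>x. f x - g x)"
  using smooth_at_add[OF _ smooth_at_minus, of a f g] by simp

lemma smooth_at_Pair:
  fixes f :: "'a::euclidean_space \<Rightarrow> 'b::euclidean_space" and g :: "'a \<Rightarrow> 'c::euclidean_space"
  assumes "smooth_at a f" "smooth_at a g" shows "smooth_at a (\<lambda>x. (f x, g x))"
proof -
  have "bounded_linear (\<lambda>y::'b. (y, 0::'c))" "bounded_linear (\<lambda>y::'c. (0::'b, y))"
    by (intro bounded_linear_Pair bounded_linear_ident bounded_linear_zero)+
  then have "smooth_at a (\<lambda>x. (f x, 0) + (0, g x))"
    by (intro smooth_at_add smooth_at_bounded_linear[where L="\<lambda>y. (y, 0)"]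
        smooth_at_bounded_linear[where L="\<lambda>y. (0, y)"] assms)
  then show ?thesis by simp
qed

lemma smooth_at_power: "smooth_at a f \<Longrightarrow> smooth_at a (\<lambda>x. f x ^ n)" for f :: "_ \<Rightarrow> real"
  by (induction n) (auto intro: smooth_at_const smooth_at_mult)

lemma smooth_at_sum: "(\<And>i. i \<in> A \<Longrightarrow> smooth_at a (f i)) \<Longrightarrow> smooth_at a (\<lambda>x. \<Sum>i\<in>A. f i x)"
  by (induction A rule: infinite_finite_induct) (auto intro: smooth_at_const smooth_at_add)

lemma smooth_at_inverse:
  assumes "smooth_at a f" "f a \<noteq> 0" shows "smooth_at a (\<lambda>x. inverse (f x :: real))"
  by (rule smooth_at_compose[OF assms(1) smooth_atI[of "- {0}"]]) (use assms(2) C_k_on_inverse in auto)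

lemma smooth_at_divide:
  assumes "smooth_at a f" "smooth_at a g" "g a \<noteq> 0" shows "smooth_at a (\<lambda>x. f x / g x :: real)"
  using smooth_at_mult[OF assms(1) smooth_at_inverse[OF assms(2,3)]] by (simp add: divide_inverse)

lemma smooth_at_root:
  assumes "n > 0" "smooth_at a f" "f a > 0" shows "smooth_at a (\<lambda>x. root n (f x))"
  by (rule smooth_at_compose[OF assms(2) smooth_atI[of "{0<..}"]]) (use assms C_k_on_root in auto)

lemma smooth_at_sin: "smooth_at a f \<Longrightarrow> smooth_at a (\<lambda>x. sin (f x :: real))"
  by (rule smooth_at_compose[of a f sin, OF _ smooth_atI[of UNIV]]) (use C_k_on_sin_cos in auto)

lemma smooth_at_cos: "smooth_at a f \<Longrightarrow> smooth_at a (\<lambda>x. cos (f x :: real))"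
  by (rule smooth_at_compose[of a f cos, OF _ smooth_atI[of UNIV]]) (use C_k_on_sin_cos in auto)

lemmas smooth_intros =
  smooth_at_const smooth_at_id smooth_at_add smooth_at_diff smooth_at_minus smooth_at_mult
  smooth_at_scaleR smooth_at_inner smooth_at_fst smooth_at_snd smooth_at_Pair smooth_at_power
  smooth_at_divide smooth_at_inverse smooth_at_sin smooth_at_cos

section \<open>Germs of functions of one variable\<close>

lemma smooth_at_has_real_derivative:
  "smooth_at a f \<Longrightarrow> (f has_real_derivative deriv f a) (at a)"
  using smooth_at_differentiable DERIV_deriv_iff_real_differentiable by blast

lemma eventually_has_real_derivative:
  "smooth_at a f \<Longrightarrow> \<forall>\<^sub>F t in nhds a. (f has_real_derivative deriv f t) (at t)"
  using eventually_smooth_at[of a f] by (rule eventually_mono[OF _ smooth_at_has_real_derivative])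

lemma smooth_at_deriv:
  assumes "smooth_at a f" shows "smooth_at a (deriv f :: real \<Rightarrow> real)"
proof (rule smooth_at_cong[OF smooth_at_partial[OF assms, of 1]])
  show "\<forall>\<^sub>F x in nhds a. frechet_derivative f (at x) 1 = deriv f x"
    using eventually_has_real_derivative[OF assms]
  proof eventually_elim
    case (elim x)
    then have "(f has_derivative (*) (deriv f x)) (at x)" by (simp add: has_field_derivative_def)
    from frechet_derivative_at[OF this] show ?case by (metis mult.right_neutral)
  qed
qed

lemma smooth_at_higher_deriv: "smooth_at a f \<Longrightarrow> smooth_at a ((deriv ^^ k) f :: real \<Rightarrow> real)"
  by (induction k) (auto intro: smooth_at_deriv)

lemma higher_deriv_cong:
  "\<forall>\<^sub>F t in nhds a. f t = g t \<Longrightarrow> (deriv ^^ k) f a = (deriv ^^ k) (g :: real \<Rightarrow> real) a"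
proof (induction k arbitrary: f g)
  case 0
  then show ?case using eventually_nhds_x_imp_x by fastforce
next
  case (Suc k)
  have "\<forall>\<^sub>F t in nhds a. \<forall>\<^sub>F t in nhds t. f t = g t" using Suc.prems by (simp add: eventually_eventually)
  then have "\<forall>\<^sub>F t in nhds a. deriv f t = deriv g t"
    by eventually_elim (auto intro: deriv_cong_ev)
  from Suc.IH[OF this] show ?case by (simp add: funpow_Suc_right del: funpow.simps)
qed

lemma higher_deriv_shift:
  assumes "\<forall>\<^sub>F t in nhds a. (f has_real_derivative g t) (at t)"
  shows "(deriv ^^ Suc k) f a = (deriv ^^ k) g a"
proof -
  have "\<forall>\<^sub>F t in nhds a. deriv f t = g t" using assms by eventually_elim (rule DERIV_imp_deriv)
  from higher_deriv_cong[OF this] show ?thesis by (simp add: funpow_Suc_right del: funpow.simps)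
qed

text \<open>
  Away from the origin one divides by \<open>t\<^sup>n\<close>; at the origin the equality follows by continuity.
\<close>
lemma eventually_mult_power_cancel:
  fixes g h :: "real \<Rightarrow> real"
  assumes "smooth_at 0 g" "smooth_at 0 h" "\<forall>\<^sub>F t in nhds 0. t ^ n * g t = t ^ n * h t"
  shows "\<forall>\<^sub>F t in nhds 0. g t = h t"
proof -
  have ev: "\<forall>\<^sub>F t in at 0. g t = h t"
    using assms(3) unfolding eventually_at_filter by eventually_elim auto
  have "(g \<longlongrightarrow> g 0) (at 0)" "(h \<longlongrightarrow> h 0) (at 0)"
    using assms(1,2)[THEN smooth_at_isCont] by (auto simp: isCont_def)
  then have "g 0 = h 0"
    using tendsto_cong[OF ev] tendsto_unique[of "at (0::real)" g] by simp
  with ev show ?thesis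
    unfolding eventually_at_filter by (auto elim!: eventually_mono)
qed

text \<open>
  The quotient is \<open>\<integral>\<^sub>0\<^sup>1 f'(t \<sigma>) d\<sigma>\<close>. Its derivatives come from differentiating under the
  integral sign, and each of them is an integral of the same shape.
\<close>
lemma hadamard:
  assumes "smooth_at 0 (f :: real \<Rightarrow> real)"
  shows "\<exists>g. smooth_at 0 g \<and> (\<forall>\<^sub>F t in nhds 0. f t = f 0 + t * g t)"
proof -
  obtain e where e: "e > 0" "\<And>t. t \<in> ball 0 e \<Longrightarrow> smooth_at t f"
    using eventually_smooth_at[OF assms] unfolding eventually_nhds_metric by (auto simp: dist_commute)
  define F where "F k = (deriv ^^ k) f" for k
  define H where "H k t = integral (cbox 0 1) (\<lambda>s. s ^ k * F (Suc k) (t * s))" for k :: nat and t :: real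
  have F: "(F k has_real_derivative F (Suc k) t) (at t)" if "t \<in> ball 0 e" for k t
    unfolding F_def using smooth_at_has_real_derivative[OF smooth_at_higher_deriv[OF e(2)[OF that]]] by simp
  have in_ball: "t * s \<in> ball 0 e" if "t \<in> ball 0 e" "s \<in> cbox 0 1" for t s :: real
    using that mult_mono[of "\<bar>t\<bar>" "\<bar>t\<bar>" "\<bar>s\<bar>" 1] by (auto simp: abs_mult)
  have contF: "continuous_on (ball 0 e) (F k)" for k
    using DERIV_isCont[OF F] by (intro continuous_at_imp_continuous_on ballI)
  have cont: "continuous_on (ball 0 e \<times> cbox 0 1) (\<lambda>(t, s). s ^ j * F k (t * s))" for j k
    unfolding case_prod_unfold
    by (intro continuous_intros continuous_on_compose2[OF contF]) (use in_ball in auto)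
  have int: "(\<lambda>s. s ^ j * F k (t * s)) integrable_on cbox 0 1" if "t \<in> ball 0 e" for j k t
    by (intro integrable_continuous continuous_intros continuous_on_compose2[OF contF])
       (use in_ball that in auto)
  have H: "(H k has_real_derivative H (Suc k) t) (at t)" if t: "t \<in> ball 0 e" for k t
  proof -
    have "((\<lambda>t. integral (cbox 0 1) (\<lambda>s. s ^ k * F (Suc k) (t * s))) has_real_derivative
        integral (cbox 0 1) (\<lambda>s. s ^ Suc k * F (Suc (Suc k)) (t * s))) (at t within ball 0 e)"
    proof (rule leibniz_rule_field_derivative[OF _ _ cont t convex_ball])
      fix x s :: real assume *: "x \<in> ball 0 e" "s \<in> cbox 0 1"
      have "((\<lambda>x. F (Suc k) (x * s)) has_real_derivative F (Suc (Suc k)) (x * s) * s) (at x)"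
        by (rule DERIV_chain2[where f="F (Suc k)" and g="\<lambda>x. x * s", OF F[OF in_ball[OF *]]])
           (auto intro!: derivative_eq_intros)
      from DERIV_cmult[OF this, of "s ^ k"]
      show "((\<lambda>x. s ^ k * F (Suc k) (x * s)) has_real_derivative
        s ^ Suc k * F (Suc (Suc k)) (x * s)) (at x within ball 0 e)"
        by (auto intro: DERIV_subset simp: mult_ac)
    qed (rule int)
    then show ?thesis
      using t at_within_open[OF t open_ball] unfolding H_def[abs_def] by simp
  qed
  have "f t = f 0 + t * H 0 t" if t: "t \<in> ball 0 e" for t
  proof -
    have "((\<lambda>s. t * F (Suc 0) (t * s)) has_integral f (t * 1) - f (t * 0)) {0..1}"
    proof (rule fundamental_theorem_of_calculus)
      fix s :: real assume s: "s \<in> {0..1}"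
      have "((\<lambda>s. F 0 (t * s)) has_real_derivative F (Suc 0) (t * s) * t) (at s)"
        by (rule DERIV_chain2[where f="F 0" and g="\<lambda>s. t * s", OF F[OF in_ball]])
           (use s t in \<open>auto intro!: derivative_eq_intros\<close>)
      then show "((\<lambda>s. f (t * s)) has_vector_derivative t * F (Suc 0) (t * s)) (at s within {0..1})"
        unfolding F_def by (auto simp: has_real_derivative_iff_has_vector_derivative[symmetric] mult.commute
            intro: DERIV_subset)
    qed simp
    from integral_unique[OF this] show ?thesis unfolding H_def by simp
  qed
  then have "\<forall>\<^sub>F t in nhds 0. f t = f 0 + t * H 0 t"
    by (rule eventually_mono[OF eventually_nhds_in_open[of "ball 0 e"], rotated 2]) (use \<open>e > 0\<close> in auto)
  moreover have "smooth_at 0 (H 0)"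
    using \<open>e > 0\<close> H by (intro smooth_atI[of "ball 0 e"] C_k_on_derivative_sequence) auto
  ultimately show ?thesis by blast
qed

text \<open>
  Taylor expansions with a smooth remainder are unique: differentiating one yields an expansion of
  the derivative whose order is lower by one. So derivatives at the origin can be read off from
  any identity of this form.
\<close>
lemma expansion_coefficient:
  fixes f R :: "real \<Rightarrow> real"
  assumes "\<forall>\<^sub>F t in nhds 0. f t = (\<Sum>k<N. c k * t ^ k) + t ^ N * R t" "smooth_at 0 R" "n < N"
  shows "(deriv ^^ n) f 0 = fact n * c n"
  using assms
proof (induction n arbitrary: f c N R)
  case 0
  then obtain M where "N = Suc M" by (cases N) auto
  with eventually_nhds_x_imp_x[OF 0(1)] show ?case
    by (simp add: sum.lessThan_Suc_shift)
next
  case (Suc n)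
  then obtain M where N: "N = Suc M" by (cases N) auto
  define R' where "R' t = real N * R t + t * deriv R t" for t
  have "\<forall>\<^sub>F t in nhds 0. \<forall>\<^sub>F t in nhds t. f t = (\<Sum>k<N. c k * t ^ k) + t ^ N * R t"
    using Suc.prems(1) by (simp add: eventually_eventually)
  then have "\<forall>\<^sub>F t in nhds 0. (f has_real_derivative
      (\<Sum>k<M. real (Suc k) * c (Suc k) * t ^ k) + t ^ M * R' t) (at t)"
    using eventually_has_real_derivative[OF Suc.prems(2)]
  proof eventually_elim
    case (elim t)
    have "((\<lambda>t. (\<Sum>k<N. c k * t ^ k) + t ^ N * R t) has_real_derivative
        (\<Sum>k<N. c k * (real k * t ^ (k - 1))) + (t ^ N * deriv R t + real N * t ^ (N - 1) * R t)) (at t)"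
      using elim(2) by (auto intro!: derivative_eq_intros sum.cong simp: mult_ac)
    moreover have "(\<Sum>k<N. c k * (real k * t ^ (k - 1))) + (t ^ N * deriv R t + real N * t ^ (N - 1) * R t)
       = (\<Sum>k<M. real (Suc k) * c (Suc k) * t ^ k) + t ^ M * R' t"
      unfolding N sum.lessThan_Suc_shift R'_def by (simp add: algebra_simps)
    ultimately show ?case using DERIV_cong_ev[OF refl elim(1) refl] by simp
  qed
  then have "\<forall>\<^sub>F t in nhds 0. deriv f t = (\<Sum>k<M. (real (Suc k) * c (Suc k)) * t ^ k) + t ^ M * R' t"
    by eventually_elim (rule DERIV_imp_deriv)
  moreover have "smooth_at 0 R'" unfolding R'_def[abs_def]
    by (intro smooth_intros smooth_at_deriv Suc.prems)
  ultimately have "(deriv ^^ n) (deriv f) 0 = fact n * (real (Suc n) * c (Suc n))"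
    by (rule Suc.IH) (use Suc.prems N in simp)
  then show ?case by (simp add: funpow_Suc_right del: funpow.simps)
qed

lemma taylor_germ:
  assumes "smooth_at 0 (f :: real \<Rightarrow> real)"
  shows "\<exists>R. smooth_at 0 R \<and>
    (\<forall>\<^sub>F t in nhds 0. f t = (\<Sum>k<N. (deriv ^^ k) f 0 / fact k * t ^ k) + t ^ N * R t)"
proof (induction N)
  case 0
  then show ?case using assms by (intro exI[of _ f]) simp
next
  case (Suc N)
  then obtain R where R: "smooth_at 0 R"
    "\<forall>\<^sub>F t in nhds 0. f t = (\<Sum>k<N. (deriv ^^ k) f 0 / fact k * t ^ k) + t ^ N * R t" by blast
  obtain S where S: "smooth_at 0 S" "\<forall>\<^sub>F t in nhds 0. R t = R 0 + t * S t"
    using hadamard[OF R(1)] by blast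
  define c where "c k = (if k < N then (deriv ^^ k) f 0 / fact k else R 0)" for k
  have ev: "\<forall>\<^sub>F t in nhds 0. f t = (\<Sum>k<Suc N. c k * t ^ k) + t ^ Suc N * S t"
    using R(2) S(2) by eventually_elim (simp add: c_def algebra_simps)
  have "(deriv ^^ k) f 0 / fact k = c k" if "k < Suc N" for k
    using expansion_coefficient[OF ev S(1) that] by simp
  then have "(\<Sum>k<Suc N. (deriv ^^ k) f 0 / fact k * t ^ k) = (\<Sum>k<Suc N. c k * t ^ k)" for t
    by (intro sum.cong) auto
  with ev S(1) show ?case by auto
qed

lemma smooth_at_power_factor:
  assumes "smooth_at 0 (f :: real \<Rightarrow> real)" "\<And>k. k < N \<Longrightarrow> (deriv ^^ k) f 0 = 0"
  shows "\<exists>R. smooth_at 0 R \<and> R 0 = (deriv ^^ N) f 0 / fact N \<and> (\<forall>\<^sub>F t in nhds 0. f t = t ^ N * R t)"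
proof -
  obtain R where R: "smooth_at 0 R"
    "\<forall>\<^sub>F t in nhds 0. f t = (\<Sum>k<N. (deriv ^^ k) f 0 / fact k * t ^ k) + t ^ N * R t"
    using taylor_germ[OF assms(1)] by blast
  obtain S where S: "smooth_at 0 S" "\<forall>\<^sub>F t in nhds 0. R t = R 0 + t * S t"
    using hadamard[OF R(1)] by blast
  have "\<forall>\<^sub>F t in nhds 0. f t = (\<Sum>k<Suc N. (if k < N then 0 else R 0) * t ^ k) + t ^ Suc N * S t"
    using R(2) S(2) by eventually_elim (simp add: assms(2) algebra_simps)
  from expansion_coefficient[OF this S(1), of N] have "R 0 = (deriv ^^ N) f 0 / fact N" by simp
  moreover have "\<forall>\<^sub>F t in nhds 0. f t = t ^ N * R t"
    using R(2) by eventually_elim (simp add: assms(2))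
  ultimately show ?thesis using R(1) by blast
qed

lemma higher_deriv_power_factor:
  assumes "smooth_at 0 R" "\<forall>\<^sub>F t in nhds 0. f t = t ^ N * R t"
  shows "k < N \<Longrightarrow> (deriv ^^ k) f 0 = (0::real)" "(deriv ^^ N) f 0 = fact N * R 0"
proof -
  obtain S where S: "smooth_at 0 S" "\<forall>\<^sub>F t in nhds 0. R t = R 0 + t * S t"
    using hadamard[OF assms(1)] by blast
  have ev: "\<forall>\<^sub>F t in nhds 0. f t = (\<Sum>k<Suc N. (if k < N then 0 else R 0) * t ^ k) + t ^ Suc N * S t"
    using assms(2) S(2) by eventually_elim (simp add: algebra_simps)
  show "k < N \<Longrightarrow> (deriv ^^ k) f 0 = (0::real)" "(deriv ^^ N) f 0 = fact N * R 0"
    using expansion_coefficient[OF ev S(1), of k] expansion_coefficient[OF ev S(1), of N] by auto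
qed

section \<open>Flat germs\<close>

text \<open>
  By Taylor's formula this says that all derivatives vanish at the origin. Divisibility by every
  power of \<open>t\<close> is the form in which flatness is used.
\<close>
definition flat :: "(real \<Rightarrow> real) \<Rightarrow> bool" where
  "flat f \<longleftrightarrow> smooth_at 0 f \<and>
     (\<forall>N. \<exists>R. smooth_at 0 R \<and> (\<forall>\<^sub>F t in nhds 0. f t = t ^ N * R t))"

lemma flat_smooth: "flat f \<Longrightarrow> smooth_at 0 f"
  by (simp add: flat_def)

lemma flatE:
  assumes "flat f"
  obtains R where "smooth_at 0 R" "\<forall>\<^sub>F t in nhds 0. f t = t ^ N * R t"
  using assms unfolding flat_def by blast

lemma flat_at_0: "flat f \<Longrightarrow> f 0 = 0"
  by (erule flatE[where N=1]) (auto dest: eventually_nhds_x_imp_x)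

lemma flat_mult_add:
  assumes "flat f" "flat g" "smooth_at 0 a" "smooth_at 0 b"
  shows "flat (\<lambda>t. a t * f t + b t * g t)"
  unfolding flat_def
proof (intro conjI allI)
  show "smooth_at 0 (\<lambda>t. a t * f t + b t * g t)"
    by (intro smooth_intros assms flat_smooth)
  fix N
  obtain R where R: "smooth_at 0 R" "\<forall>\<^sub>F t in nhds 0. f t = t ^ N * R t" using assms(1) by (rule flatE)
  obtain S where S: "smooth_at 0 S" "\<forall>\<^sub>F t in nhds 0. g t = t ^ N * S t" using assms(2) by (rule flatE)
  have "\<forall>\<^sub>F t in nhds 0. a t * f t + b t * g t = t ^ N * (a t * R t + b t * S t)"
    using R(2) S(2) by eventually_elim (simp add: algebra_simps)
  then show "\<exists>R. smooth_at 0 R \<and> (\<forall>\<^sub>F t in nhds 0. a t * f t + b t * g t = t ^ N * R t)"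
    by (intro exI[of _ "\<lambda>t. a t * R t + b t * S t"] conjI smooth_intros assms R S)
qed

lemma flat_reflect: assumes "flat f" shows "flat (\<lambda>t. f (- t))"
  unfolding flat_def
proof (intro conjI allI)
  have u: "smooth_at 0 (\<lambda>t::real. - t)" by (intro smooth_intros)
  show "smooth_at 0 (\<lambda>t. f (- t))"
    using smooth_at_compose[OF u, of f] flat_smooth[OF assms] by simp
  fix N
  obtain R where R: "smooth_at 0 R" "\<forall>\<^sub>F t in nhds 0. f t = t ^ N * R t" using assms(1) by (rule flatE)
  have "\<forall>\<^sub>F t in nhds 0. f (- t) = (- t) ^ N * R (- t)"
    by (rule smooth_at_eventually_compose[OF u]) (use R(2) in simp)
  then have "\<forall>\<^sub>F t in nhds 0. f (- t) = t ^ N * ((- 1) ^ N * R (- t))"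
    by eventually_elim (metis mult.assoc mult.commute power_minus)
  moreover have "smooth_at 0 (\<lambda>t. (- 1) ^ N * R (- t))"
    using R(1) by (intro smooth_intros smooth_at_compose[OF u, of R]) simp
  ultimately show "\<exists>R. smooth_at 0 R \<and> (\<forall>\<^sub>F t in nhds 0. f (- t) = t ^ N * R t)" by blast
qed

lemma flat_divide:
  assumes "flat f"
  shows "\<exists>g. flat g \<and> (\<forall>\<^sub>F t in nhds 0. f t = t ^ n * g t)"
proof -
  obtain g where g: "smooth_at 0 g" "\<forall>\<^sub>F t in nhds 0. f t = t ^ n * g t" using assms by (rule flatE)
  have "\<exists>R. smooth_at 0 R \<and> (\<forall>\<^sub>F t in nhds 0. g t = t ^ N * R t)" for N
  proof -
    obtain R where R: "smooth_at 0 R" "\<forall>\<^sub>F t in nhds 0. f t = t ^ (n + N) * R t" using assms by (rule flatE)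
    have "\<forall>\<^sub>F t in nhds 0. t ^ n * g t = t ^ n * (t ^ N * R t)"
      using g(2) R(2) by eventually_elim (metis mult.assoc power_add)
    then have "\<forall>\<^sub>F t in nhds 0. g t = t ^ N * R t"
      by (intro eventually_mult_power_cancel[OF g(1)] smooth_intros R)
    with R show ?thesis by blast
  qed
  with g show ?thesis unfolding flat_def by blast
qed

lemma flat_deriv: assumes "flat f" shows "flat (deriv f)"
  unfolding flat_def
proof (intro conjI allI)
  show "smooth_at 0 (deriv f)" using smooth_at_deriv flat_smooth[OF assms] .
  fix N
  obtain R where R: "smooth_at 0 R" "\<forall>\<^sub>F t in nhds 0. f t = t ^ Suc N * R t" using assms by (rule flatE)
  have "\<forall>\<^sub>F t in nhds 0. \<forall>\<^sub>F t in nhds t. f t = t ^ Suc N * R t"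
    using R(2) by (simp add: eventually_eventually)
  then have "\<forall>\<^sub>F t in nhds 0. deriv f t = t ^ N * (real (Suc N) * R t + t * deriv R t)"
    using eventually_has_real_derivative[OF R(1)]
  proof eventually_elim
    case (elim t)
    have "((\<lambda>t. t ^ Suc N * R t) has_real_derivative t ^ N * (real (Suc N) * R t + t * deriv R t)) (at t)"
      by (rule DERIV_cong[OF DERIV_mult[OF DERIV_pow elim(2)]]) (simp add: algebra_simps)
    then show ?case using DERIV_imp_deriv deriv_cong_ev[OF elim(1) refl] by metis
  qed
  then show "\<exists>R. smooth_at 0 R \<and> (\<forall>\<^sub>F t in nhds 0. deriv f t = t ^ N * R t)"
    by (intro exI[of _ "\<lambda>t. real (Suc N) * R t + t * deriv R t"] conjI)
       (intro smooth_intros smooth_at_deriv R)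
qed

text \<open>
  The function \<open>u \<mapsto> f (u\<^sup>1\<^sup>/\<^sup>n)\<close> on the half-line \<open>u > 0\<close>. The truncation extends it by \<open>f 0\<close>, which is
  zero for flat \<open>f\<close>.
\<close>
definition root_extension :: "nat \<Rightarrow> (real \<Rightarrow> real) \<Rightarrow> real \<Rightarrow> real" where
  "root_extension n f u = f (root n (max 0 u))"

lemma eventually_root_max:
  assumes "\<forall>\<^sub>F t in nhds (0::real). P t"
  shows "\<forall>\<^sub>F u in nhds 0. P (root n (max 0 u))"
proof -
  have "isCont (\<lambda>u. root n (max 0 u)) 0" by (intro continuous_intros)
  then have "((\<lambda>u. root n (max 0 u)) \<longlongrightarrow> root n (max 0 0)) (nhds 0)"
    using tendsto_at_iff_tendsto_nhds[of "\<lambda>u. root n (max 0 u)" 0] by (simp only: isCont_def)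
  then have "filterlim (\<lambda>u. root n (max 0 u)) (nhds 0) (nhds 0)" by simp
  then show ?thesis using assms unfolding filterlim_iff by blast
qed

text \<open>
  For \<open>u > 0\<close> the chain rule produces the factor \<open>u\<^sup>1\<^sup>/\<^sup>n\<^sup>-\<^sup>1\<close>, which is singular at the origin but is
  absorbed by flatness: \<open>f'(t) / (n t\<^sup>n\<^sup>-\<^sup>1)\<close> is again flat. So differentiation
  stays within functions of this shape.
\<close>
lemma root_extension_derivative:
  assumes "flat f" "n > 0"
  shows "\<exists>k. flat k \<and> (\<forall>\<^sub>F u in nhds 0. (root_extension n f has_real_derivative root_extension n k u) (at u))"
proof -
  obtain q where q: "flat q" "\<forall>\<^sub>F t in nhds 0. deriv f t = t ^ (n - 1) * q t"
    using flat_divide[OF flat_deriv[OF assms(1)]] by blast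
  define k where "k t = inverse (real n) * q t + 0 * q t" for t
  have k: "flat k" unfolding k_def[abs_def] by (intro flat_mult_add q smooth_intros)
  have cont: "isCont (\<lambda>u. root n (max 0 u)) 0"
    by (intro continuous_intros)
  have "\<forall>\<^sub>F t in nhds 0. (f has_real_derivative real n * t ^ (n - 1) * k t) (at t)"
    using eventually_has_real_derivative[OF flat_smooth[OF assms(1)]] q(2)
    by eventually_elim (use assms(2) in \<open>auto simp: k_def field_simps\<close>)
  then have ev: "\<forall>\<^sub>F u in nhds 0. (f has_real_derivative
      real n * root n (max 0 u) ^ (n - 1) * k (root n (max 0 u))) (at (root n (max 0 u)))"
    by (rule eventually_root_max)
  obtain h where h: "smooth_at 0 h" "\<forall>\<^sub>F t in nhds 0. f t = t ^ Suc n * h t"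
    using assms(1) by (rule flatE)
  have at_0: "(root_extension n f has_real_derivative 0) (at 0)"
  proof -
    have "isCont (\<lambda>u. root n (max 0 u) * h (root n (max 0 u))) 0"
      by (intro continuous_intros cont isCont_o2[OF cont]) (use smooth_at_isCont[OF h(1)] in simp)
    then have "((\<lambda>u. root n (max 0 u) * h (root n (max 0 u))) \<longlongrightarrow> 0) (at 0)"
      by (simp add: isCont_def)
    moreover have "\<forall>\<^sub>F u in at 0. root n (max 0 u) * h (root n (max 0 u)) = root_extension n f u / u"
    proof -
      have "\<forall>\<^sub>F u in nhds 0. f (root n (max 0 u)) = root n (max 0 u) ^ Suc n * h (root n (max 0 u))"
        by (rule eventually_root_max[OF h(2)])
      then show ?thesis unfolding eventually_at_filter
        by eventually_elim (use assms(2) in \<open>auto simp: root_extension_def max_def field_simps\<close>)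
    qed
    ultimately have "((\<lambda>u. root_extension n f u / u) \<longlongrightarrow> 0) (at 0)"
      by (rule Lim_transform_eventually)
    then show ?thesis using flat_at_0[OF assms(1)]
      by (simp add: DERIV_def root_extension_def)
  qed
  have "\<forall>\<^sub>F u in nhds 0. (root_extension n f has_real_derivative root_extension n k u) (at u)"
    using ev
  proof eventually_elim
    case (elim u)
    consider "u < 0" | "u = 0" | "u > 0" by linarith
    then show ?case
    proof cases
      case 1
      have "\<forall>\<^sub>F v in nhds u. root_extension n f v = 0"
        using eventually_nhds_in_open[of "{..<0}" u] 1
        by (auto simp: root_extension_def flat_at_0[OF assms(1)] elim!: eventually_mono)
      from DERIV_cong_ev[OF refl this refl] have "(root_extension n f has_real_derivative 0) (at u)"
        by simp
      then show ?thesis using 1 flat_at_0[OF k] by (simp add: root_extension_def[of n k])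
    next
      case 2
      then show ?thesis using at_0 flat_at_0[OF k] by (simp add: root_extension_def[of n k])
    next
      case 3
      have "((\<lambda>u. f (root n u)) has_real_derivative k (root n u)) (at u)"
      proof (rule DERIV_cong)
        show "((\<lambda>u. f (root n u)) has_real_derivative
            (real n * root n u ^ (n - 1) * k (root n u)) * inverse (real n * root n u ^ (n - Suc 0))) (at u)"
          using elim 3 by (intro DERIV_chain2[where g="root n"] DERIV_real_root assms(2)) (auto simp: max_def)
      qed (use 3 assms(2) real_root_gt_zero[OF assms(2) 3] in \<open>simp add: field_simps\<close>)
      moreover have "\<forall>\<^sub>F v in nhds u. root_extension n f v = f (root n v)"
        using eventually_nhds_in_open[of "{0<..}" u] 3
        by (auto simp: root_extension_def max_def elim!: eventually_mono)
      ultimately have "(root_extension n f has_real_derivative k (root n u)) (at u)"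
        by (subst DERIV_cong_ev[OF refl _ refl]) auto
      then show ?thesis using 3 by (simp add: root_extension_def[of n k])
    qed
  qed
  with k show ?thesis by blast
qed

text \<open>
  Iterating the previous lemma shows class \<open>C\<^sup>k\<close> near the origin, but on neighbourhoods that depend
  on \<open>k\<close>. Off the origin the root itself is smooth, on a neighbourhood independent of \<open>k\<close>, and being
  \<open>C\<^sup>k\<close> is a local property.
\<close>
lemma smooth_root_extension:
  assumes "flat f" "n > 0"
  shows "smooth_at 0 (root_extension n f)"
proof -
  have at_0: "\<exists>U. open U \<and> 0 \<in> U \<and> C_k_on k U (root_extension n f)" if "flat f" for k f
    using that
  proof (induction k arbitrary: f)
    case 0
    from root_extension_derivative[OF this assms(2)] obtain k U where
      "open U" "0 \<in> U" "\<And>u. u \<in> U \<Longrightarrow> (root_extension n f has_real_derivative root_extension n k u) (at u)"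
      unfolding eventually_nhds by blast
    then show ?case
      by (intro exI[of _ U]) (auto intro!: continuous_at_imp_continuous_on DERIV_isCont)
  next
    case (Suc m)
    from root_extension_derivative[OF this(2) assms(2)] obtain k U where
      U: "flat k" "open U" "0 \<in> U" "\<And>u. u \<in> U \<Longrightarrow> (root_extension n f has_real_derivative root_extension n k u) (at u)"
      unfolding eventually_nhds by blast
    from Suc.IH[OF U(1)] obtain V where V: "open V" "0 \<in> V" "C_k_on m V (root_extension n k)" by blast
    have "C_k_on (Suc m) (U \<inter> V) (root_extension n f)"
      by (rule C_k_on_real_SucI[where f'="root_extension n k"])
         (use U V C_k_on_subset[OF V(3), of "U \<inter> V"] in auto)
    then show ?case using U V by (intro exI[of _ "U \<inter> V"]) auto
  qed
  have "\<forall>\<^sub>F u in nhds 0. smooth_at (root n (max 0 u)) f"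
    by (rule eventually_root_max[OF eventually_smooth_at[OF flat_smooth[OF assms(1)]]])
  then obtain U where U: "open U" "0 \<in> U" "\<And>u. u \<in> U \<Longrightarrow> smooth_at (root n (max 0 u)) f"
    unfolding eventually_nhds by blast
  have off_0: "smooth_at u (root_extension n f)" if "u \<in> U" "u \<noteq> 0" for u
  proof (cases "u > 0")
    case True
    have "smooth_at u (\<lambda>u. f (root n u))"
      by (rule smooth_at_compose[OF smooth_at_root[OF assms(2) smooth_at_id True]])
         (use U(3)[OF that(1)] True in \<open>simp add: max_def\<close>)
    moreover have "\<forall>\<^sub>F v in nhds u. f (root n v) = root_extension n f v"
      using eventually_nhds_in_open[of "{0<..}" u] True
      by (auto simp: root_extension_def max_def elim!: eventually_mono)
    ultimately show ?thesis by (rule smooth_at_cong)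
  next
    case False
    have "\<forall>\<^sub>F v in nhds u. 0 = root_extension n f v"
      using eventually_nhds_in_open[of "{..<0}" u] False that
      by (auto simp: root_extension_def flat_at_0[OF assms(1)] elim!: eventually_mono)
    then show ?thesis by (rule smooth_at_cong[OF smooth_at_const])
  qed
  have "C_k_on k U (root_extension n f)" for k
  proof (rule C_k_on_local)
    fix u assume "u \<in> U"
    then show "\<exists>V. open V \<and> u \<in> V \<and> C_k_on k V (root_extension n f)"
      using at_0[OF assms(1), of k] off_0[of u] by (cases "u = 0") (auto simp: smooth_at_def)
  qed
  then show ?thesis using smooth_atI U by blast
qed

text \<open>
  For odd \<open>n\<close> the map \<open>t \<mapsto> t\<^sup>n\<close> is invertible, and \<open>f\<close> itself is a function of \<open>t\<^sup>n\<close>, obtained by joining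
  the extensions from the two half-lines. For even \<open>n\<close> only the even part of \<open>f\<close> is a function of
  \<open>t\<^sup>n\<close>; the odd part is \<open>t\<close> times another even function.
\<close>
lemma flat_division:
  assumes "flat f" "n > 0"
  shows "\<exists>A. (\<forall>k<n. smooth_at 0 (A k)) \<and> (\<forall>\<^sub>F t in nhds 0. f t = (\<Sum>k<n. t ^ k * A k (t ^ n)))"
proof (cases "even n")
  case False
  define A where "A k u = (if k = 0 then root_extension n f u + root_extension n (\<lambda>t. f (- t)) (- u) else 0)"
    for k :: nat and u
  have "smooth_at 0 (\<lambda>u. root_extension n (\<lambda>t. f (- t)) (- u))"
    using smooth_root_extension[OF flat_reflect[OF assms(1)] assms(2)]
    by (intro smooth_at_compose[of 0 "\<lambda>u. - u" "root_extension n (\<lambda>t. f (- t))"] smooth_intros) simp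
  then have "smooth_at 0 (A k)" for k
    unfolding A_def[abs_def] using smooth_root_extension[OF assms]
    by (cases "k = 0") (auto intro: smooth_intros)
  moreover have "f t = (\<Sum>k<n. t ^ k * A k (t ^ n))" for t
  proof -
    have "(\<Sum>k<n. t ^ k * A k (t ^ n)) = (\<Sum>k\<in>{0}. t ^ k * A k (t ^ n))"
      using assms(2) by (intro sum.mono_neutral_right) (auto simp: A_def)
    also have "\<dots> = f t"
    proof (cases "t \<ge> 0")
      case True
      then have "max 0 (- (t ^ n)) = 0" "max 0 (t ^ n) = t ^ n" by simp_all
      then show ?thesis using assms(2) flat_at_0[OF assms(1)] True
        by (simp add: A_def root_extension_def real_root_power_cancel)
    next
      case neg: False
      then have "- (t ^ n) = (- t) ^ n" using False by simp
      moreover have "(- t) ^ n > 0" using neg by simp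
      ultimately have "max 0 (- (t ^ n)) = (- t) ^ n" "max 0 (t ^ n) = 0" by simp_all
      then show ?thesis using assms(2) neg flat_at_0[OF assms(1)] real_root_power_cancel[of n "- t"]
        by (simp add: A_def root_extension_def)
    qed
    finally show ?thesis by simp
  qed
  ultimately show ?thesis by (intro exI[of _ A]) auto
next
  case True
  with assms(2) have n: "n \<ge> 2" by presburger
  define odd_part where "odd_part t = 1/2 * f t + - (1/2) * f (- t)" for t
  have "flat odd_part" unfolding odd_part_def[abs_def]
    by (intro flat_mult_add assms flat_reflect smooth_intros)
  from flat_divide[OF this, of 1] obtain g where g: "flat g" "\<forall>\<^sub>F t in nhds 0. odd_part t = t ^ 1 * g t"
    by blast
  define p where "p t = 1/2 * f t + 1/2 * f (- t)" for t
  define q where "q t = 1/2 * g t + 1/2 * g (- t)" for t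
  have pq: "flat p" "flat q" unfolding p_def[abs_def] q_def[abs_def]
    by (intro flat_mult_add assms flat_reflect g smooth_intros)+
  have even: "h t = root_extension n h (t ^ n)" if "\<And>t. h (- t) = h t" for h t
  proof -
    have "root n (t ^ n) = \<bar>t\<bar>" using True assms(2) real_root_power_cancel[of n "\<bar>t\<bar>"]
      by (simp add: power_even_abs)
    moreover have "t ^ n \<ge> 0" using True by (rule zero_le_even_power)
    ultimately show ?thesis using that[of t] by (auto simp: root_extension_def max_def abs_if split: if_splits)
  qed
  define A where "A k = (if k = 0 then root_extension n p else if k = 1 then root_extension n q else (\<lambda>_. 0))"
    for k :: nat
  have "smooth_at 0 (A k)" for k
    unfolding A_def using smooth_root_extension[OF _ assms(2)] pq by (auto intro: smooth_at_const)
  moreover have "\<forall>\<^sub>F t in nhds 0. odd_part (- t) = (- t) ^ 1 * g (- t)"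
    by (rule smooth_at_eventually_compose[OF smooth_at_minus[OF smooth_at_id]]) (use g(2) in simp)
  with g(2) have "\<forall>\<^sub>F t in nhds 0. f t = (\<Sum>k<n. t ^ k * A k (t ^ n))"
  proof eventually_elim
    case (elim t)
    have "(\<Sum>k<n. t ^ k * A k (t ^ n)) = (\<Sum>k\<in>{0,1}. t ^ k * A k (t ^ n))"
      using n by (intro sum.mono_neutral_right) (auto simp: A_def)
    also have "\<dots> = p t + t * q t"
      using even[of p t] even[of q t] by (simp add: A_def p_def q_def add.commute)
    also have "\<dots> = f t"
    proof -
      have "t * g t = 1/2 * f t - 1/2 * f (- t)" "t * g (- t) = 1/2 * f t - 1/2 * f (- t)"
        using elim unfolding odd_part_def power_one_right minus_minus by linarith+
      moreover have "t * q t = 1/2 * (t * g t) + 1/2 * (t * g (- t))"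
        unfolding q_def by (simp add: algebra_simps)
      ultimately show ?thesis unfolding p_def by linarith
    qed
    finally show ?case by simp
  qed
  ultimately show ?thesis by blast
qed

section \<open>Borel's theorem\<close>

text \<open>
  All derivatives of these functions are bounded on the whole line. So the powers of the sine can
  take the place of monomials that are cut off at infinity.
\<close>
inductive trig_poly :: "(real \<Rightarrow> real) \<Rightarrow> bool" where
  const: "trig_poly (\<lambda>x. c)"
| sin: "trig_poly (\<lambda>x. sin (l * x))"
| cos: "trig_poly (\<lambda>x. cos (l * x))"
| add: "trig_poly f \<Longrightarrow> trig_poly g \<Longrightarrow> trig_poly (\<lambda>x. f x + g x)"
| mult: "trig_poly f \<Longrightarrow> trig_poly g \<Longrightarrow> trig_poly (\<lambda>x. f x * g x)"

lemma trig_poly_power: "trig_poly f \<Longrightarrow> trig_poly (\<lambda>x. f x ^ n)"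
  by (induction n) (auto intro: trig_poly.intros)

lemma trig_poly_bounded: "trig_poly f \<Longrightarrow> \<exists>B. \<forall>x. \<bar>f x\<bar> \<le> B"
proof (induction rule: trig_poly.induct)
  case (add f g)
  then obtain B C where "\<And>x. \<bar>f x\<bar> \<le> B" "\<And>x. \<bar>g x\<bar> \<le> C" by blast
  then have "\<bar>f x + g x\<bar> \<le> B + C" for x by (meson abs_triangle_ineq add_mono order_trans)
  then show ?case by blast
next
  case (mult f g)
  then obtain B C where *: "\<And>x. \<bar>f x\<bar> \<le> B" "\<And>x. \<bar>g x\<bar> \<le> C" by blast
  have "0 \<le> B" using *(1)[of 0] by linarith
  then have "\<bar>f x * g x\<bar> \<le> B * C" for x unfolding abs_mult by (intro mult_mono *) auto
  then show ?case by blast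
qed (use abs_sin_le_one abs_cos_le_one in blast)+

lemma trig_poly_has_derivative:
  "trig_poly f \<Longrightarrow> \<exists>g. trig_poly g \<and> (\<forall>x. (f has_real_derivative g x) (at x))"
proof (induction rule: trig_poly.induct)
  case (const c)
  then show ?case by (intro exI[of _ "\<lambda>x. 0"]) (auto intro: trig_poly.intros)
next
  case (sin l)
  show ?case
    by (intro exI[of _ "\<lambda>x. l * cos (l * x)"] conjI allI trig_poly.mult trig_poly.const trig_poly.cos)
       (auto intro!: derivative_eq_intros)
next
  case (cos l)
  show ?case
    by (intro exI[of _ "\<lambda>x. - l * sin (l * x)"] conjI allI trig_poly.mult trig_poly.const trig_poly.sin)
       (auto intro!: derivative_eq_intros)
next
  case (add f g)
  then obtain f' g' where "trig_poly f'" "trig_poly g'" "\<And>x. (f has_real_derivative f' x) (at x)"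
    "\<And>x. (g has_real_derivative g' x) (at x)" by blast
  then show ?case
    by (intro exI[of _ "\<lambda>x. f' x + g' x"]) (auto intro: trig_poly.add DERIV_add)
next
  case (mult f g)
  then obtain f' g' where "trig_poly f'" "trig_poly g'" "\<And>x. (f has_real_derivative f' x) (at x)"
    "\<And>x. (g has_real_derivative g' x) (at x)" by blast
  with mult show ?case
    by (intro exI[of _ "\<lambda>x. f' x * g x + g' x * f x"])
       (auto intro!: trig_poly.add trig_poly.mult DERIV_mult)
qed

lemma trig_poly_deriv:
  assumes "trig_poly f"
  shows "trig_poly (deriv f)" "(f has_real_derivative deriv f x) (at x)"
proof -
  obtain g where g: "trig_poly g" "\<And>x. (f has_real_derivative g x) (at x)"
    using trig_poly_has_derivative[OF assms] by blast
  then have "deriv f = g" by (intro ext DERIV_imp_deriv)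
  with g show "trig_poly (deriv f)" "(f has_real_derivative deriv f x) (at x)" by auto
qed

lemma trig_poly_higher_deriv: "trig_poly f \<Longrightarrow> trig_poly ((deriv ^^ k) f)"
  by (induction k) (auto intro: trig_poly_deriv)

lemma higher_deriv_rescale:
  assumes "trig_poly f"
  shows "(deriv ^^ k) (\<lambda>x. c * f (l * x)) = (\<lambda>x. c * l ^ k * (deriv ^^ k) f (l * x))"
proof (induction k)
  case (Suc k)
  have "((\<lambda>x. c * l ^ k * (deriv ^^ k) f (l * x)) has_real_derivative
      c * l ^ k * ((deriv ^^ Suc k) f (l * x) * l)) (at x)" for x
    using trig_poly_deriv(2)[OF trig_poly_higher_deriv[OF assms, of k], of "l * x"]
    by (intro DERIV_cmult DERIV_chain2[where f="(deriv ^^ k) f" and g="\<lambda>x. l * x"])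
       (auto intro!: derivative_eq_intros)
  then have "deriv (\<lambda>x. c * l ^ k * (deriv ^^ k) f (l * x)) = (\<lambda>x. c * l ^ Suc k * (deriv ^^ Suc k) f (l * x))"
    by (intro ext DERIV_imp_deriv) (simp add: mult_ac)
  then show ?case using Suc.IH by simp
qed auto

lemma higher_deriv_sin_power:
  shows "k < n \<Longrightarrow> (deriv ^^ k) (\<lambda>x::real. sin x ^ n) 0 = 0"
    and "(deriv ^^ n) (\<lambda>x::real. sin x ^ n) 0 = fact n"
proof -
  have "smooth_at 0 (\<lambda>x::real. sin x)" by (intro smooth_intros)
  moreover have "deriv (sin :: real \<Rightarrow> real) 0 = 1"
    by (rule DERIV_imp_deriv) (auto intro!: derivative_eq_intros)
  ultimately have "\<exists>S. smooth_at 0 S \<and> S 0 = (1::real) \<and> (\<forall>\<^sub>F x::real in nhds 0. sin x = x * S x)"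
    using smooth_at_power_factor[of sin 1] by simp
  then obtain S where S: "smooth_at 0 S" "S 0 = 1" "\<forall>\<^sub>F x::real in nhds 0. sin x = x * S x" by blast
  have "\<forall>\<^sub>F x in nhds 0. sin x ^ n = x ^ n * S x ^ n"
    using S(3) by eventually_elim (simp add: power_mult_distrib)
  from higher_deriv_power_factor[OF smooth_at_power[OF S(1)] this]
  show "k < n \<Longrightarrow> (deriv ^^ k) (\<lambda>x::real. sin x ^ n) 0 = 0"
    and "(deriv ^^ n) (\<lambda>x::real. sin x ^ n) 0 = fact n" using S(2) by auto
qed

text \<open>
  The function is \<open>c (sin (l x) / l)\<^sup>n\<close> with \<open>l\<close> large: its \<open>n\<close>-th derivative at the origin does not
  depend on \<open>l\<close>, while the lower derivatives are of size \<open>1 / l\<close> on the whole line.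
\<close>
lemma trig_poly_small:
  "\<exists>p. trig_poly p \<and> (\<forall>k<n. (deriv ^^ k) p 0 = 0) \<and> (deriv ^^ n) p 0 = r \<and>
     (\<forall>k<n. \<forall>x. \<bar>(deriv ^^ k) p x\<bar> \<le> (1/2) ^ n)"
proof -
  define Q where "Q x = sin x ^ n" for x :: real
  have Q: "trig_poly Q" unfolding Q_def[abs_def]
    using trig_poly_power[OF trig_poly.sin[of 1]] by simp
  have "\<exists>B. \<forall>x. \<bar>(deriv ^^ k) Q x\<bar> \<le> B" for k
    by (rule trig_poly_bounded[OF trig_poly_higher_deriv[OF Q]])
  then obtain B where B: "\<And>k x. \<bar>(deriv ^^ k) Q x\<bar> \<le> B k" by metis
  have B0: "0 \<le> B k" for k using B[of k 0] by linarith
  define c where "c = r / fact n"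
  \<comment> \<open>Any \<open>l \<ge> 1\<close> with \<open>\<bar>c\<bar> B\<^sub>k / l \<le> 2\<^sup>-\<^sup>n\<close> for all \<open>k < n\<close> would do.\<close>
  define l where "l = 1 + 2 ^ n * \<bar>c\<bar> * (\<Sum>k<n. B k)"
  have S0: "0 \<le> (\<Sum>k<n. B k)" using B0 by (intro sum_nonneg) auto
  then have l: "l \<ge> 1" unfolding l_def by simp
  define p where "p x = c / l ^ n * Q (l * x)" for x
  have D: "(deriv ^^ k) p = (\<lambda>x. c / l ^ n * l ^ k * (deriv ^^ k) Q (l * x))" for k
    unfolding p_def[abs_def] by (rule higher_deriv_rescale[OF Q])
  have "trig_poly (\<lambda>x. Q (l * x))" unfolding Q_def by (intro trig_poly_power trig_poly.sin)
  then have "trig_poly p" unfolding p_def[abs_def] by (intro trig_poly.mult trig_poly.const)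
  moreover have "(deriv ^^ k) p 0 = 0" if "k < n" for k
    using higher_deriv_sin_power(1)[OF that] unfolding D by (simp add: Q_def[abs_def])
  moreover have "(deriv ^^ n) p 0 = r"
    using higher_deriv_sin_power(2)[of n] l unfolding D by (simp add: Q_def[abs_def] c_def)
  moreover have "\<bar>(deriv ^^ k) p x\<bar> \<le> (1/2) ^ n" if k: "k < n" for k x
  proof -
    have "B k \<le> (\<Sum>k<n. B k)" using k B0 by (intro member_le_sum) auto
    then have "2 ^ n * \<bar>c\<bar> * B k \<le> l"
      unfolding l_def by (intro order_trans[OF mult_left_mono[of "B k" "\<Sum>k<n. B k"]]) auto
    moreover have "l ^ k / l ^ n \<le> 1 / l"
    proof -
      have "l ^ k * l \<le> l ^ n" using power_increasing[of "Suc k" n l] k l by (simp add: mult.commute)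
      then show ?thesis using l by (simp add: field_simps)
    qed
    moreover have "\<bar>(deriv ^^ k) p x\<bar> = \<bar>c\<bar> * (l ^ k / l ^ n) * \<bar>(deriv ^^ k) Q (l * x)\<bar>"
      unfolding D using l by (simp add: abs_mult power_abs)
    moreover have "\<dots> \<le> \<bar>c\<bar> * (1 / l) * B k"
      using l B0 B by (intro mult_mono calculation(2)) auto
    ultimately have "\<bar>(deriv ^^ k) p x\<bar> \<le> \<bar>c\<bar> * B k / l" "2 ^ n * (\<bar>c\<bar> * B k) \<le> l" by (auto simp: mult_ac)
    then have "\<bar>c\<bar> * B k \<le> l / 2 ^ n" by (simp add: field_simps)
    then have "\<bar>c\<bar> * B k / l \<le> (l / 2 ^ n) / l" using l by (intro divide_right_mono) auto
    with \<open>\<bar>(deriv ^^ k) p x\<bar> \<le> \<bar>c\<bar> * B k / l\<close> have "\<bar>(deriv ^^ k) p x\<bar> \<le> (l / 2 ^ n) / l"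
      by linarith
    then show ?thesis using l by (simp add: power_divide)
  qed
  ultimately show ?thesis by blast
qed

text \<open>
  The function is a series of corrections. The \<open>n\<close>-th one adjusts the \<open>n\<close>-th derivative at the
  origin, leaves the lower ones unchanged and is so small that all derived series converge
  uniformly on the line.
\<close>
theorem borel:
  fixes d :: "nat \<Rightarrow> real"
  shows "\<exists>f. smooth_at 0 f \<and> (\<forall>k. (deriv ^^ k) f 0 = d k)"
proof -
  define P where "P n S \<longleftrightarrow> trig_poly S \<and> (\<forall>k<n. (deriv ^^ k) S 0 = d k)" for n :: nat and S
  define small where "small n S S' \<longleftrightarrow> (\<forall>k<n. \<forall>x. \<bar>(deriv ^^ k) S' x - (deriv ^^ k) S x\<bar> \<le> (1/2) ^ n)"
    for n and S S' :: "real \<Rightarrow> real"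
  have D_add: "(deriv ^^ k) (\<lambda>x. f x + g x) = (\<lambda>x. (deriv ^^ k) f x + (deriv ^^ k) g x)"
    if "trig_poly f" "trig_poly g" for f g k
  proof (induction k)
    case (Suc k)
    have "deriv (\<lambda>x. (deriv ^^ k) f x + (deriv ^^ k) g x) x = deriv ((deriv ^^ k) f) x + deriv ((deriv ^^ k) g) x" for x
      using that by (intro DERIV_imp_deriv DERIV_add trig_poly_deriv trig_poly_higher_deriv)
    then show ?case using Suc.IH by simp
  qed simp
  have "\<exists>S. P 0 S" unfolding P_def using trig_poly.const by blast
  moreover have "\<exists>S'. P (Suc n) S' \<and> small n S S'" if "P n S" for n S
  proof -
    obtain p where p: "trig_poly p" "\<And>k. k < n \<Longrightarrow> (deriv ^^ k) p 0 = 0"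
      "(deriv ^^ n) p 0 = d n - (deriv ^^ n) S 0"
      "\<And>k x. k < n \<Longrightarrow> \<bar>(deriv ^^ k) p x\<bar> \<le> (1/2) ^ n"
      using trig_poly_small[of n "d n - (deriv ^^ n) S 0"] by blast
    have S: "trig_poly S" using that by (simp add: P_def)
    have "P (Suc n) (\<lambda>x. S x + p x)"
      using that p unfolding P_def by (auto simp: D_add[OF S p(1)] less_Suc_eq intro: trig_poly.add)
    moreover have "small n S (\<lambda>x. S x + p x)"
      using p(4) unfolding small_def by (simp add: D_add[OF S p(1)])
    ultimately show ?thesis by blast
  qed
  ultimately obtain S where S: "\<And>n. P n (S n)" "\<And>n. small n (S n) (S (Suc n))"
    using dependent_nat_choice[of P small] by metis
  define p where "p k n x = (deriv ^^ k) (S (Suc n)) x - (deriv ^^ k) (S n) x" for k n x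
  define G where "G k x = (deriv ^^ k) (S 0) x + (\<Sum>n. p k n x)" for k x
  have trig: "trig_poly (S n)" for n using S(1) by (simp add: P_def)
  have D: "((deriv ^^ k) (S n) has_real_derivative (deriv ^^ Suc k) (S n) x) (at x)" for k n x
    using trig_poly_deriv(2)[OF trig_poly_higher_deriv[OF trig]] by simp
  have p': "(p k n has_real_derivative p (Suc k) n x) (at x)" for k n x
    unfolding p_def[abs_def] by (intro DERIV_diff D)
  have bound: "\<forall>\<^sub>F n in sequentially. \<forall>x\<in>UNIV. norm (p k n x) \<le> (1/2) ^ n" for k
    using eventually_gt_at_top[of k] by eventually_elim (use S(2) in \<open>auto simp: small_def p_def\<close>)
  have geo: "summable (\<lambda>n. (1/2) ^ n :: real)" by (rule summable_geometric) simp
  have summ: "summable (\<lambda>n. p k n x)" for k x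
    by (rule summable_comparison_test_ev[OF _ geo]) (use bound[of k] in \<open>auto elim: eventually_mono\<close>)
  have G: "(G k has_real_derivative G (Suc k) x) (at x)" for k x
  proof -
    have "\<exists>g. \<forall>x\<in>UNIV. (\<lambda>n. p k n x) sums g x \<and>
        (g has_field_derivative (\<Sum>n. p (Suc k) n x)) (at x within UNIV)"
      by (rule has_field_derivative_series[OF convex_UNIV p' Weierstrass_m_test_ev[OF bound geo] UNIV_I summ])
    then obtain g where g: "\<And>x. (\<lambda>n. p k n x) sums g x"
      "\<And>x. (g has_real_derivative (\<Sum>n. p (Suc k) n x)) (at x)" by auto
    have "G k = (\<lambda>x. (deriv ^^ k) (S 0) x + g x)"
      unfolding G_def[abs_def] using sums_unique[OF g(1)] by simp
    then show ?thesis unfolding G_def[of "Suc k"] using DERIV_add[OF D g(2)] by simp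
  qed
  have "G k 0 = d k" for k
  proof -
    have "(deriv ^^ k) (S n) 0 = d k" if "n > k" for n using S(1)[of n] that by (simp add: P_def)
    then have "\<forall>\<^sub>F n in sequentially. (deriv ^^ k) (S n) 0 = d k"
      using eventually_gt_at_top[of k] by (rule eventually_mono[rotated])
    then have "(\<lambda>n. (deriv ^^ k) (S n) 0) \<longlonglongrightarrow> d k" by (rule tendsto_eventually)
    from telescope_sums[OF this] show ?thesis
      unfolding G_def p_def by (simp add: sums_iff)
  qed
  moreover have "(deriv ^^ k) (G 0) = G k" for k
  proof (induction k)
    case (Suc k)
    have "deriv (G k) = G (Suc k)" by (intro ext DERIV_imp_deriv G)
    with Suc show ?case by simp
  qed simp
  moreover have "smooth_at 0 (G 0)"
    by (intro smooth_atI[of UNIV] C_k_on_derivative_sequence G) auto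
  ultimately show ?thesis by (intro exI[of _ "G 0"]) simp
qed

section \<open>Division by a power of the parameter\<close>

text \<open>
  Borel's theorem provides \<open>A\<^sub>0, \<dots>, A\<^sub>n\<^sub>-\<^sub>1\<close> for which the identity holds on the level of Taylor
  series. The remaining error is flat.
\<close>
theorem power_division:
  assumes "smooth_at 0 (f :: real \<Rightarrow> real)" "n > 0"
  shows "\<exists>A. (\<forall>k<n. smooth_at 0 (A k)) \<and> (\<forall>\<^sub>F t in nhds 0. f t = (\<Sum>k<n. t ^ k * A k (t ^ n)))"
proof -
  define c where "c m = (deriv ^^ m) f 0 / fact m" for m
  have "\<exists>A. smooth_at 0 A \<and> (\<forall>q. (deriv ^^ q) A 0 = fact q * c (q * n + k))" for k
    by (rule borel)
  then obtain A where A: "\<And>k. smooth_at 0 (A k)" "\<And>k q. (deriv ^^ q) (A k) 0 = fact q * c (q * n + k)"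
    by metis
  have pow: "smooth_at 0 (\<lambda>t::real. t ^ n)" by (intro smooth_intros)
  have comp: "smooth_at 0 (\<lambda>t. g (t ^ n))" if "smooth_at 0 g" for g :: "real \<Rightarrow> real"
    using that assms(2) by (intro smooth_at_compose[OF pow]) (simp add: zero_power)
  define h where "h t = f t - (\<Sum>k<n. t ^ k * A k (t ^ n))" for t
  have "flat h"
    unfolding flat_def
  proof (intro conjI allI)
    show "smooth_at 0 h" unfolding h_def[abs_def]
      by (intro smooth_at_diff smooth_at_sum smooth_at_mult smooth_at_power smooth_at_id comp assms(1) A)
    fix N
    obtain R where R: "smooth_at 0 R" "\<forall>\<^sub>F t in nhds 0. f t = (\<Sum>m<N * n. c m * t ^ m) + t ^ (N * n) * R t"
      using taylor_germ[OF assms(1), of "N * n"] unfolding c_def by blast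
    have "\<exists>R. smooth_at 0 R \<and> (\<forall>\<^sub>F u in nhds 0. A k u = (\<Sum>q<N. c (q * n + k) * u ^ q) + u ^ N * R u)" for k
      using taylor_germ[OF A(1)[of k], of N] by (simp add: A(2))
    then have "\<exists>S. \<forall>k. smooth_at 0 (S k) \<and>
        (\<forall>\<^sub>F u in nhds 0. A k u = (\<Sum>q<N. c (q * n + k) * u ^ q) + u ^ N * S k u)"
      by (intro choice allI)
    then obtain S where S: "\<And>k. smooth_at 0 (S k)"
      "\<And>k. \<forall>\<^sub>F u in nhds 0. A k u = (\<Sum>q<N. c (q * n + k) * u ^ q) + u ^ N * S k u" by blast
    \<comment> \<open>The two expansions agree up to order \<open>N n\<close>, which is at least the order \<open>N\<close> asked for.\<close>
    define T where "T t = t ^ (N * n - N) * (R t - (\<Sum>k<n. t ^ k * S k (t ^ n)))" for t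
    have "\<forall>\<^sub>F t in nhds 0. A k (t ^ n) = (\<Sum>q<N. c (q * n + k) * (t ^ n) ^ q) + (t ^ n) ^ N * S k (t ^ n)" for k
      by (rule smooth_at_eventually_compose[OF pow]) (use S(2)[of k] assms(2) in \<open>simp add: zero_power\<close>)
    then have "\<forall>\<^sub>F t in nhds 0. \<forall>k\<in>{..<n}. A k (t ^ n) =
        (\<Sum>q<N. c (q * n + k) * (t ^ n) ^ q) + (t ^ n) ^ N * S k (t ^ n)"
      by (intro eventually_ball_finite) auto
    with R(2) have "\<forall>\<^sub>F t in nhds 0. h t = t ^ N * T t"
    proof eventually_elim
      case (elim t)
      have "(\<Sum>k<n. t ^ k * A k (t ^ n)) =
          (\<Sum>k<n. \<Sum>q<N. c (q * n + k) * t ^ (q * n + k)) + t ^ (N * n) * (\<Sum>k<n. t ^ k * S k (t ^ n))"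
        using elim(2) by (simp add: sum.distrib sum_distrib_left distrib_left power_add power_mult mult_ac
            flip: power_mult)
      also have "(\<Sum>k<n. \<Sum>q<N. c (q * n + k) * t ^ (q * n + k)) = (\<Sum>m<N * n. c m * t ^ m)"
      proof -
        have "(\<Sum>m<N * n. c m * t ^ m) = (\<Sum>q<N. \<Sum>m = q * n..<q * n + n. c m * t ^ m)"
          by (rule sum.nat_group[symmetric])
        also have "\<dots> = (\<Sum>q<N. \<Sum>k<n. c (q * n + k) * t ^ (q * n + k))"
        proof (rule sum.cong[OF refl])
          show "(\<Sum>m = q * n..<q * n + n. c m * t ^ m) = (\<Sum>k<n. c (q * n + k) * t ^ (q * n + k))" for q
            by (rule sum.reindex_bij_witness[of _ "\<lambda>k. q * n + k" "\<lambda>m. m - q * n"]) auto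
        qed
        finally show ?thesis by (simp add: sum.swap[of _ "{..<n}"])
      qed
      finally have "h t = t ^ (N * n) * (R t - (\<Sum>k<n. t ^ k * S k (t ^ n)))"
        unfolding h_def elim(1) by (simp add: algebra_simps)
      moreover have "t ^ (N * n) = t ^ N * t ^ (N * n - N)"
        using assms(2) by (simp flip: power_add)
      ultimately show ?case by (simp add: T_def mult.assoc)
    qed
    moreover have "smooth_at 0 T" unfolding T_def[abs_def]
      by (intro smooth_at_diff smooth_at_sum smooth_at_mult smooth_at_power smooth_at_id comp R S)
    ultimately show "\<exists>R. smooth_at 0 R \<and> (\<forall>\<^sub>F t in nhds 0. h t = t ^ N * R t)" by blast
  qed
  from flat_division[OF this assms(2)] obtain E where
    E: "\<And>k. k < n \<Longrightarrow> smooth_at 0 (E k)" "\<forall>\<^sub>F t in nhds 0. h t = (\<Sum>k<n. t ^ k * E k (t ^ n))" by blast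
  have "\<forall>\<^sub>F t in nhds 0. f t = (\<Sum>k<n. t ^ k * (A k (t ^ n) + E k (t ^ n)))"
    using E(2) by eventually_elim (simp add: h_def distrib_left sum.distrib)
  then show ?thesis using A(1) E(1)
    by (intro exI[of _ "\<lambda>k u. A k u + E k u"]) (auto intro: smooth_at_add)
qed

section \<open>Diffeomorphism germs and equivalence of map germs\<close>

text \<open>
  The inverse \<open>g\<close> has derivative \<open>(f'(g y))\<^sup>-\<^sup>1\<close>, so it gains one order of differentiability for each
  order already known, provided that inverting the derivative preserves the class \<open>C\<^sup>k\<close>. That last
  point is the hypothesis \<open>inv_C_k\<close>, which is checked separately on the line and in the plane.
\<close>
lemma diffeo_germ_from_derivative:
  fixes f :: "'a::euclidean_space \<Rightarrow> 'a"
  assumes "open U" "p \<in> U" "\<And>k. C_k_on k U f" "inj (frechet_derivative f (at p))"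
    and inv_C_k: "\<And>k (V :: 'a set) g v. open V \<Longrightarrow> C_k_on k V g \<Longrightarrow> g ` V \<subseteq> U \<Longrightarrow>
      (\<And>y. y \<in> V \<Longrightarrow> bij (frechet_derivative f (at (g y)))) \<Longrightarrow>
      C_k_on k V (\<lambda>y. inv (frechet_derivative f (at (g y))) v)"
  shows "\<exists>\<psi>. diffeo_germ p (f p) f \<psi>"
proof -
  define f' where "f' x = Blinfun (frechet_derivative f (at x))" for x
  have D: "(f has_derivative frechet_derivative f (at x)) (at x)" if "x \<in> U" for x
    using assms(3)[of 1] that by (auto simp: frechet_derivative_works)
  have f': "blinfun_apply (f' x) = frechet_derivative f (at x)" if "x \<in> U" for x
    unfolding f'_def by (rule bounded_linear_Blinfun_apply[OF has_derivative_bounded_linear[OF D[OF that]]])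
  have cont: "continuous_on U f'"
  proof (rule continuous_on_blinfun_componentwise)
    fix i :: 'a
    have "continuous_on U (\<lambda>x. frechet_derivative f (at x) i)" using assms(3)[of 1] by simp
    then show "continuous_on U (\<lambda>x. blinfun_apply (f' x) i)"
      by (rule continuous_on_eq) (simp add: f')
  qed
  have lin: "linear (frechet_derivative f (at p))"
    by (rule has_derivative_linear[OF D[OF assms(2)]])
  obtain h where h: "linear h" "h \<circ> frechet_derivative f (at p) = id"
    using linear_injective_left_inverse[OF lin assms(4)] by blast
  have "Blinfun h o\<^sub>L f' p = id_blinfun"
    using h(2) by (intro blinfun_eqI)
      (simp add: f'[OF assms(2)] bounded_linear_Blinfun_apply linear_conv_bounded_linear[symmetric] h(1) fun_eq_iff)
  from inverse_function_theorem[OF assms(1) _ cont assms(2) this] D f'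
  obtain U' V g g' where *: "open U'" "U' \<subseteq> U" "p \<in> U'" "open V" "homeomorphism U' V f g"
    "\<And>y. y \<in> V \<Longrightarrow> (g has_derivative g' y) (at y)"
    "\<And>y. y \<in> V \<Longrightarrow> g' y = inv (blinfun_apply (f' (g y)))"
    "\<And>y. y \<in> V \<Longrightarrow> bij (blinfun_apply (f' (g y)))"
    by (metis (no_types, lifting))
  have gV: "g ` V \<subseteq> U" using *(2,5) by (auto simp: homeomorphism_def)
  have bij: "bij (frechet_derivative f (at (g y)))" if "y \<in> V" for y
    using *(8)[OF that] f' gV that by (metis image_subset_iff)
  have g: "(g has_derivative inv (frechet_derivative f (at (g y)))) (at y)" if "y \<in> V" for y
    using *(6,7)[OF that] f' gV that by (metis image_subset_iff)
  have "C_k_on k V g" for k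
  proof (induction k)
    case 0
    then show ?case using *(5) by (simp add: homeomorphism_def)
  next
    case (Suc k)
    show ?case
      by (rule C_k_on_SucI[OF *(4) g inv_C_k[OF *(4) Suc gV bij]])
  qed
  then have "smooth_on V g" using *(4) by (auto simp: smooth_on_open_iff intro: smooth_atI)
  moreover have "smooth_on U' f"
    using assms(1,3) *(1,2) by (auto simp: smooth_on_open_iff intro: smooth_atI)
  ultimately show ?thesis unfolding diffeo_germ_def using * by blast
qed

lemma diffeo_germ_real:
  fixes f :: "real \<Rightarrow> real"
  assumes "smooth_at a f" "deriv f a \<noteq> 0"
  shows "\<exists>\<psi>. diffeo_germ a (f a) f \<psi>"
proof -
  obtain U where U: "open U" "a \<in> U" "\<And>k. C_k_on k U f"
    using assms(1) unfolding smooth_at_def by blast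
  have D: "frechet_derivative f (at x) = (\<lambda>v. v * frechet_derivative f (at x) 1)" if "x \<in> U" for x
  proof -
    have "linear (frechet_derivative f (at x))"
      using U(3)[of 1] that by (auto simp: frechet_derivative_works intro: has_derivative_linear)
    from linear_scale[OF this, of _ 1]
    have "frechet_derivative f (at x) v = v * frechet_derivative f (at x) 1" for v
      unfolding real_scaleR_def mult_1_right .
    then show ?thesis by (rule ext)
  qed
  have "frechet_derivative f (at a) = (\<lambda>v. deriv f a * v)"
    using smooth_at_has_real_derivative[OF assms(1)] frechet_derivative_at
    by (metis has_field_derivative_def)
  with assms(2) have "inj (frechet_derivative f (at a))" by (auto simp: inj_def)
  moreover have "C_k_on k V (\<lambda>y. inv (frechet_derivative f (at (g y))) v)"
    if V: "open V" "C_k_on k V g" "g ` V \<subseteq> U"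
      and bij: "\<And>y. y \<in> V \<Longrightarrow> bij (frechet_derivative f (at (g y)))" for k and V :: "real set" and g v
  proof -
    let ?d = "\<lambda>y. frechet_derivative f (at (g y)) 1"
    have ne: "?d y \<noteq> 0" if "y \<in> V" for y
    proof
      assume "?d y = 0"
      then have "frechet_derivative f (at (g y)) 0 = frechet_derivative f (at (g y)) 1"
        using D[of "g y"] V(3) that by (metis image_subset_iff mult_zero_right)
      from injD[OF bij_is_inj[OF bij[OF that]] this] show False by simp
    qed
    have inv_eq: "v * inverse (?d y) = inv (frechet_derivative f (at (g y))) v" if "y \<in> V" for y
    proof (rule inv_f_eq[OF bij_is_inj[OF bij[OF that]], symmetric])
      have "frechet_derivative f (at (g y)) w = w * ?d y" for w
        using D[of "g y"] V(3) that by (metis image_subset_iff)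
      from this[of "v * inverse (?d y)"]
      show "frechet_derivative f (at (g y)) (v * inverse (?d y)) = v"
        unfolding mult.assoc left_inverse[OF ne[OF that]] mult_1_right .
    qed
    have "C_k_on k V ?d"
      using C_k_on_compose[OF V(1) U(1) V(3,2), of "\<lambda>x. frechet_derivative f (at x) 1"] U(3)[of "Suc k"] by simp
    then have "C_k_on k V (\<lambda>y. inverse (?d y))"
      by (rule C_k_on_compose[OF V(1) _ _ _ C_k_on_inverse, rotated 2]) (use ne in auto)
    then have "C_k_on k V (\<lambda>y. v * inverse (?d y))"
      by (intro C_k_on_mult V C_k_on_const)
    from C_k_on_cong[OF V(1) inv_eq this] show ?thesis by blast
  qed
  ultimately show ?thesis by (rule diffeo_germ_from_derivative[OF U])
qed

definition det2 :: "real \<times> real \<Rightarrow> real \<times> real \<Rightarrow> real" where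
  "det2 u w = fst u * snd w - snd u * fst w"

lemma linear_plane:
  assumes "linear (L :: real \<times> real \<Rightarrow> real \<times> real)"
  shows "L v = fst v *\<^sub>R L (1, 0) + snd v *\<^sub>R L (0, 1)"
proof -
  have "v = fst v *\<^sub>R (1, 0) + snd v *\<^sub>R (0, 1)" by (simp add: prod_eq_iff)
  then show ?thesis using linear_add[OF assms] linear_scale[OF assms] by metis
qed

lemma det2_eq_0_dependent:
  assumes "det2 u w = 0"
  shows "\<exists>a b. (a, b) \<noteq> (0, 0) \<and> a *\<^sub>R u + b *\<^sub>R w = 0"
proof (cases "u = 0")
  case True
  then show ?thesis by (intro exI[of _ 1] exI[of _ 0]) simp
next
  case False
  show ?thesis
  proof (cases "fst u = 0")
    case True
    with False assms show ?thesis
      by (intro exI[of _ "snd w"] exI[of _ "- snd u"]) (auto simp: prod_eq_iff det2_def)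
  next
    case False
    with assms show ?thesis
      by (intro exI[of _ "fst w"] exI[of _ "- fst u"]) (auto simp: prod_eq_iff det2_def algebra_simps)
  qed
qed

lemma inj_linear_plane_iff:
  assumes "linear (L :: real \<times> real \<Rightarrow> real \<times> real)"
  shows "inj L \<longleftrightarrow> det2 (L (1, 0)) (L (0, 1)) \<noteq> 0"
proof
  assume "inj L"
  show "det2 (L (1, 0)) (L (0, 1)) \<noteq> 0"
  proof
    assume "det2 (L (1, 0)) (L (0, 1)) = 0"
    then obtain a b where ab: "(a, b) \<noteq> (0, 0)" "a *\<^sub>R L (1, 0) + b *\<^sub>R L (0, 1) = 0"
      using det2_eq_0_dependent by blast
    then have "L (a, b) = 0" using linear_plane[OF assms, of "(a, b)"] by simp
    then have "(a, b) = 0" using \<open>inj L\<close> linear_injective_0[OF assms] by blast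
    with ab show False by (simp add: zero_prod_def)
  qed
next
  assume *: "det2 (L (1, 0)) (L (0, 1)) \<noteq> 0"
  show "inj L"
    unfolding linear_injective_0[OF assms]
  proof (intro allI impI)
    fix v assume "L v = 0"
    then have "fst v *\<^sub>R L (1, 0) + snd v *\<^sub>R L (0, 1) = 0" using linear_plane[OF assms, of v] by simp
    then have "fst v * fst (L (1, 0)) + snd v * fst (L (0, 1)) = 0"
      "fst v * snd (L (1, 0)) + snd v * snd (L (0, 1)) = 0" by (auto simp: prod_eq_iff)
    then have "fst v * det2 (L (1, 0)) (L (0, 1)) = 0" "snd v * det2 (L (1, 0)) (L (0, 1)) = 0"
      unfolding det2_def by algebra+
    with * show "v = 0" by (simp add: prod_eq_iff)
  qed
qed

text \<open>Cramer's rule expresses the derivative of the inverse by the partial derivatives of \<open>f\<close>.\<close>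
lemma diffeo_germ_plane:
  fixes f :: "real \<times> real \<Rightarrow> real \<times> real"
  assumes "smooth_at p f"
    and "det2 (frechet_derivative f (at p) (1, 0)) (frechet_derivative f (at p) (0, 1)) \<noteq> 0"
  shows "\<exists>\<psi>. diffeo_germ p (f p) f \<psi>"
proof -
  obtain U where U: "open U" "p \<in> U" "\<And>k. C_k_on k U f"
    using assms(1) unfolding smooth_at_def by blast
  let ?D = "\<lambda>x. frechet_derivative f (at x)"
  have lin: "linear (?D x)" if "x \<in> U" for x
    using U(3)[of 1] that by (auto simp: frechet_derivative_works intro: has_derivative_linear)
  have "inj (?D p)" using assms(2) inj_linear_plane_iff[OF lin[OF U(2)]] by simp
  moreover have "C_k_on k V (\<lambda>y. inv (?D (g y)) v)"
    if V: "open V" "C_k_on k V g" "g ` V \<subseteq> U" and bij: "\<And>y. y \<in> V \<Longrightarrow> bij (?D (g y))"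
    for k and V :: "(real \<times> real) set" and g v
  proof -
    define u w where "u y = ?D (g y) (1, 0)" and "w y = ?D (g y) (0, 1)" for y
    define d where "d y = det2 (u y) (w y)" for y
    have linV: "linear (?D (g y))" if "y \<in> V" for y using lin V(3) that by blast
    have ne: "d y \<noteq> 0" if "y \<in> V" for y
      using inj_linear_plane_iff[OF linV[OF that]] bij_is_inj[OF bij[OF that]]
      unfolding d_def u_def w_def by simp
    define N where "N y = inverse (d y) *\<^sub>R
      (fst v * snd (w y) + (- snd v) * fst (w y), snd v * fst (u y) + (- fst v) * snd (u y))" for y
    have N: "N y = inv (?D (g y)) v" if "y \<in> V" for y
    proof (rule inv_f_eq[OF bij_is_inj[OF bij[OF that]], symmetric])
      have "?D (g y) (N y) = fst (N y) *\<^sub>R u y + snd (N y) *\<^sub>R w y"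
        unfolding u_def w_def by (rule linear_plane[OF linV[OF that]])
      also have "\<dots> = v"
      proof -
        have "inverse (d y) * (fst (u y) * snd (w y) - snd (u y) * fst (w y)) = 1"
          using left_inverse[OF ne[OF that]] unfolding d_def det2_def .
        then show ?thesis unfolding N_def prod_eq_iff fst_add snd_add fst_scaleR snd_scaleR
            fst_conv snd_conv real_scaleR_def by algebra
      qed
      finally show "?D (g y) (N y) = v" .
    qed
    have "C_k_on k V u" "C_k_on k V w"
      unfolding u_def w_def using U(3)[of "Suc k"] 
      by (intro C_k_on_compose[OF V(1) U(1) V(3,2), of "\<lambda>x. ?D x (1, 0)"]
          C_k_on_compose[OF V(1) U(1) V(3,2), of "\<lambda>x. ?D x (0, 1)"]; simp)+
    then have c: "C_k_on k V (\<lambda>y. fst (u y))" "C_k_on k V (\<lambda>y. snd (u y))"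
      "C_k_on k V (\<lambda>y. fst (w y))" "C_k_on k V (\<lambda>y. snd (w y))"
      using V(1) by (auto intro: C_k_on_bounded_linear_comp bounded_linear_fst bounded_linear_snd)
    have "C_k_on k V d" unfolding d_def[abs_def] det2_def
      using C_k_on_add[OF V(1) C_k_on_mult[OF V(1) c(1,4)]
          C_k_on_mult[OF V(1) C_k_on_mult[OF V(1) c(2) C_k_on_const[of _ _ "-1"]] c(3)]] by simp
    then have d: "C_k_on k V (\<lambda>y. inverse (d y))"
      by (rule C_k_on_compose[OF V(1) _ _ _ C_k_on_inverse, rotated 2]) (use ne in auto)
    have pair: "C_k_on k V (\<lambda>y. (a y, b y))" if "C_k_on k V a" "C_k_on k V b" for a b :: "real \<times> real \<Rightarrow> real"
    proof -
      have "bounded_linear (\<lambda>y::real. (y, 0::real))" "bounded_linear (\<lambda>y::real. (0::real, y))"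
        by (intro bounded_linear_Pair bounded_linear_ident bounded_linear_zero)+
      from C_k_on_add[OF V(1) this[THEN C_k_on_bounded_linear_comp, OF V(1)], OF that]
      show ?thesis by simp
    qed
    have "C_k_on k V N" unfolding N_def[abs_def]
      by (intro C_k_on_bilinear[OF bounded_bilinear_scaleR V(1) d] pair
          C_k_on_add[OF V(1)] C_k_on_mult[OF V(1) C_k_on_const] c)
    from C_k_on_cong[OF V(1) N this] show ?thesis by blast
  qed
  ultimately show ?thesis by (rule diffeo_germ_from_derivative[OF U])
qed

lemma diffeo_germ_sym: "diffeo_germ p q \<phi> \<psi> \<Longrightarrow> diffeo_germ q p \<psi> \<phi>"
  unfolding diffeo_germ_def using homeomorphism_sym
  by (metis homeomorphism_apply1 homeomorphism_image1 image_eqI)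

lemma diffeo_germ_id: "diffeo_germ p p (\<lambda>x. x) (\<lambda>x. x)"
  unfolding diffeo_germ_def
  by (intro conjI refl exI[of _ UNIV]) (auto simp: homeomorphism_def smooth_on_open_iff smooth_at_id)

lemma diffeo_germ_forward:
  assumes "diffeo_germ p q \<phi> \<psi>"
  shows "\<phi> p = q \<and> smooth_at p \<phi> \<and> (\<forall>\<^sub>F x in nhds p. \<psi> (\<phi> x) = x)"
  using assms unfolding diffeo_germ_def eventually_nhds
  by (metis homeomorphism_apply1 smooth_on_open_iff)

lemma diffeo_germD:
  assumes "diffeo_germ p q \<phi> \<psi>"
  shows "\<phi> p = q" "\<psi> q = p" "smooth_at p \<phi>" "smooth_at q \<psi>"
    "\<forall>\<^sub>F x in nhds p. \<psi> (\<phi> x) = x" "\<forall>\<^sub>F y in nhds q. \<phi> (\<psi> y) = y"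
  using diffeo_germ_forward[OF assms] diffeo_germ_forward[OF diffeo_germ_sym[OF assms]] by auto

lemma diffeo_germ_trans:
  assumes "diffeo_germ p q \<phi> \<psi>" "diffeo_germ q r \<phi>' \<psi>'"
  shows "diffeo_germ p r (\<phi>' \<circ> \<phi>) (\<psi> \<circ> \<psi>')"
proof -
  obtain U V where U: "open U" "open V" "p \<in> U" "homeomorphism U V \<phi> \<psi>" "smooth_on U \<phi>" "smooth_on V \<psi>"
    and pq: "\<phi> p = q" using assms(1) unfolding diffeo_germ_def by blast
  obtain U' V' where U': "open U'" "open V'" "q \<in> U'" "homeomorphism U' V' \<phi>' \<psi>'" "smooth_on U' \<phi>'" "smooth_on V' \<psi>'"
    and qr: "\<phi>' q = r" using assms(2) unfolding diffeo_germ_def by blast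
  define A where "A = U \<inter> \<phi> -` U'"
  define B where "B = V' \<inter> \<psi>' -` V"
  have img: "\<phi> ` A = V \<inter> U'" "\<phi>' ` (V \<inter> U') = B"
    using U(4) U'(4) unfolding A_def B_def homeomorphism_def by force+
  have "open A" "open B"
    using U U' continuous_open_preimage[of U \<phi> U'] continuous_open_preimage[of V' \<psi>' V]
    unfolding A_def B_def homeomorphism_def by auto
  moreover have "homeomorphism A B (\<phi>' \<circ> \<phi>) (\<psi> \<circ> \<psi>')"
    by (rule homeomorphism_compose[OF homeomorphism_of_subsets[OF U(4) _ _ img(1)]
          homeomorphism_of_subsets[OF U'(4) _ _ img(2)]]) (auto simp: A_def B_def)
  moreover have "smooth_on A (\<phi>' \<circ> \<phi>)"
    unfolding smooth_on_open_iff[OF \<open>open A\<close>] comp_def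
    using U U' by (auto simp: A_def smooth_on_open_iff intro: smooth_at_compose)
  moreover have "smooth_on B (\<psi> \<circ> \<psi>')"
    unfolding smooth_on_open_iff[OF \<open>open B\<close>] comp_def
    using U U' by (auto simp: B_def smooth_on_open_iff intro: smooth_at_compose)
  ultimately show ?thesis
    unfolding diffeo_germ_def using pq qr U(3) U'(3)
    by (intro conjI exI[of _ A] exI[of _ B]) (auto simp: A_def)
qed

lemma A_equivalent_trans:
  assumes "A_equivalent f p g q" "A_equivalent g q h r"
  shows "A_equivalent f p h r"
proof -
  obtain \<phi> \<psi> \<Phi> \<Psi> where 1: "diffeo_germ p q \<phi> \<psi>" "diffeo_germ (f p) (g q) \<Phi> \<Psi>"
    "\<forall>\<^sub>F s in nhds q. g s = (\<Phi> \<circ> f \<circ> \<psi>) s" using assms(1) unfolding A_equivalent_def by blast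
  obtain \<phi>' \<psi>' \<Phi>' \<Psi>' where 2: "diffeo_germ q r \<phi>' \<psi>'" "diffeo_germ (g q) (h r) \<Phi>' \<Psi>'"
    "\<forall>\<^sub>F s in nhds r. h s = (\<Phi>' \<circ> g \<circ> \<psi>') s" using assms(2) unfolding A_equivalent_def by blast
  note d = diffeo_germD[OF 2(1)]
  have "\<forall>\<^sub>F s in nhds r. g (\<psi>' s) = (\<Phi> \<circ> f \<circ> \<psi>) (\<psi>' s)"
    by (rule smooth_at_eventually_compose[OF d(4)]) (use d(2) 1(3) in simp)
  with 2(3) have "\<forall>\<^sub>F s in nhds r. h s = ((\<Phi>' \<circ> \<Phi>) \<circ> f \<circ> (\<psi> \<circ> \<psi>')) s"
    by eventually_elim simp
  then show ?thesis unfolding A_equivalent_def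
    using diffeo_germ_trans[OF 1(1) 2(1)] diffeo_germ_trans[OF 1(2) 2(2)] by blast
qed

lemma A_equivalent_target:
  assumes "diffeo_germ (f p) q \<Phi> \<Psi>" "\<forall>\<^sub>F s in nhds p. g s = \<Phi> (f s)"
  shows "A_equivalent f p g p"
proof -
  have "g p = q" using eventually_nhds_x_imp_x[OF assms(2)] diffeo_germD(1)[OF assms(1)] by simp
  then show ?thesis unfolding A_equivalent_def using assms diffeo_germ_id[of p]
    by (intro exI[of _ "\<lambda>x. x"] exI[of _ \<Phi>] exI[of _ \<Psi>] conjI) auto
qed

lemma A_equivalent_source:
  assumes "diffeo_germ q p \<kappa> \<kappa>'" "\<forall>\<^sub>F s in nhds q. g s = f (\<kappa> s)"
  shows "A_equivalent f p g q"
proof -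
  have "g q = f p" using eventually_nhds_x_imp_x[OF assms(2)] diffeo_germD(1)[OF assms(1)] by simp
  then show ?thesis unfolding A_equivalent_def
    using diffeo_germ_sym[OF assms(1)] diffeo_germ_id[of "f p"] assms(2)
    by (intro exI[of _ \<kappa>'] exI[of _ \<kappa>] exI[of _ "\<lambda>x. x"] conjI) auto
qed

section \<open>Normal forms of graph-like curve germs\<close>

lemma diffeo_germ_planeI:
  assumes "smooth_at (p, q) \<Phi>"
    and "((\<lambda>s. \<Phi> (s, q)) has_vector_derivative u) (at p)"
    and "((\<lambda>s. \<Phi> (p, s)) has_vector_derivative w) (at q)"
    and "det2 u w \<noteq> 0"
  shows "\<exists>\<Psi>. diffeo_germ (p, q) (\<Phi> (p, q)) \<Phi> \<Psi>"
proof -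
  let ?D = "frechet_derivative \<Phi> (at (p, q))"
  have D: "(\<Phi> has_derivative ?D) (at (p, q))" using smooth_at_has_derivative[OF assms(1)] .
  have "((\<lambda>s. \<Phi> (s, q)) has_derivative (\<lambda>h. ?D (h, 0))) (at p)"
    by (rule has_derivative_compose[of "\<lambda>s. (s, q)" _ p UNIV, OF _ D]) (auto intro!: derivative_eq_intros)
  moreover have "((\<lambda>s. \<Phi> (p, s)) has_derivative (\<lambda>h. ?D (0, h))) (at q)"
    by (rule has_derivative_compose[of "\<lambda>s. (p, s)" _ q UNIV, OF _ D]) (auto intro!: derivative_eq_intros)
  ultimately have "(\<lambda>h. ?D (h, 0)) = (\<lambda>h. h *\<^sub>R u)" "(\<lambda>h. ?D (0, h)) = (\<lambda>h. h *\<^sub>R w)"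
    using assms(2,3) has_derivative_unique unfolding has_vector_derivative_def by blast+
  then have "?D (1, 0) = u" "?D (0, 1) = w" by (auto dest: fun_cong[of _ _ 1])
  with assms(1,4) show ?thesis by (intro diffeo_germ_plane) auto
qed

lemma diffeo_germ_shear:
  fixes a c :: "real \<Rightarrow> real"
  assumes "smooth_at p a" "smooth_at p c" "c p \<noteq> (0::real)"
  shows "\<exists>\<Psi>. diffeo_germ (p, q) (p, (q - a p) / c p) (\<lambda>w. (fst w, (snd w - a (fst w)) / c (fst w))) \<Psi>"
proof -
  define \<Phi> where "\<Phi> w = (fst w, (snd w - a (fst w)) / c (fst w))" for w :: "real \<times> real"
  have fst: "smooth_at (p, q) fst" using smooth_at_fst[OF smooth_at_id] .
  have sa: "smooth_at (p, q) (\<lambda>w. a (fst w))" "smooth_at (p, q) (\<lambda>w. c (fst w))"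
    using smooth_at_compose[OF fst, of a] smooth_at_compose[OF fst, of c] assms by auto
  have "smooth_at (p, q) \<Phi>"
    unfolding \<Phi>_def[abs_def] by (intro smooth_at_Pair smooth_at_divide smooth_at_diff smooth_at_snd smooth_at_id fst sa)
      (use assms in auto)
  moreover have "smooth_at p (\<lambda>s. (q - a s) / c s)" by (intro smooth_intros assms)
  then have "((\<lambda>s. (q - a s) / c s) has_vector_derivative deriv (\<lambda>s. (q - a s) / c s) p) (at p)"
    using smooth_at_has_real_derivative has_real_derivative_iff_has_vector_derivative by blast
  then have "((\<lambda>s. \<Phi> (s, q)) has_vector_derivative (1, deriv (\<lambda>s. (q - a s) / c s) p)) (at p)"
    unfolding \<Phi>_def fst_conv snd_conv by (intro has_vector_derivative_Pair has_vector_derivative_id)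
  moreover have "((\<lambda>s. (s - a p) / c p) has_real_derivative 1 / c p) (at q)"
    using assms(3) by (auto intro!: derivative_eq_intros)
  then have "((\<lambda>s. \<Phi> (p, s)) has_vector_derivative (0, 1 / c p)) (at q)"
    unfolding \<Phi>_def fst_conv snd_conv has_real_derivative_iff_has_vector_derivative
    by (intro has_vector_derivative_Pair has_vector_derivative_const)
  ultimately have "\<exists>\<Psi>. diffeo_germ (p, q) (\<Phi> (p, q)) \<Phi> \<Psi>"
    by (rule diffeo_germ_planeI) (use assms(3) in \<open>simp add: det2_def\<close>)
  then show ?thesis unfolding \<Phi>_def[abs_def] by simp
qed

text \<open>
  The map \<open>(u, v) \<mapsto> (u, (v - a u) / c u)\<close> is a diffeomorphism near points where \<open>c\<close> does not vanish.
  It subtracts functions of the first coordinate and divides by nonvanishing ones.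
\<close>
lemma A_equivalent_shear:
  fixes a c Y y :: "real \<Rightarrow> real"
  assumes "smooth_at 0 a" "smooth_at 0 c" "c 0 \<noteq> 0" "i > 0"
    and "\<forall>\<^sub>F s in nhds 0. Y s = a (s ^ i) + c (s ^ i) * y s"
  shows "A_equivalent (\<lambda>s. (s ^ i, Y s)) 0 (\<lambda>s. (s ^ i, y s)) (0::real)"
proof -
  obtain \<Psi> where "diffeo_germ (0, Y 0) (0, (Y 0 - a 0) / c 0)
      (\<lambda>w. (fst w, (snd w - a (fst w)) / c (fst w))) \<Psi>"
    using diffeo_germ_shear[OF assms(1-3)] by blast
  moreover have "smooth_at 0 (\<lambda>s::real. s ^ i)" by (intro smooth_intros)
  then have "\<forall>\<^sub>F s in nhds 0. c (s ^ i) \<noteq> 0"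
    by (rule smooth_at_eventually_compose)
       (use smooth_at_eventually_nonzero[OF assms(2,3)] assms(4) in \<open>simp add: zero_power\<close>)
  with assms(5) have "\<forall>\<^sub>F s in nhds 0. (s ^ i, y s) =
      (\<lambda>w. (fst w, (snd w - a (fst w)) / c (fst w))) (s ^ i, Y s)"
    by eventually_elim simp
  ultimately show ?thesis using assms(4)
    by (intro A_equivalent_target[where f="\<lambda>s. (s ^ i, Y s)"]) (auto simp: zero_power)
qed

text \<open>
  The polynomial keeps finitely many coefficients visible, while the remainder is sorted by the
  residues of the exponents modulo \<open>n\<close>.
\<close>
lemma taylor_germ_division:
  fixes Y :: "real \<Rightarrow> real"
  assumes "smooth_at 0 Y" "n > 0"
  shows "\<exists>A. (\<forall>k<n. smooth_at 0 (A k)) \<and> (\<forall>\<^sub>F t in nhds 0. Y t =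
    (\<Sum>k<N. (deriv ^^ k) Y 0 / fact k * t ^ k) + t ^ N * (\<Sum>k<n. t ^ k * A k (t ^ n)))"
proof -
  obtain R where R: "smooth_at 0 R"
    "\<forall>\<^sub>F t in nhds 0. Y t = (\<Sum>k<N. (deriv ^^ k) Y 0 / fact k * t ^ k) + t ^ N * R t"
    using taylor_germ[OF assms(1)] by blast
  obtain A where A: "\<forall>k<n. smooth_at 0 (A k)" "\<forall>\<^sub>F t in nhds 0. R t = (\<Sum>k<n. t ^ k * A k (t ^ n))"
    using power_division[OF R(1) assms(2)] by blast
  have "\<forall>\<^sub>F t in nhds 0. Y t =
    (\<Sum>k<N. (deriv ^^ k) Y 0 / fact k * t ^ k) + t ^ N * (\<Sum>k<n. t ^ k * A k (t ^ n))"
    using R(2) A(2) by eventually_elim simp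
  with A(1) show ?thesis by blast
qed

text \<open>
  The even part of \<open>Y\<close> is a function of \<open>s\<^sup>2\<close>, and the odd part is \<open>s\<^sup>3\<close> times a nonvanishing function
  of \<open>s\<^sup>2\<close>. Both are removed by a shear.
\<close>
lemma normal_form_3_2:
  fixes Y :: "real \<Rightarrow> real"
  assumes "smooth_at 0 Y" "(deriv ^^ 1) Y 0 = 0" "(deriv ^^ 3) Y 0 \<noteq> 0"
  shows "A_equivalent (\<lambda>s. (s ^ 2, Y s)) 0 (\<lambda>s. (s ^ 2, s ^ 3)) (0::real)"
proof -
  define y where "y k = (deriv ^^ k) Y 0 / fact k" for k
  obtain A where A: "\<forall>k<2. smooth_at 0 (A k)"
    "\<forall>\<^sub>F t in nhds 0. Y t = (\<Sum>k<4. y k * t ^ k) + t ^ 4 * (\<Sum>k<2. t ^ k * A k (t ^ 2))"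
    using taylor_germ_division[OF assms(1), of 2 4] unfolding y_def by auto
  have y1: "y 1 = 0" using assms(2) by (simp add: y_def)
  define a where "a u = y 0 + y 2 * u + u ^ 2 * A 0 u" for u
  define c where "c u = y 3 + u * A 1 u" for u
  have "\<forall>\<^sub>F t in nhds 0. Y t = a (t ^ 2) + c (t ^ 2) * t ^ 3"
    using A(2) by eventually_elim (simp add: a_def c_def y1[simplified] eval_nat_numeral algebra_simps)
  moreover have "smooth_at 0 a" "smooth_at 0 c"
    unfolding a_def[abs_def] c_def[abs_def] using A(1) by (intro smooth_intros; simp)+
  moreover have "c 0 \<noteq> 0" using assms(3) by (simp add: c_def y_def)
  ultimately show ?thesis by (intro A_equivalent_shear) auto
qed

lemma normal_form_5_2:
  fixes Y :: "real \<Rightarrow> real"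
  assumes "smooth_at 0 Y" "(deriv ^^ 1) Y 0 = 0" "(deriv ^^ 3) Y 0 = 0" "(deriv ^^ 5) Y 0 \<noteq> 0"
  shows "A_equivalent (\<lambda>s. (s ^ 2, Y s)) 0 (\<lambda>s. (s ^ 2, s ^ 5)) (0::real)"
proof -
  define y where "y k = (deriv ^^ k) Y 0 / fact k" for k
  obtain A where A: "\<forall>k<2. smooth_at 0 (A k)"
    "\<forall>\<^sub>F t in nhds 0. Y t = (\<Sum>k<6. y k * t ^ k) + t ^ 6 * (\<Sum>k<2. t ^ k * A k (t ^ 2))"
    using taylor_germ_division[OF assms(1), of 2 6] unfolding y_def by auto
  have y13: "y (Suc 0) = 0" "y (Suc (Suc (Suc 0))) = 0"
    using assms(2,3) by (simp_all add: y_def eval_nat_numeral)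
  define a where "a u = y 0 + y 2 * u + y 4 * u ^ 2 + u ^ 3 * A 0 u" for u
  define c where "c u = y 5 + u * A 1 u" for u
  have "\<forall>\<^sub>F t in nhds 0. Y t = a (t ^ 2) + c (t ^ 2) * t ^ 5"
    using A(2) by eventually_elim (simp add: a_def c_def y13 eval_nat_numeral algebra_simps)
  moreover have "smooth_at 0 a" "smooth_at 0 c"
    unfolding a_def[abs_def] c_def[abs_def] using A(1) by (intro smooth_intros; simp)+
  moreover have "c 0 \<noteq> 0" using assms(4) by (simp add: c_def y_def)
  ultimately show ?thesis by (intro A_equivalent_shear) auto
qed

text \<open>
  Multiples of \<open>t\<^sup>N\<close> are functions of the point \<open>(t\<^sup>3, y t)\<close> without linear part. Adding such a
  function to a coordinate of the plane does not change its differential at the origin.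
\<close>
definition absorbs :: "nat \<Rightarrow> (real \<Rightarrow> real) \<Rightarrow> bool" where
  "absorbs N y \<longleftrightarrow> (\<forall>R. smooth_at 0 R \<longrightarrow> (\<exists>A p q. smooth_at 0 A \<and> smooth_at 0 p \<and> smooth_at 0 q \<and> p 0 = 0 \<and>
    (\<forall>\<^sub>F t in nhds 0. t ^ N * R t = (t ^ 3) ^ 2 * A (t ^ 3) + p (t ^ 3) * y t + q (t ^ 3) * y t ^ 2)))"

text \<open>
  The absorbed remainders become part of the target diffeomorphism
  \<open>(u, v) \<mapsto> (u + \<mu> v + \<dots>, v + \<dots>)\<close>, and \<open>\<sigma>\<close> is the change of parameter. So it suffices to match the
  two coordinates up to order \<open>N\<close>.
\<close>
lemma A_equivalent_absorb:
  fixes \<sigma> y :: "real \<Rightarrow> real"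
  assumes "absorbs N y" and \<sigma>: "smooth_at 0 \<sigma>" "\<sigma> 0 = 0" "deriv \<sigma> 0 \<noteq> 0" and "y 0 = 0"
    and R: "smooth_at 0 R\<^sub>1" "smooth_at 0 R\<^sub>2"
    and eqs: "\<forall>\<^sub>F t in nhds 0. \<sigma> t ^ 3 = t ^ 3 + \<mu> * y t + t ^ N * R\<^sub>1 t"
      "\<forall>\<^sub>F t in nhds 0. \<sigma> t ^ j = y t + t ^ N * R\<^sub>2 t"
  shows "A_equivalent (\<lambda>t. (t ^ 3, y t)) 0 (\<lambda>s. (s ^ 3, s ^ j)) (0::real)"
proof -
  obtain A\<^sub>1 p\<^sub>1 q\<^sub>1 where A: "smooth_at 0 A\<^sub>1" "smooth_at 0 p\<^sub>1" "smooth_at 0 q\<^sub>1" "p\<^sub>1 0 = 0"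
    "\<forall>\<^sub>F t in nhds 0. t ^ N * R\<^sub>1 t = (t ^ 3) ^ 2 * A\<^sub>1 (t ^ 3) + p\<^sub>1 (t ^ 3) * y t + q\<^sub>1 (t ^ 3) * y t ^ 2"
    using assms(1) R(1) unfolding absorbs_def by blast
  obtain A\<^sub>2 p\<^sub>2 q\<^sub>2 where B: "smooth_at 0 A\<^sub>2" "smooth_at 0 p\<^sub>2" "smooth_at 0 q\<^sub>2" "p\<^sub>2 0 = 0"
    "\<forall>\<^sub>F t in nhds 0. t ^ N * R\<^sub>2 t = (t ^ 3) ^ 2 * A\<^sub>2 (t ^ 3) + p\<^sub>2 (t ^ 3) * y t + q\<^sub>2 (t ^ 3) * y t ^ 2"
    using assms(1) R(2) unfolding absorbs_def by blast
  define h where "h A p q w = fst w ^ 2 * A (fst w) + p (fst w) * snd w + q (fst w) * snd w ^ 2"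
    for A p q :: "real \<Rightarrow> real" and w :: "real \<times> real"
  define \<Phi> where "\<Phi> w = (fst w + \<mu> * snd w + h A\<^sub>1 p\<^sub>1 q\<^sub>1 w, snd w + h A\<^sub>2 p\<^sub>2 q\<^sub>2 w)" for w
  have fst: "smooth_at (0, 0) (fst :: real \<times> real \<Rightarrow> real)" using smooth_at_fst[OF smooth_at_id] .
  have comp: "smooth_at (0, 0) (\<lambda>w :: real \<times> real. f (fst w))" if "smooth_at 0 f" for f :: "real \<Rightarrow> real"
    using smooth_at_compose[OF fst, of f] that by simp
  have h: "smooth_at (0, 0) (h A p q)" if "smooth_at 0 A" "smooth_at 0 p" "smooth_at 0 q" for A p q
    unfolding h_def[abs_def]
    by (intro smooth_at_add smooth_at_mult smooth_at_power comp that smooth_at_fst smooth_at_snd smooth_at_id)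
  have "smooth_at (0, 0) \<Phi>" unfolding \<Phi>_def[abs_def]
    by (intro smooth_at_Pair smooth_at_add smooth_at_mult smooth_at_const h A B smooth_at_fst smooth_at_snd smooth_at_id)
  moreover have "((\<lambda>s. \<Phi> (s, 0)) has_vector_derivative (1, 0)) (at 0)"
  proof -
    have "((\<lambda>s. h A p q (s, 0)) has_real_derivative 0) (at 0)" if "smooth_at 0 A" for A p q
      unfolding h_def using smooth_at_has_real_derivative[OF that]
      by (auto intro!: derivative_eq_intros)
    from this[OF A(1)] this[OF B(1)] show ?thesis
      unfolding \<Phi>_def by (intro has_vector_derivative_Pair)
        (auto simp flip: has_real_derivative_iff_has_vector_derivative intro!: derivative_eq_intros)
  qed
  moreover have "((\<lambda>s. \<Phi> (0, s)) has_vector_derivative (\<mu>, 1)) (at 0)"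
  proof -
    have "((\<lambda>s. h A p q (0, s)) has_real_derivative 0) (at 0)" if "p 0 = 0" for A p q
      unfolding h_def by (auto intro!: derivative_eq_intros simp: that)
    from this[of p\<^sub>1 A\<^sub>1 q\<^sub>1] this[of p\<^sub>2 A\<^sub>2 q\<^sub>2] A(4) B(4) show ?thesis
      unfolding \<Phi>_def by (intro has_vector_derivative_Pair)
        (auto simp flip: has_real_derivative_iff_has_vector_derivative intro!: derivative_eq_intros)
  qed
  ultimately have "\<exists>\<Psi>. diffeo_germ (0, 0) (\<Phi> (0, 0)) \<Phi> \<Psi>"
    by (rule diffeo_germ_planeI) (simp add: det2_def)
  then obtain \<Psi> where "diffeo_germ (0, 0) (\<Phi> (0, 0)) \<Phi> \<Psi>" by blast
  moreover have "\<forall>\<^sub>F t in nhds 0. (\<sigma> t ^ 3, \<sigma> t ^ j) = \<Phi> (t ^ 3, y t)"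
    using eqs A(5) B(5) by eventually_elim (simp add: \<Phi>_def h_def)
  ultimately have 1: "A_equivalent (\<lambda>t. (t ^ 3, y t)) 0 (\<lambda>t. (\<sigma> t ^ 3, \<sigma> t ^ j)) 0"
    using assms(5) by (intro A_equivalent_target) auto
  obtain \<tau> where \<tau>: "diffeo_germ 0 0 \<sigma> \<tau>" using diffeo_germ_real[OF \<sigma>(1,3)] \<sigma>(2) by auto
  have "\<forall>\<^sub>F s in nhds 0. (s ^ 3, s ^ j) = (\<lambda>t. (\<sigma> t ^ 3, \<sigma> t ^ j)) (\<tau> s)"
    using diffeo_germD(6)[OF \<tau>] by eventually_elim simp
  then have "A_equivalent (\<lambda>t. (\<sigma> t ^ 3, \<sigma> t ^ j)) 0 (\<lambda>s. (s ^ 3, s ^ j)) (0::real)"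
    by (intro A_equivalent_source[OF diffeo_germ_sym[OF \<tau>]]) simp
  with 1 show ?thesis by (rule A_equivalent_trans)
qed

text \<open>
  Every integer from \<open>6\<close> on is a sum of threes and fours. With \<open>u = t\<^sup>3\<close> one has
  \<open>y = t u b + t\<^sup>2 u c\<close> and \<open>y\<^sup>2 = 2 u\<^sup>3 b c + t u\<^sup>3 c\<^sup>2 + t\<^sup>2 u\<^sup>2 b\<^sup>2\<close>. Splitting \<open>R = D\<^sub>0 + t D\<^sub>1 + t\<^sup>2 D\<^sub>2\<close> by powers of
  \<open>t\<close> and comparing the coefficients of \<open>t\<close> and \<open>t\<^sup>2\<close> gives two linear equations for \<open>p\<close> and \<open>q\<close>. Their
  determinant is \<open>u\<^sup>3 (b\<^sup>3 - u c\<^sup>3)\<close>, and \<open>u\<^sup>3\<close> cancels in Cramer's rule. The terms free of \<open>t\<close> go into \<open>A\<close>.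
\<close>
lemma absorb_order_6:
  fixes b c :: "real \<Rightarrow> real"
  assumes "smooth_at 0 b" "smooth_at 0 c" "b 0 \<noteq> 0"
  defines "y \<equiv> \<lambda>t. t ^ 4 * b (t ^ 3) + t ^ 5 * c (t ^ 3)"
  shows "absorbs 6 y"
  unfolding absorbs_def
proof (intro allI impI)
  fix R :: "real \<Rightarrow> real" assume R: "smooth_at 0 R"
  obtain D where "\<forall>k<3. smooth_at 0 (D k)" and R_eq: "\<forall>\<^sub>F t in nhds 0. R t = (\<Sum>k<3. t ^ k * D k (t ^ 3))"
    using power_division[OF R, of 3] by auto
  then have D: "smooth_at 0 (D 0)" "smooth_at 0 (D 1)" "smooth_at 0 (D 2)" by auto
  define e where "e u = b u ^ 3 - u * c u ^ 3" for u
  have e: "smooth_at 0 e" "e 0 \<noteq> 0" unfolding e_def[abs_def]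
    using assms(3) by (intro smooth_intros assms | simp)+
  define p where "p u = u * (b u ^ 2 * D 1 u - u * c u ^ 2 * D 2 u) / e u" for u
  define q where "q u = (b u * D 2 u - c u * D 1 u) / e u" for u
  define A where "A u = D 0 u - 2 * u * b u * c u * q u" for u
  have q: "smooth_at 0 q" unfolding q_def[abs_def]
    by (intro smooth_at_divide smooth_at_diff smooth_at_mult assms D e)
  have "smooth_at 0 p" unfolding p_def[abs_def]
    by (intro smooth_at_divide smooth_at_diff smooth_at_mult smooth_at_power smooth_at_id assms D e)
  moreover have "smooth_at 0 A" unfolding A_def[abs_def]
    by (intro smooth_at_diff smooth_at_mult smooth_at_const smooth_at_id assms D q)
  moreover have "p 0 = 0" by (simp add: p_def)
  moreover have "\<forall>\<^sub>F t in nhds 0. e (t ^ 3) \<noteq> 0"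
    by (rule smooth_at_eventually_compose[of 0 "\<lambda>t. t ^ 3"], intro smooth_intros)
       (use smooth_at_eventually_nonzero[OF e] in simp)
  with R_eq have "\<forall>\<^sub>F t in nhds 0. t ^ 6 * R t = (t ^ 3) ^ 2 * A (t ^ 3) + p (t ^ 3) * y t + q (t ^ 3) * y t ^ 2"
  proof eventually_elim
    case (elim t)
    define u where "u = t ^ 3"
    have "e u * p u = u * (b u ^ 2 * D 1 u - u * c u ^ 2 * D 2 u)" "e u * q u = b u * D 2 u - c u * D 1 u"
      using elim(2) by (simp_all add: p_def q_def u_def)
    moreover have "R t = D 0 u + t * D 1 u + t ^ 2 * D 2 u"
      unfolding elim(1) u_def by (simp add: eval_nat_numeral)
    moreover have "y t = t * u * b u + t ^ 2 * u * c u"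
      unfolding y_def u_def by (simp add: eval_nat_numeral)
    ultimately have "e u * (t ^ 6 * R t) = e u * (u ^ 2 * A u + p u * y t + q u * y t ^ 2)"
      using u_def unfolding A_def e_def by algebra
    then show ?case using elim(2) by (simp add: u_def)
  qed
  ultimately show "\<exists>A p q. smooth_at 0 A \<and> smooth_at 0 p \<and> smooth_at 0 q \<and> p 0 = 0 \<and>
    (\<forall>\<^sub>F t in nhds 0. t ^ 6 * R t = (t ^ 3) ^ 2 * A (t ^ 3) + p (t ^ 3) * y t + q (t ^ 3) * y t ^ 2)"
    using q by blast
qed

text \<open>
  The same argument for the semigroup generated by \<open>3\<close> and \<open>5\<close>, which contains every integer from
  \<open>8\<close> on. Here \<open>y = t u\<^sup>2 b + t\<^sup>2 u c\<close>, so that the determinant is \<open>u\<^sup>4 (u\<^sup>2 b\<^sup>3 - c\<^sup>3)\<close>.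
\<close>
lemma absorb_order_8:
  fixes b c :: "real \<Rightarrow> real"
  assumes "smooth_at 0 b" "smooth_at 0 c" "c 0 \<noteq> 0"
  defines "y \<equiv> \<lambda>t. t ^ 5 * c (t ^ 3) + t ^ 7 * b (t ^ 3)"
  shows "absorbs 8 y"
  unfolding absorbs_def
proof (intro allI impI)
  fix R :: "real \<Rightarrow> real" assume R: "smooth_at 0 R"
  obtain D where "\<forall>k<3. smooth_at 0 (D k)" and R_eq: "\<forall>\<^sub>F t in nhds 0. R t = (\<Sum>k<3. t ^ k * D k (t ^ 3))"
    using power_division[OF R, of 3] by auto
  then have D: "smooth_at 0 (D 0)" "smooth_at 0 (D 1)" "smooth_at 0 (D 2)" by auto
  define e where "e u = u ^ 2 * b u ^ 3 - c u ^ 3" for u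
  have e: "smooth_at 0 e" "e 0 \<noteq> 0" unfolding e_def[abs_def]
    using assms(3) by (intro smooth_intros assms | simp)+
  define p where "p u = u * (u ^ 2 * b u ^ 2 * D 2 u - c u ^ 2 * D 0 u) / e u" for u
  define q where "q u = (b u * D 0 u - c u * D 2 u) / e u" for u
  define A where "A u = u * D 1 u - 2 * u ^ 2 * b u * c u * q u" for u
  have q: "smooth_at 0 q" unfolding q_def[abs_def]
    by (intro smooth_at_divide smooth_at_diff smooth_at_mult assms D e)
  have "smooth_at 0 p" unfolding p_def[abs_def]
    by (intro smooth_at_divide smooth_at_diff smooth_at_mult smooth_at_power smooth_at_id assms D e)
  moreover have "smooth_at 0 A" unfolding A_def[abs_def]
    by (intro smooth_at_diff smooth_at_mult smooth_at_power smooth_at_const smooth_at_id assms D q)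
  moreover have "p 0 = 0" by (simp add: p_def)
  moreover have "\<forall>\<^sub>F t in nhds 0. e (t ^ 3) \<noteq> 0"
    by (rule smooth_at_eventually_compose[of 0 "\<lambda>t. t ^ 3"], intro smooth_intros)
       (use smooth_at_eventually_nonzero[OF e] in simp)
  with R_eq have "\<forall>\<^sub>F t in nhds 0. t ^ 8 * R t = (t ^ 3) ^ 2 * A (t ^ 3) + p (t ^ 3) * y t + q (t ^ 3) * y t ^ 2"
  proof eventually_elim
    case (elim t)
    define u where "u = t ^ 3"
    have "e u * p u = u * (u ^ 2 * b u ^ 2 * D 2 u - c u ^ 2 * D 0 u)" "e u * q u = b u * D 0 u - c u * D 2 u"
      using elim(2) by (simp_all add: p_def q_def u_def)
    moreover have "R t = D 0 u + t * D 1 u + t ^ 2 * D 2 u"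
      unfolding elim(1) u_def by (simp add: eval_nat_numeral)
    moreover have "y t = t * u ^ 2 * b u + t ^ 2 * u * c u"
      unfolding y_def u_def by (simp add: eval_nat_numeral)
    ultimately have "e u * (t ^ 8 * R t) = e u * (u ^ 2 * A u + p u * y t + q u * y t ^ 2)"
      using u_def unfolding A_def e_def by algebra
    then show ?case using elim(2) by (simp add: u_def)
  qed
  ultimately show "\<exists>A p q. smooth_at 0 A \<and> smooth_at 0 p \<and> smooth_at 0 q \<and> p 0 = 0 \<and>
    (\<forall>\<^sub>F t in nhds 0. t ^ 8 * R t = (t ^ 3) ^ 2 * A (t ^ 3) + p (t ^ 3) * y t + q (t ^ 3) * y t ^ 2)"
    using q by blast
qed

text \<open>
  Up to order \<open>6\<close> the second coordinate is \<open>t\<^sup>4 + 4 \<alpha> t\<^sup>5\<close> with \<open>\<alpha> = c 0 / 4\<close>. The exponent \<open>5\<close> is not a sum of threes and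
  fours, so this term has to be removed by a change of parameter.
\<close>
lemma A_equivalent_4_3:
  assumes "smooth_at 0 b" "smooth_at 0 c" "b 0 = (1::real)"
  shows "A_equivalent (\<lambda>t. (t ^ 3, t ^ 4 * b (t ^ 3) + t ^ 5 * c (t ^ 3))) 0 (\<lambda>s. (s ^ 3, s ^ 4)) (0::real)"
proof -
  define y where "y = (\<lambda>t. t ^ 4 * b (t ^ 3) + t ^ 5 * c (t ^ 3))"
  have absorbs: "absorbs 6 y" unfolding y_def using assms(3) by (intro absorb_order_6 assms) simp
  obtain b\<^sub>1 where b1: "smooth_at 0 b\<^sub>1" "\<forall>\<^sub>F u in nhds 0. b u = b 0 + u * b\<^sub>1 u" using hadamard[OF assms(1)] by blast
  obtain c\<^sub>1 where c1: "smooth_at 0 c\<^sub>1" "\<forall>\<^sub>F u in nhds 0. c u = c 0 + u * c\<^sub>1 u" using hadamard[OF assms(2)] by blast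
  have cube: "smooth_at 0 (\<lambda>t::real. t ^ 3)" by (intro smooth_intros)
  have comp: "smooth_at 0 (\<lambda>t. f (t ^ 3))" if "smooth_at 0 f" for f :: "real \<Rightarrow> real"
    using smooth_at_compose[OF cube, of f] that by simp
  have ev: "\<forall>\<^sub>F t in nhds 0. P (t ^ 3)" if "\<forall>\<^sub>F t in nhds 0. P t" for P :: "real \<Rightarrow> bool"
    using smooth_at_eventually_compose[OF cube, of P] that by simp
  define \<alpha> where "\<alpha> = c 0 / 4"
  \<comment> \<open>The coefficient of \<open>t\<^sup>2\<close> makes \<open>\<sigma>\<^sup>4\<close> agree with \<open>y\<close>; that of \<open>t\<^sup>3\<close> makes \<open>\<sigma>\<^sup>3\<close> agree with \<open>t\<^sup>3 + 3 \<alpha> y\<close>.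
    The polynomials in \<open>R\<^sub>1\<close> and \<open>R\<^sub>2\<close> are the tails of \<open>\<sigma>\<^sup>3\<close> and \<open>\<sigma>\<^sup>4\<close>.\<close>
  define \<sigma> where "\<sigma> = (\<lambda>t. t + \<alpha> * t ^ 2 + 3 * \<alpha> ^ 2 * t ^ 3)"
  define T where "T t = t * b\<^sub>1 (t ^ 3) + t ^ 2 * c\<^sub>1 (t ^ 3)" for t
  define R\<^sub>1 where "R\<^sub>1 t = 19 * \<alpha> ^ 3 + 36 * \<alpha> ^ 4 * t + 27 * \<alpha> ^ 5 * t ^ 2 + 27 * \<alpha> ^ 6 * t ^ 3 - 3 * \<alpha> * T t" for t
  define R\<^sub>2 where "R\<^sub>2 t = 18 * \<alpha> ^ 2 + 40 * \<alpha> ^ 3 * t + 91 * \<alpha> ^ 4 * t ^ 2 + 120 * \<alpha> ^ 5 * t ^ 3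
      + 162 * \<alpha> ^ 6 * t ^ 4 + 108 * \<alpha> ^ 7 * t ^ 5 + 81 * \<alpha> ^ 8 * t ^ 6 - T t" for t
  have T: "smooth_at 0 T" unfolding T_def[abs_def]
    by (intro smooth_at_add smooth_at_mult smooth_at_power smooth_at_id comp b1 c1)
  have R: "smooth_at 0 R\<^sub>1" "smooth_at 0 R\<^sub>2" unfolding R\<^sub>1_def[abs_def] R\<^sub>2_def[abs_def]
    by (intro smooth_at_add smooth_at_diff smooth_at_mult smooth_at_power smooth_at_id smooth_at_const T)+
  have y_eq: "\<forall>\<^sub>F t in nhds 0. y t = t ^ 4 + 4 * \<alpha> * t ^ 5 + t ^ 6 * T t"
    using ev[OF b1(2)] ev[OF c1(2)]
    by eventually_elim (simp add: y_def T_def \<alpha>_def assms(3) eval_nat_numeral algebra_simps)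
  have "\<forall>\<^sub>F t in nhds 0. \<sigma> t ^ 3 = t ^ 3 + 3 * \<alpha> * y t + t ^ 6 * R\<^sub>1 t"
    using y_eq unfolding \<sigma>_def R\<^sub>1_def by eventually_elim algebra
  moreover have "\<forall>\<^sub>F t in nhds 0. \<sigma> t ^ 4 = y t + t ^ 6 * R\<^sub>2 t"
    using y_eq unfolding \<sigma>_def R\<^sub>2_def by eventually_elim algebra
  moreover have "smooth_at 0 \<sigma>" unfolding \<sigma>_def
    by (intro smooth_at_add smooth_at_mult smooth_at_power smooth_at_id smooth_at_const)
  moreover have "deriv \<sigma> 0 = 1" unfolding \<sigma>_def
    by (rule DERIV_imp_deriv) (auto intro!: derivative_eq_intros)
  ultimately have "A_equivalent (\<lambda>t. (t ^ 3, y t)) 0 (\<lambda>s. (s ^ 3, s ^ 4)) (0::real)"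
    using absorbs R by (intro A_equivalent_absorb[where y=y]) (auto simp: y_def \<sigma>_def)
  then show ?thesis by (simp only: y_def)
qed

text \<open>
  Up to order \<open>8\<close> the second coordinate is \<open>t\<^sup>5 + 5 \<alpha> t\<^sup>7\<close> with \<open>\<alpha> = b 0 / 5\<close>, and a change of parameter removes the
  exponent \<open>7\<close>.
\<close>
lemma A_equivalent_5_3:
  assumes "smooth_at 0 b" "smooth_at 0 c" "c 0 = (1::real)"
  shows "A_equivalent (\<lambda>t. (t ^ 3, t ^ 5 * c (t ^ 3) + t ^ 7 * b (t ^ 3))) 0 (\<lambda>s. (s ^ 3, s ^ 5)) (0::real)"
proof -
  define y where "y = (\<lambda>t. t ^ 5 * c (t ^ 3) + t ^ 7 * b (t ^ 3))"
  have absorbs: "absorbs 8 y" unfolding y_def using assms(3) by (intro absorb_order_8 assms) simp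
  obtain b\<^sub>1 where b1: "smooth_at 0 b\<^sub>1" "\<forall>\<^sub>F u in nhds 0. b u = b 0 + u * b\<^sub>1 u" using hadamard[OF assms(1)] by blast
  obtain c\<^sub>1 where c1: "smooth_at 0 c\<^sub>1" "\<forall>\<^sub>F u in nhds 0. c u = c 0 + u * c\<^sub>1 u" using hadamard[OF assms(2)] by blast
  have cube: "smooth_at 0 (\<lambda>t::real. t ^ 3)" by (intro smooth_intros)
  have comp: "smooth_at 0 (\<lambda>t. f (t ^ 3))" if "smooth_at 0 f" for f :: "real \<Rightarrow> real"
    using smooth_at_compose[OF cube, of f] that by simp
  have ev: "\<forall>\<^sub>F t in nhds 0. P (t ^ 3)" if "\<forall>\<^sub>F t in nhds 0. P t" for P :: "real \<Rightarrow> bool"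
    using smooth_at_eventually_compose[OF cube, of P] that by simp
  define \<alpha> where "\<alpha> = b 0 / 5"
  \<comment> \<open>The coefficient of \<open>t\<^sup>3\<close> makes \<open>\<sigma>\<^sup>5\<close> agree with \<open>y\<close>; that of \<open>t\<^sup>5\<close> makes \<open>\<sigma>\<^sup>3\<close> agree with \<open>t\<^sup>3 + 3 \<alpha> y\<close>.
    The polynomials in \<open>R\<^sub>1\<close> and \<open>R\<^sub>2\<close> are the tails of \<open>\<sigma>\<^sup>3\<close> and \<open>\<sigma>\<^sup>5\<close>.\<close>
  define \<sigma> where "\<sigma> = (\<lambda>t. t + \<alpha> * t ^ 3 + 4 * \<alpha> ^ 2 * t ^ 5)"
  define T where "T t = c\<^sub>1 (t ^ 3) + t ^ 2 * b\<^sub>1 (t ^ 3)" for t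
  define R\<^sub>1 where "R\<^sub>1 t = t * (25 * \<alpha> ^ 3 + 60 * \<alpha> ^ 4 * t ^ 2 + 48 * \<alpha> ^ 5 * t ^ 4 + 64 * \<alpha> ^ 6 * t ^ 6) - 3 * \<alpha> * T t" for t
  define R\<^sub>2 where "R\<^sub>2 t = t * (30 * \<alpha> ^ 2 + 90 * \<alpha> ^ 3 * t ^ 2 + 285 * \<alpha> ^ 4 * t ^ 4 + 561 * \<alpha> ^ 5 * t ^ 6
      + 1140 * \<alpha> ^ 6 * t ^ 8 + 1440 * \<alpha> ^ 7 * t ^ 10 + 1920 * \<alpha> ^ 8 * t ^ 12 + 1280 * \<alpha> ^ 9 * t ^ 14
      + 1024 * \<alpha> ^ 10 * t ^ 16) - T t" for t
  have T: "smooth_at 0 T" unfolding T_def[abs_def]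
    by (intro smooth_at_add smooth_at_mult smooth_at_power smooth_at_id comp b1 c1)
  have R: "smooth_at 0 R\<^sub>1" "smooth_at 0 R\<^sub>2" unfolding R\<^sub>1_def[abs_def] R\<^sub>2_def[abs_def]
    by (intro smooth_at_add smooth_at_diff smooth_at_mult smooth_at_power smooth_at_id smooth_at_const T)+
  have y_eq: "\<forall>\<^sub>F t in nhds 0. y t = t ^ 5 + 5 * \<alpha> * t ^ 7 + t ^ 8 * T t"
    using ev[OF b1(2)] ev[OF c1(2)]
    by eventually_elim (simp add: y_def T_def \<alpha>_def assms(3) eval_nat_numeral algebra_simps)
  have "\<forall>\<^sub>F t in nhds 0. \<sigma> t ^ 3 = t ^ 3 + 3 * \<alpha> * y t + t ^ 8 * R\<^sub>1 t"
    using y_eq unfolding \<sigma>_def R\<^sub>1_def by eventually_elim algebra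
  moreover have "\<forall>\<^sub>F t in nhds 0. \<sigma> t ^ 5 = y t + t ^ 8 * R\<^sub>2 t"
    using y_eq unfolding \<sigma>_def R\<^sub>2_def by eventually_elim algebra
  moreover have "smooth_at 0 \<sigma>" unfolding \<sigma>_def
    by (intro smooth_at_add smooth_at_mult smooth_at_power smooth_at_id smooth_at_const)
  moreover have "deriv \<sigma> 0 = 1" unfolding \<sigma>_def
    by (rule DERIV_imp_deriv) (auto intro!: derivative_eq_intros)
  ultimately have "A_equivalent (\<lambda>t. (t ^ 3, y t)) 0 (\<lambda>s. (s ^ 3, s ^ 5)) (0::real)"
    using absorbs R by (intro A_equivalent_absorb[where y=y]) (auto simp: y_def \<sigma>_def)
  then show ?thesis by (simp only: y_def)
qed

text \<open>
  The part of \<open>Y\<close> that is a function of \<open>s\<^sup>3\<close> is removed by a shear, which also normalizes the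
  coefficient of \<open>s\<^sup>4\<close>.
\<close>
lemma normal_form_4_3:
  fixes Y :: "real \<Rightarrow> real"
  assumes "smooth_at 0 Y" "(deriv ^^ 1) Y 0 = 0" "(deriv ^^ 2) Y 0 = 0" "(deriv ^^ 4) Y 0 \<noteq> 0"
  shows "A_equivalent (\<lambda>s. (s ^ 3, Y s)) 0 (\<lambda>s. (s ^ 3, s ^ 4)) (0::real)"
proof -
  define y where "y k = (deriv ^^ k) Y 0 / fact k" for k
  obtain A where A: "\<forall>k<3. smooth_at 0 (A k)"
    "\<forall>\<^sub>F t in nhds 0. Y t = (\<Sum>k<6. y k * t ^ k) + t ^ 6 * (\<Sum>k<3. t ^ k * A k (t ^ 3))"
    using taylor_germ_division[OF assms(1), of 3 6] unfolding y_def by auto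
  have y0: "y (Suc 0) = 0" "y (Suc (Suc 0)) = 0" "y 4 \<noteq> 0"
    using assms(2-4) by (simp_all add: y_def eval_nat_numeral)
  define a where "a u = y 0 + y 3 * u + u ^ 2 * A 0 u" for u
  define b where "b u = (y 4 + u * A 1 u) / y 4" for u
  define c where "c u = (y 5 + u * A 2 u) / y 4" for u
  have "\<forall>\<^sub>F t in nhds 0. Y t = a (t ^ 3) + y 4 * (t ^ 4 * b (t ^ 3) + t ^ 5 * c (t ^ 3))"
    using A(2)
  proof eventually_elim
    case (elim t)
    have "y 4 * (t ^ 4 * b (t ^ 3) + t ^ 5 * c (t ^ 3)) = t ^ 4 * (y 4 * b (t ^ 3)) + t ^ 5 * (y 4 * c (t ^ 3))"
      by (simp add: algebra_simps)
    also have "y 4 * b (t ^ 3) = y 4 + t ^ 3 * A 1 (t ^ 3)" using y0(3) by (simp add: b_def)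
    also have "y 4 * c (t ^ 3) = y 5 + t ^ 3 * A 2 (t ^ 3)" using y0(3) by (simp add: c_def)
    finally show ?case unfolding elim
      by (simp add: a_def y0(1,2) eval_nat_numeral algebra_simps)
  qed
  moreover have "smooth_at 0 a" "smooth_at 0 b" "smooth_at 0 c"
    unfolding a_def[abs_def] b_def[abs_def] c_def[abs_def] using A(1) y0(3) by (intro smooth_intros; simp)+
  moreover have "b 0 = 1" using y0(3) by (simp add: b_def)
  ultimately show ?thesis using y0(3)
    by (intro A_equivalent_trans[OF A_equivalent_shear[where c="\<lambda>_. y 4"] A_equivalent_4_3[of b c]]
        smooth_at_const) auto
qed

lemma normal_form_5_3:
  fixes Y :: "real \<Rightarrow> real"
  assumes "smooth_at 0 Y" "(deriv ^^ 1) Y 0 = 0" "(deriv ^^ 2) Y 0 = 0" "(deriv ^^ 4) Y 0 = 0"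
    "(deriv ^^ 5) Y 0 \<noteq> 0"
  shows "A_equivalent (\<lambda>s. (s ^ 3, Y s)) 0 (\<lambda>s. (s ^ 3, s ^ 5)) (0::real)"
proof -
  define y where "y k = (deriv ^^ k) Y 0 / fact k" for k
  obtain A where A: "\<forall>k<3. smooth_at 0 (A k)"
    "\<forall>\<^sub>F t in nhds 0. Y t = (\<Sum>k<8. y k * t ^ k) + t ^ 8 * (\<Sum>k<3. t ^ k * A k (t ^ 3))"
    using taylor_germ_division[OF assms(1), of 3 8] unfolding y_def by auto
  have y0: "y (Suc 0) = 0" "y (Suc (Suc 0)) = 0" "y (Suc (Suc (Suc (Suc 0)))) = 0" "y 5 \<noteq> 0"
    using assms(2-5) by (simp_all add: y_def eval_nat_numeral)
  define a where "a u = y 0 + y 3 * u + y 6 * u ^ 2 + u ^ 3 * A 1 u" for u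
  define b where "b u = (y 7 + u * A 2 u) / y 5" for u
  define c where "c u = (y 5 + u * A 0 u) / y 5" for u
  have "\<forall>\<^sub>F t in nhds 0. Y t = a (t ^ 3) + y 5 * (t ^ 5 * c (t ^ 3) + t ^ 7 * b (t ^ 3))"
    using A(2)
  proof eventually_elim
    case (elim t)
    have "y 5 * (t ^ 5 * c (t ^ 3) + t ^ 7 * b (t ^ 3)) = t ^ 5 * (y 5 * c (t ^ 3)) + t ^ 7 * (y 5 * b (t ^ 3))"
      by (simp add: algebra_simps)
    also have "y 5 * b (t ^ 3) = y 7 + t ^ 3 * A 2 (t ^ 3)" using y0(4) by (simp add: b_def)
    also have "y 5 * c (t ^ 3) = y 5 + t ^ 3 * A 0 (t ^ 3)" using y0(4) by (simp add: c_def)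
    finally show ?case unfolding elim
      by (simp add: a_def y0(1-3) eval_nat_numeral algebra_simps)
  qed
  moreover have "smooth_at 0 a" "smooth_at 0 b" "smooth_at 0 c"
    unfolding a_def[abs_def] b_def[abs_def] c_def[abs_def] using A(1) y0(4) by (intro smooth_intros; simp)+
  moreover have "c 0 = 1" using y0(4) by (simp add: c_def)
  ultimately show ?thesis using y0(4)
    by (intro A_equivalent_trans[OF A_equivalent_shear[where c="\<lambda>_. y 5"] A_equivalent_5_3[of b c]]
        smooth_at_const) auto
qed

section \<open>Derivatives of products and compositions\<close>

lemma smooth_at_antiderivative:
  fixes f :: "real \<Rightarrow> real"
  assumes "\<forall>\<^sub>F t in nhds a. (f has_real_derivative g t) (at t)" "smooth_at a g"
  shows "smooth_at a f"
proof -
  obtain U where U: "open U" "a \<in> U" "\<And>k. C_k_on k U g"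
    using assms(2) unfolding smooth_at_def by blast
  obtain V where V: "open V" "a \<in> V" "\<And>t. t \<in> V \<Longrightarrow> (f has_real_derivative g t) (at t)"
    using assms(1) unfolding eventually_nhds by blast
  have "C_k_on (Suc k) (U \<inter> V) f" for k
    by (rule C_k_on_real_SucI[where f'=g]) (use U V C_k_on_subset[OF U(3), of "U \<inter> V"] in auto)
  then show ?thesis using U V by (intro smooth_atI[of "U \<inter> V"]) (auto intro: C_k_on_SucD)
qed

lemma deriv_mult_at:
  assumes "smooth_at a f" "smooth_at a (g :: real \<Rightarrow> real)"
  shows "deriv (\<lambda>t. f t * g t) a = f a * deriv g a + deriv f a * g a"
  using DERIV_mult[OF assms[THEN smooth_at_has_real_derivative]]
  by (intro DERIV_imp_deriv) (simp add: mult.commute add.commute)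

lemma deriv_add_at:
  assumes "smooth_at a f" "smooth_at a (g :: real \<Rightarrow> real)"
  shows "deriv (\<lambda>t. f t + g t) a = deriv f a + deriv g a"
  using DERIV_add[OF assms[THEN smooth_at_has_real_derivative]] by (rule DERIV_imp_deriv)

lemma deriv2_mult_at:
  assumes "smooth_at a f" "smooth_at a (g :: real \<Rightarrow> real)"
  shows "(deriv ^^ 2) (\<lambda>t. f t * g t) a =
    f a * (deriv ^^ 2) g a + 2 * deriv f a * deriv g a + (deriv ^^ 2) f a * g a"
proof -
  have "\<forall>\<^sub>F t in nhds a. ((\<lambda>t. f t * g t) has_real_derivative f t * deriv g t + deriv f t * g t) (at t)"
    using eventually_has_real_derivative[OF assms(1)] eventually_has_real_derivative[OF assms(2)]
    by eventually_elim (auto intro!: derivative_eq_intros)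
  from higher_deriv_shift[OF this, of 1]
  have "(deriv ^^ 2) (\<lambda>t. f t * g t) a = deriv (\<lambda>t. f t * deriv g t + deriv f t * g t) a"
    by (simp add: numeral_2_eq_2)
  also have "\<dots> = f a * deriv (deriv g) a + deriv f a * deriv g a + (deriv f a * deriv g a + deriv (deriv f) a * g a)"
    using assms by (simp add: deriv_add_at deriv_mult_at smooth_at_mult smooth_at_deriv)
  finally show ?thesis by (simp add: numeral_2_eq_2)
qed

lemma deriv_compose_at:
  assumes "smooth_at a k" "smooth_at (k a) (f :: real \<Rightarrow> real)"
  shows "deriv (\<lambda>s. f (k s)) a = deriv f (k a) * deriv k a"
  by (rule DERIV_imp_deriv[OF DERIV_chain2[OF assms(2,1)[THEN smooth_at_has_real_derivative]]])

lemma higher_deriv_compose_shift: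
  assumes "smooth_at a k" "smooth_at (k a) (f :: real \<Rightarrow> real)"
  shows "(deriv ^^ Suc n) (\<lambda>s. f (k s)) a = (deriv ^^ n) (\<lambda>s. deriv f (k s) * deriv k s) a"
proof (rule higher_deriv_shift)
  have "\<forall>\<^sub>F s in nhds a. smooth_at (k s) f"
    by (rule smooth_at_eventually_compose[OF assms(1) eventually_smooth_at[OF assms(2)]])
  then show "\<forall>\<^sub>F s in nhds a. ((\<lambda>s. f (k s)) has_real_derivative deriv f (k s) * deriv k s) (at s)"
    using eventually_smooth_at[OF assms(1)]
    by eventually_elim (intro DERIV_chain2 smooth_at_has_real_derivative)
qed

lemma deriv2_compose_at:
  assumes "smooth_at a k" "smooth_at (k a) (f :: real \<Rightarrow> real)"
  shows "(deriv ^^ 2) (\<lambda>s. f (k s)) a = (deriv ^^ 2) f (k a) * deriv k a ^ 2 + deriv f (k a) * (deriv ^^ 2) k a"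
  using higher_deriv_compose_shift[OF assms, of 1]
  by (simp add: deriv_mult_at deriv_compose_at smooth_at_compose[OF assms(1)] smooth_at_deriv assms
      numeral_2_eq_2 power2_eq_square)

lemma deriv3_compose_at:
  assumes "smooth_at a k" "smooth_at (k a) (f :: real \<Rightarrow> real)"
  shows "(deriv ^^ 3) (\<lambda>s. f (k s)) a = (deriv ^^ 3) f (k a) * deriv k a ^ 3
      + 3 * (deriv ^^ 2) f (k a) * deriv k a * (deriv ^^ 2) k a + deriv f (k a) * (deriv ^^ 3) k a"
proof -
  have f': "smooth_at (k a) (deriv f)" and k': "smooth_at a (deriv k)"
    using assms by (auto intro: smooth_at_deriv)
  have shift: "(deriv ^^ 2) (deriv h) = (deriv ^^ 3) h" "(deriv ^^ 2) h = deriv (deriv h)" for h :: "real \<Rightarrow> real"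
    by (simp_all add: numeral_2_eq_2 numeral_3_eq_3)
  have "(deriv ^^ 3) (\<lambda>s. f (k s)) a = (deriv ^^ 2) (\<lambda>s. deriv f (k s) * deriv k s) a"
    using higher_deriv_compose_shift[OF assms, of 2] by (simp add: numeral_3_eq_3 numeral_2_eq_2)
  also have "\<dots> = (deriv ^^ 3) f (k a) * deriv k a ^ 3
      + 3 * (deriv ^^ 2) f (k a) * deriv k a * (deriv ^^ 2) k a + deriv f (k a) * (deriv ^^ 3) k a"
    unfolding deriv2_mult_at[OF smooth_at_compose[OF assms(1) f'] k'] deriv_compose_at[OF assms(1) f']
      deriv2_compose_at[OF assms(1) f'] shift(1)
    unfolding shift(2) by (simp add: algebra_simps power2_eq_square power3_eq_cube)
  finally show ?thesis .
qed

lemma higher_deriv_add: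
  assumes "smooth_at a f" "smooth_at a (g :: real \<Rightarrow> real)"
  shows "(deriv ^^ n) (\<lambda>t. f t + g t) a = (deriv ^^ n) f a + (deriv ^^ n) g a"
  using assms
proof (induction n arbitrary: f g)
  case (Suc n)
  have "\<forall>\<^sub>F t in nhds a. ((\<lambda>t. f t + g t) has_real_derivative deriv f t + deriv g t) (at t)"
    using eventually_has_real_derivative[OF Suc.prems(1)] eventually_has_real_derivative[OF Suc.prems(2)]
    by eventually_elim (rule DERIV_add)
  from higher_deriv_shift[OF this] show ?case
    using Suc.IH[OF Suc.prems[THEN smooth_at_deriv]] by (simp add: funpow_Suc_right del: funpow.simps)
qed simp

lemma higher_deriv_cmult:
  assumes "smooth_at a (f :: real \<Rightarrow> real)"
  shows "(deriv ^^ n) (\<lambda>t. c * f t) a = c * (deriv ^^ n) f a"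
  using assms
proof (induction n arbitrary: f)
  case (Suc n)
  have "\<forall>\<^sub>F t in nhds a. ((\<lambda>t. c * f t) has_real_derivative c * deriv f t) (at t)"
    using eventually_has_real_derivative[OF Suc.prems] by eventually_elim (rule DERIV_cmult)
  from higher_deriv_shift[OF this] show ?case
    using Suc.IH[OF smooth_at_deriv[OF Suc.prems]] by (simp add: funpow_Suc_right del: funpow.simps)
qed simp

lemma higher_deriv_times_id:
  assumes "smooth_at 0 (f :: real \<Rightarrow> real)"
  shows "(deriv ^^ Suc n) (\<lambda>t. t * f t) 0 = real (Suc n) * (deriv ^^ n) f 0"
  using assms
proof (induction n arbitrary: f)
  case 0
  then show ?case using deriv_mult_at[OF smooth_at_id 0] by simp
next
  case (Suc n)
  have "\<forall>\<^sub>F t in nhds 0. ((\<lambda>t. t * f t) has_real_derivative f t + t * deriv f t) (at t)"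
    using eventually_has_real_derivative[OF Suc.prems]
    by eventually_elim (auto intro!: derivative_eq_intros)
  then have "(deriv ^^ Suc (Suc n)) (\<lambda>t. t * f t) 0 = (deriv ^^ Suc n) (\<lambda>t. f t + t * deriv f t) 0"
    by (rule higher_deriv_shift)
  also have "\<dots> = (deriv ^^ Suc n) f 0 + real (Suc n) * (deriv ^^ n) (deriv f) 0"
    unfolding higher_deriv_add[OF Suc.prems smooth_at_mult[OF smooth_at_id smooth_at_deriv[OF Suc.prems]]]
      Suc.IH[OF smooth_at_deriv[OF Suc.prems]] ..
  also have "\<dots> = real (Suc (Suc n)) * (deriv ^^ Suc n) f 0"
    by (simp add: funpow_Suc_right algebra_simps del: funpow.simps)
  finally show ?case .
qed

section \<open>Legendre germs\<close>

text \<open>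
  The equation \<open>\<gamma>' = \<beta> \<mu>\<close> with \<open>\<mu> = (- sin \<phi>, cos \<phi>)\<close> contains all the information on a Legendre curve
  with normal \<open>(cos \<phi>, sin \<phi>)\<close> near the base point \<open>a\<close>.
\<close>
definition legendre_germ ::
  "real \<Rightarrow> (real \<Rightarrow> real \<times> real) \<Rightarrow> (real \<Rightarrow> real) \<Rightarrow> (real \<Rightarrow> real) \<Rightarrow> bool" where
  "legendre_germ a \<gamma> \<phi> \<beta> \<longleftrightarrow> smooth_at a \<phi> \<and> smooth_at a \<beta> \<and>
     (\<forall>\<^sub>F t in nhds a. (\<gamma> has_vector_derivative \<beta> t *\<^sub>R (- sin (\<phi> t), cos (\<phi> t))) (at t))"

definition criterion_3_2 :: "(real \<Rightarrow> real) \<Rightarrow> (real \<Rightarrow> real) \<Rightarrow> real \<Rightarrow> bool" where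
  "criterion_3_2 \<beta> \<phi> a \<longleftrightarrow> deriv \<beta> a * deriv \<phi> a \<noteq> 0"

definition criterion_5_2 :: "(real \<Rightarrow> real) \<Rightarrow> (real \<Rightarrow> real) \<Rightarrow> real \<Rightarrow> bool" where
  "criterion_5_2 \<beta> \<phi> a \<longleftrightarrow> deriv \<beta> a \<noteq> 0 \<and> deriv \<phi> a = 0 \<and>
     (deriv ^^ 2) \<beta> a * (deriv ^^ 2) \<phi> a - deriv \<beta> a * (deriv ^^ 3) \<phi> a \<noteq> 0"

definition criterion_4_3 :: "(real \<Rightarrow> real) \<Rightarrow> (real \<Rightarrow> real) \<Rightarrow> real \<Rightarrow> bool" where
  "criterion_4_3 \<beta> \<phi> a \<longleftrightarrow> deriv \<beta> a = 0 \<and> (deriv ^^ 2) \<beta> a * deriv \<phi> a \<noteq> 0"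

definition criterion_5_3 :: "(real \<Rightarrow> real) \<Rightarrow> (real \<Rightarrow> real) \<Rightarrow> real \<Rightarrow> bool" where
  "criterion_5_3 \<beta> \<phi> a \<longleftrightarrow> deriv \<beta> a = 0 \<and> deriv \<phi> a = 0 \<and> (deriv ^^ 2) \<beta> a * (deriv ^^ 2) \<phi> a \<noteq> 0"

text \<open>
  The four conditions are collected so that their invariance can be stated once for all of them.
\<close>
definition criteria :: "((real \<Rightarrow> real) \<Rightarrow> (real \<Rightarrow> real) \<Rightarrow> real \<Rightarrow> bool) set" where
  "criteria = {criterion_3_2, criterion_5_2, criterion_4_3, criterion_5_3}"

lemma legendre_germ_reparametrize:
  assumes "legendre_germ a \<gamma> \<phi> \<beta>" "smooth_at 0 \<kappa>" "\<kappa> 0 = a"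
  shows "legendre_germ 0 (\<lambda>s. \<gamma> (\<kappa> s)) (\<lambda>s. \<phi> (\<kappa> s)) (\<lambda>s. \<beta> (\<kappa> s) * deriv \<kappa> s)"
proof -
  have "\<forall>\<^sub>F s in nhds 0. (\<gamma> has_vector_derivative \<beta> (\<kappa> s) *\<^sub>R (- sin (\<phi> (\<kappa> s)), cos (\<phi> (\<kappa> s)))) (at (\<kappa> s))"
    by (rule smooth_at_eventually_compose[OF assms(2)]) (use assms in \<open>simp add: legendre_germ_def\<close>)
  then have "\<forall>\<^sub>F s in nhds 0. ((\<lambda>s. \<gamma> (\<kappa> s)) has_vector_derivative
      (\<beta> (\<kappa> s) * deriv \<kappa> s) *\<^sub>R (- sin (\<phi> (\<kappa> s)), cos (\<phi> (\<kappa> s)))) (at s)"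
    using eventually_has_real_derivative[OF assms(2)]
  proof eventually_elim
    case (elim s)
    have "(\<gamma> \<circ> \<kappa> has_vector_derivative
        deriv \<kappa> s *\<^sub>R (\<beta> (\<kappa> s) *\<^sub>R (- sin (\<phi> (\<kappa> s)), cos (\<phi> (\<kappa> s))))) (at s)"
      using elim by (intro vector_diff_chain_at) (simp_all only: has_real_derivative_iff_has_vector_derivative)
    then show ?case by (simp add: comp_def mult_ac)
  qed
  moreover have "smooth_at 0 (\<lambda>s. \<phi> (\<kappa> s))" "smooth_at 0 (\<lambda>s. \<beta> (\<kappa> s) * deriv \<kappa> s)"
    using assms by (auto intro!: smooth_at_mult smooth_at_deriv smooth_at_compose[OF assms(2)]
        simp: legendre_germ_def)
  ultimately show ?thesis unfolding legendre_germ_def by simp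
qed

text \<open>
  As \<open>\<beta>\<close> vanishes at the base point, the higher derivatives of the parameter change enter only
  through terms that a condition makes zero or that cancel.
\<close>
lemma criteria_reparametrize:
  fixes \<kappa> \<phi> \<beta> :: "real \<Rightarrow> real"
  assumes "smooth_at a \<phi>" "smooth_at a \<beta>" "\<beta> a = 0" "smooth_at 0 \<kappa>" "\<kappa> 0 = a" "deriv \<kappa> 0 \<noteq> 0"
    and "C \<in> criteria"
  defines "\<phi>' \<equiv> \<lambda>s. \<phi> (\<kappa> s)" and "\<beta>' \<equiv> \<lambda>s. \<beta> (\<kappa> s) * deriv \<kappa> s"
  shows "C \<beta>' \<phi>' 0 \<longleftrightarrow> C \<beta> \<phi> a"
proof -
  define k\<^sub>1 k\<^sub>2 where "k\<^sub>1 = deriv \<kappa> 0" and "k\<^sub>2 = (deriv ^^ 2) \<kappa> 0"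
  have k1: "k\<^sub>1 \<noteq> 0" using assms(6) by (simp add: k\<^sub>1_def)
  have sm: "smooth_at (\<kappa> 0) \<phi>" "smooth_at (\<kappa> 0) \<beta>" using assms by auto
  have \<beta>\<kappa>: "smooth_at 0 (\<lambda>s. \<beta> (\<kappa> s))" by (rule smooth_at_compose[OF assms(4) sm(2)])
  have \<phi>1: "deriv \<phi>' 0 = deriv \<phi> a * k\<^sub>1"
    and \<phi>2: "(deriv ^^ 2) \<phi>' 0 = (deriv ^^ 2) \<phi> a * k\<^sub>1 ^ 2 + deriv \<phi> a * k\<^sub>2"
    and \<phi>3: "(deriv ^^ 3) \<phi>' 0 = (deriv ^^ 3) \<phi> a * k\<^sub>1 ^ 3 + 3 * (deriv ^^ 2) \<phi> a * k\<^sub>1 * k\<^sub>2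
        + deriv \<phi> a * (deriv ^^ 3) \<kappa> 0"
    unfolding \<phi>'_def using deriv_compose_at[OF assms(4) sm(1)] deriv2_compose_at[OF assms(4) sm(1)]
      deriv3_compose_at[OF assms(4) sm(1)] by (simp_all add: assms(5) k\<^sub>1_def k\<^sub>2_def)
  have \<beta>1: "deriv \<beta>' 0 = deriv \<beta> a * k\<^sub>1 ^ 2"
    unfolding \<beta>'_def deriv_mult_at[OF \<beta>\<kappa> smooth_at_deriv[OF assms(4)]] deriv_compose_at[OF assms(4) sm(2)]
    by (simp add: assms(3,5) k\<^sub>1_def power2_eq_square)
  have \<beta>2: "(deriv ^^ 2) \<beta>' 0 = (deriv ^^ 2) \<beta> a * k\<^sub>1 ^ 3 + 3 * deriv \<beta> a * k\<^sub>1 * k\<^sub>2"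
    unfolding \<beta>'_def deriv2_mult_at[OF \<beta>\<kappa> smooth_at_deriv[OF assms(4)]] deriv_compose_at[OF assms(4) sm(2)]
      deriv2_compose_at[OF assms(4) sm(2)] k\<^sub>2_def
    by (simp add: assms(3,5) k\<^sub>1_def power2_eq_square power3_eq_cube numeral_2_eq_2 algebra_simps)
  have "criterion_3_2 \<beta>' \<phi>' 0 \<longleftrightarrow> criterion_3_2 \<beta> \<phi> a"
    and "criterion_4_3 \<beta>' \<phi>' 0 \<longleftrightarrow> criterion_4_3 \<beta> \<phi> a"
    and "criterion_5_3 \<beta>' \<phi>' 0 \<longleftrightarrow> criterion_5_3 \<beta> \<phi> a"
    unfolding criterion_3_2_def criterion_4_3_def criterion_5_3_def \<phi>1 \<phi>2 \<beta>1 \<beta>2 using k1 by auto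
  moreover have "criterion_5_2 \<beta>' \<phi>' 0 \<longleftrightarrow> criterion_5_2 \<beta> \<phi> a"
  proof (cases "deriv \<phi> a = 0")
    case True
    have "(deriv ^^ 2) \<beta>' 0 * (deriv ^^ 2) \<phi>' 0 - deriv \<beta>' 0 * (deriv ^^ 3) \<phi>' 0 =
        k\<^sub>1 ^ 5 * ((deriv ^^ 2) \<beta> a * (deriv ^^ 2) \<phi> a - deriv \<beta> a * (deriv ^^ 3) \<phi> a)"
      unfolding \<phi>2 \<phi>3 \<beta>1 \<beta>2 True by algebra
    then show ?thesis unfolding criterion_5_2_def \<phi>1 \<beta>1 using k1 by auto
  next
    case False
    then show ?thesis unfolding criterion_5_2_def \<phi>1 using k1 by auto
  qed
  ultimately show ?thesis using assms(7) by (auto simp: criteria_def)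
qed

section \<open>The conditions are sufficient\<close>

text \<open>
  For \<open>c = \<phi> a\<close> these are the coordinates along the tangent and the normal direction at the base
  point.
\<close>
lemma legendre_germ_coordinates:
  assumes "legendre_germ a \<gamma> \<phi> \<beta>"
  shows "\<forall>\<^sub>F t in nhds a. ((\<lambda>t. (\<gamma> t - \<gamma> a) \<bullet> (- sin c, cos c)) has_real_derivative
      \<beta> t * cos (\<phi> t - c)) (at t)"
    and "\<forall>\<^sub>F t in nhds a. ((\<lambda>t. (\<gamma> t - \<gamma> a) \<bullet> (cos c, sin c)) has_real_derivative
      - (\<beta> t * sin (\<phi> t - c))) (at t)"
proof -
  have *: "\<forall>\<^sub>F t in nhds a. ((\<lambda>t. (\<gamma> t - \<gamma> a) \<bullet> v) has_real_derivative
      (\<beta> t *\<^sub>R (- sin (\<phi> t), cos (\<phi> t))) \<bullet> v) (at t)" for v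
  proof -
    have "\<forall>\<^sub>F t in nhds a. (\<gamma> has_vector_derivative \<beta> t *\<^sub>R (- sin (\<phi> t), cos (\<phi> t))) (at t)"
      using assms by (simp add: legendre_germ_def)
    then show ?thesis
    proof eventually_elim
      case (elim t)
      then have "((\<lambda>t. \<gamma> t - \<gamma> a) has_vector_derivative \<beta> t *\<^sub>R (- sin (\<phi> t), cos (\<phi> t))) (at t)"
        by (auto intro!: derivative_eq_intros)
      from bounded_linear.has_vector_derivative[OF bounded_linear_inner_left this, of v]
      show ?case by (simp add: has_real_derivative_iff_has_vector_derivative)
    qed
  qed
  have "(\<beta> t *\<^sub>R (- sin (\<phi> t), cos (\<phi> t))) \<bullet> (- sin c, cos c) = \<beta> t * cos (\<phi> t - c)"
    "(\<beta> t *\<^sub>R (- sin (\<phi> t), cos (\<phi> t))) \<bullet> (cos c, sin c) = - (\<beta> t * sin (\<phi> t - c))" for t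
    by (simp_all add: inner_prod_def cos_diff sin_diff algebra_simps)
  with *[of "(- sin c, cos c)"] *[of "(cos c, sin c)"]
  show "\<forall>\<^sub>F t in nhds a. ((\<lambda>t. (\<gamma> t - \<gamma> a) \<bullet> (- sin c, cos c)) has_real_derivative
      \<beta> t * cos (\<phi> t - c)) (at t)"
    and "\<forall>\<^sub>F t in nhds a. ((\<lambda>t. (\<gamma> t - \<gamma> a) \<bullet> (cos c, sin c)) has_real_derivative
      - (\<beta> t * sin (\<phi> t - c))) (at t)" by auto
qed

text \<open>
  If \<open>\<beta>\<close> vanishes to order exactly \<open>i - 1\<close>, then the tangential coordinate is \<open>t\<^sup>i\<close> times a
  nonvanishing function \<open>h\<close>. The new parameter is \<open>t\<close> times the \<open>i\<close>-th root of \<open>\<bar>h\<bar>\<close>, and \<open>\<sigma>\<close> is the sign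
  of \<open>h\<close>.
\<close>
lemma straighten:
  assumes "legendre_germ 0 \<gamma> \<phi> \<beta>" "i > 0"
    and "\<And>k. k < i - 1 \<Longrightarrow> (deriv ^^ k) \<beta> 0 = 0" "(deriv ^^ (i - 1)) \<beta> 0 \<noteq> 0"
  shows "\<exists>\<kappa> \<kappa>' \<sigma>. diffeo_germ 0 0 \<kappa> \<kappa>' \<and> \<sigma> \<noteq> 0 \<and>
    (\<forall>\<^sub>F s in nhds 0. (\<gamma> (\<kappa> s) - \<gamma> 0) \<bullet> (- sin (\<phi> 0), cos (\<phi> 0)) = \<sigma> * s ^ i)"
proof -
  define Z where "Z t = (\<gamma> t - \<gamma> 0) \<bullet> (- sin (\<phi> 0), cos (\<phi> 0))" for t
  have sm: "smooth_at 0 \<phi>" "smooth_at 0 \<beta>" using assms(1) by (auto simp: legendre_germ_def)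
  have Z': "\<forall>\<^sub>F t in nhds 0. (Z has_real_derivative \<beta> t * cos (\<phi> t - \<phi> 0)) (at t)"
    using legendre_germ_coordinates(1)[OF assms(1), of "\<phi> 0"] by (simp add: Z_def[abs_def])
  have Z: "smooth_at 0 Z"
    by (rule smooth_at_antiderivative[OF Z']) (intro smooth_intros sm)
  obtain m where i: "i = Suc m" using assms(2) by (cases i) auto
  obtain b where b: "smooth_at 0 b" "b 0 = (deriv ^^ m) \<beta> 0 / fact m" "\<forall>\<^sub>F t in nhds 0. \<beta> t = t ^ m * b t"
    using smooth_at_power_factor[OF sm(2), of m] assms(3) i by auto
  have "smooth_at 0 (\<lambda>t. b t * cos (\<phi> t - \<phi> 0))" by (intro smooth_intros sm b)
  moreover have "\<forall>\<^sub>F t in nhds 0. \<beta> t * cos (\<phi> t - \<phi> 0) = t ^ m * (b t * cos (\<phi> t - \<phi> 0))"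
    using b(3) by eventually_elim simp
  ultimately have D: "k < m \<Longrightarrow> (deriv ^^ k) (\<lambda>t. \<beta> t * cos (\<phi> t - \<phi> 0)) 0 = 0"
    "(deriv ^^ m) (\<lambda>t. \<beta> t * cos (\<phi> t - \<phi> 0)) 0 = fact m * b 0" for k
    using higher_deriv_power_factor[of "\<lambda>t. b t * cos (\<phi> t - \<phi> 0)"] by auto
  have "(deriv ^^ k) Z 0 = 0" if "k < i" for k
  proof (cases k)
    case 0
    then show ?thesis by (simp add: Z_def)
  next
    case (Suc l)
    then show ?thesis using higher_deriv_shift[OF Z', of l] D(1)[of l] that i by simp
  qed
  then obtain h where h: "smooth_at 0 h" "h 0 = (deriv ^^ i) Z 0 / fact i" "\<forall>\<^sub>F t in nhds 0. Z t = t ^ i * h t"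
    using smooth_at_power_factor[OF Z, of i] by auto
  have h0: "h 0 \<noteq> 0"
    using assms(4) b(2) unfolding h(2) i higher_deriv_shift[OF Z'] D(2) by simp
  define \<sigma> where "\<sigma> = sgn (h 0)"
  have \<sigma>: "\<sigma> * \<sigma> = 1" "\<sigma> * h 0 > 0" using h0 by (auto simp: \<sigma>_def sgn_if)
  define r where "r t = root i (\<sigma> * h t)" for t
  have r: "smooth_at 0 r" unfolding r_def[abs_def]
    using \<sigma>(2) by (intro smooth_at_root smooth_intros h assms(2)) auto
  define S where "S t = t * r t" for t
  have S: "smooth_at 0 S" unfolding S_def[abs_def] by (intro smooth_intros r)
  have "deriv S 0 = r 0" unfolding S_def[abs_def] using deriv_mult_at[OF smooth_at_id r] by simp
  also have "\<dots> \<noteq> 0" using real_root_gt_zero[OF assms(2) \<sigma>(2)] by (simp add: r_def)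
  finally obtain \<kappa> where \<kappa>: "diffeo_germ 0 0 S \<kappa>"
    using diffeo_germ_real[OF S] by (auto simp: S_def)
  have "(h \<longlongrightarrow> h 0) (nhds 0)"
    using smooth_at_isCont[OF h(1)] by (simp add: isCont_def tendsto_at_iff_tendsto_nhds)
  then have "\<forall>\<^sub>F t in nhds 0. \<sigma> * h t > 0"
    by (intro order_tendstoD(1)[OF tendsto_mult[OF tendsto_const] \<sigma>(2)])
  with h(3) have "\<forall>\<^sub>F t in nhds 0. Z t = \<sigma> * S t ^ i"
  proof eventually_elim
    case (elim t)
    then have "r t ^ i = \<sigma> * h t" using assms(2) by (simp add: r_def)
    then have "\<sigma> * S t ^ i = (\<sigma> * \<sigma>) * (t ^ i * h t)" by (simp add: S_def power_mult_distrib mult_ac)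
    then show ?case using elim \<sigma>(1) by simp
  qed
  then have "\<forall>\<^sub>F s in nhds 0. Z (\<kappa> s) = \<sigma> * S (\<kappa> s) ^ i"
    by (intro smooth_at_eventually_compose[OF diffeo_germD(4)[OF \<kappa>]]) (simp add: diffeo_germD(2)[OF \<kappa>])
  with diffeo_germD(6)[OF \<kappa>] have "\<forall>\<^sub>F s in nhds 0. Z (\<kappa> s) = \<sigma> * s ^ i"
    by eventually_elim simp
  moreover have "\<sigma> \<noteq> 0" using \<sigma>(2) by auto
  ultimately show ?thesis using diffeo_germ_sym[OF \<kappa>] unfolding Z_def by blast
qed

text \<open>
  In the straightened parameter the normal coordinate \<open>Y\<close> has derivative \<open>s\<^sup>i\<^sup>-\<^sup>1 M\<close>, where \<open>M\<close> is a
  multiple of the tangent of the angle between the normal and its initial direction.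
\<close>
lemma straightened_graph:
  assumes "legendre_germ 0 \<gamma> \<phi> \<beta>" "i > 0" "\<sigma> \<noteq> 0"
    and "\<forall>\<^sub>F s in nhds 0. (\<gamma> s - \<gamma> 0) \<bullet> (- sin (\<phi> 0), cos (\<phi> 0)) = \<sigma> * s ^ i"
  defines "M \<equiv> \<lambda>s. - (real i * \<sigma>) * (sin (\<phi> s - \<phi> 0) / cos (\<phi> s - \<phi> 0))"
  shows "\<exists>Y. smooth_at 0 Y \<and> A_equivalent \<gamma> 0 (\<lambda>s. (s ^ i, Y s)) 0 \<and> smooth_at 0 M \<and>
    (\<forall>\<^sub>F s in nhds 0. (Y has_real_derivative s ^ (i - 1) * M s) (at s)) \<and>
    (\<forall>\<^sub>F s in nhds 0. \<beta> s * cos (\<phi> s - \<phi> 0) = real i * \<sigma> * s ^ (i - 1))"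
proof -
  let ?c = "\<phi> 0"
  define Y where "Y t = (\<gamma> t - \<gamma> 0) \<bullet> (cos ?c, sin ?c)" for t
  have sm: "smooth_at 0 \<phi>" "smooth_at 0 \<beta>" using assms(1) by (auto simp: legendre_germ_def)
  have Y': "\<forall>\<^sub>F t in nhds 0. (Y has_real_derivative - (\<beta> t * sin (\<phi> t - ?c))) (at t)"
    using legendre_germ_coordinates(2)[OF assms(1)] by (simp add: Y_def[abs_def])
  have Y: "smooth_at 0 Y"
    by (rule smooth_at_antiderivative[OF Y']) (intro smooth_intros sm)
  have M: "smooth_at 0 M" unfolding M_def by (intro smooth_at_mult smooth_at_const smooth_at_divide
        smooth_at_sin smooth_at_cos smooth_at_diff sm) simp
  have "\<forall>\<^sub>F s in nhds 0. \<forall>\<^sub>F s in nhds s. (\<gamma> s - \<gamma> 0) \<bullet> (- sin ?c, cos ?c) = \<sigma> * s ^ i"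
    using assms(4) by (simp add: eventually_eventually)
  with legendre_germ_coordinates(1)[OF assms(1), of ?c]
  have tangential: "\<forall>\<^sub>F s in nhds 0. \<beta> s * cos (\<phi> s - ?c) = real i * \<sigma> * s ^ (i - 1)"
  proof eventually_elim
    case (elim s)
    have "((\<lambda>s. \<sigma> * s ^ i) has_real_derivative \<beta> s * cos (\<phi> s - ?c)) (at s)"
      using elim(1) DERIV_cong_ev[OF refl elim(2) refl] by simp
    moreover have "((\<lambda>s. \<sigma> * s ^ i) has_real_derivative real i * \<sigma> * s ^ (i - 1)) (at s)"
      by (auto intro!: derivative_eq_intros)
    ultimately show ?case by (rule DERIV_unique)
  qed
  have "\<forall>\<^sub>F s in nhds 0. cos (\<phi> s - ?c) \<noteq> 0"
    by (rule smooth_at_eventually_nonzero) (intro smooth_intros sm, simp)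
  with tangential Y' have Y'': "\<forall>\<^sub>F s in nhds 0. (Y has_real_derivative s ^ (i - 1) * M s) (at s)"
  proof eventually_elim
    case (elim s)
    have "\<beta> s * sin (\<phi> s - ?c) = (\<beta> s * cos (\<phi> s - ?c)) * (sin (\<phi> s - ?c) / cos (\<phi> s - ?c))"
      using elim(3) by simp
    then have "- (\<beta> s * sin (\<phi> s - ?c)) = s ^ (i - 1) * M s" unfolding elim(1) M_def by simp
    then show ?case using elim(2) by simp
  qed
  define L where "L v = ((v - \<gamma> 0) \<bullet> (- sin ?c, cos ?c) / \<sigma>, (v - \<gamma> 0) \<bullet> (cos ?c, sin ?c))" for v
  have L: "smooth_at p L" for p unfolding L_def[abs_def] using assms(3) by (intro smooth_intros)
  obtain p q where pq: "\<gamma> 0 = (p, q)" by (cases "\<gamma> 0")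
  have sc: "sin ?c * sin ?c + cos ?c * cos ?c = 1"
    using sin_cos_squared_add[of ?c] by (simp add: power2_eq_square)
  have "\<exists>\<Psi>. diffeo_germ (p, q) (L (p, q)) L \<Psi>"
  proof (rule diffeo_germ_planeI[OF L])
    show "((\<lambda>s. L (s, q)) has_vector_derivative (- sin ?c / \<sigma>, cos ?c)) (at p)"
      unfolding L_def pq inner_prod_def
      by (intro has_vector_derivative_Pair)
        (auto simp flip: has_real_derivative_iff_has_vector_derivative intro!: derivative_eq_intros simp: assms(3))
    show "((\<lambda>s. L (p, s)) has_vector_derivative (cos ?c / \<sigma>, sin ?c)) (at q)"
      unfolding L_def pq inner_prod_def
      by (intro has_vector_derivative_Pair)
        (auto simp flip: has_real_derivative_iff_has_vector_derivative intro!: derivative_eq_intros simp: assms(3))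
    have "det2 (- sin ?c / \<sigma>, cos ?c) (cos ?c / \<sigma>, sin ?c) = - inverse \<sigma>"
      unfolding det2_def fst_conv snd_conv divide_inverse using sc by algebra
    then show "det2 (- sin ?c / \<sigma>, cos ?c) (cos ?c / \<sigma>, sin ?c) \<noteq> 0"
      using assms(3) by simp
  qed
  then obtain \<Psi> where "diffeo_germ (\<gamma> 0) (L (\<gamma> 0)) L \<Psi>" unfolding pq by blast
  moreover have "\<forall>\<^sub>F s in nhds 0. (s ^ i, Y s) = L (\<gamma> s)"
    using assms(4) by eventually_elim (simp add: L_def Y_def assms(3))
  ultimately have "A_equivalent \<gamma> 0 (\<lambda>s. (s ^ i, Y s)) 0" by (rule A_equivalent_target)
  with Y M Y'' tangential show ?thesis by blast
qed

text \<open>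
  The tangent satisfies \<open>T' = (1 + T\<^sup>2) \<phi>'\<close>. If \<open>\<phi>'\<close> vanishes at the base point, then \<open>1 + T\<^sup>2\<close> is
  constant up to order two there, so \<open>T\<close> and \<open>\<phi>\<close> have the same derivatives up to the third.
\<close>
lemma tangent_derivatives:
  fixes \<phi> :: "real \<Rightarrow> real"
  assumes "smooth_at a \<phi>" "\<phi> a = c"
  defines "T \<equiv> \<lambda>s. sin (\<phi> s - c) / cos (\<phi> s - c)"
  shows "smooth_at a T" "T a = 0" "deriv T a = deriv \<phi> a"
    and "deriv \<phi> a = 0 \<Longrightarrow> (deriv ^^ 2) T a = (deriv ^^ 2) \<phi> a"
    and "deriv \<phi> a = 0 \<Longrightarrow> (deriv ^^ 3) T a = (deriv ^^ 3) \<phi> a"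
proof -
  show T: "smooth_at a T" unfolding T_def using assms(2) by (intro smooth_intros assms(1)) simp
  show T0: "T a = 0" using assms(2) by (simp add: T_def)
  define Q where "Q s = 1 + T s * T s" for s
  have Q: "smooth_at a Q" unfolding Q_def[abs_def] by (intro smooth_intros T)
  have "\<forall>\<^sub>F s in nhds a. cos (\<phi> s - c) \<noteq> 0"
    by (rule smooth_at_eventually_nonzero) (intro smooth_intros assms(1), simp add: assms(2))
  with eventually_has_real_derivative[OF assms(1)]
  have "\<forall>\<^sub>F s in nhds a. (T has_real_derivative Q s * deriv \<phi> s) (at s)"
  proof eventually_elim
    case (elim s)
    then show ?case
      unfolding T_def Q_def by (auto intro!: derivative_eq_intros simp: field_simps)
        (simp flip: distrib_left)
  qed
  note shift = higher_deriv_shift[OF this]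
  have \<phi>': "smooth_at a (deriv \<phi>)" using assms(1) by (rule smooth_at_deriv)
  have Q': "deriv Q a = 0" "Q a = 1"
    unfolding Q_def using deriv_add_at[OF smooth_at_const smooth_at_mult[OF T T], of 1] deriv_mult_at[OF T T] T0
    by simp_all
  show "deriv T a = deriv \<phi> a" using shift[of 0] Q' by simp
  show "(deriv ^^ 2) T a = (deriv ^^ 2) \<phi> a" if "deriv \<phi> a = 0"
    using shift[of 1] deriv_mult_at[OF Q \<phi>'] Q' by (simp add: numeral_2_eq_2)
  show "(deriv ^^ 3) T a = (deriv ^^ 3) \<phi> a" if "deriv \<phi> a = 0"
    using shift[of 2] deriv2_mult_at[OF Q \<phi>'] Q' that by (simp add: numeral_3_eq_3 numeral_2_eq_2)
qed

lemma straightened_derivatives: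
  assumes "legendre_germ 0 \<gamma> \<phi> \<beta>" "i > 0" "\<sigma> \<noteq> 0"
    and "\<forall>\<^sub>F s in nhds 0. (\<gamma> s - \<gamma> 0) \<bullet> (- sin (\<phi> 0), cos (\<phi> 0)) = \<sigma> * s ^ i"
  shows "\<exists>Y M. smooth_at 0 Y \<and> A_equivalent \<gamma> 0 (\<lambda>s. (s ^ i, Y s)) 0 \<and> smooth_at 0 M \<and> M 0 = 0 \<and>
    (\<forall>n. (deriv ^^ Suc n) Y 0 = (deriv ^^ n) (\<lambda>s. s ^ (i - 1) * M s) 0) \<and>
    deriv M 0 = - (real i * \<sigma>) * deriv \<phi> 0 \<and>
    (deriv \<phi> 0 = 0 \<longrightarrow> (deriv ^^ 2) M 0 = - (real i * \<sigma>) * (deriv ^^ 2) \<phi> 0 \<and>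
       (deriv ^^ 3) M 0 = - (real i * \<sigma>) * (deriv ^^ 3) \<phi> 0)"
proof -
  define T where "T s = sin (\<phi> s - \<phi> 0) / cos (\<phi> s - \<phi> 0)" for s
  have sm: "smooth_at 0 \<phi>" using assms(1) by (auto simp: legendre_germ_def)
  note T = tangent_derivatives[OF sm refl, folded T_def]
  obtain Y where Y: "smooth_at 0 Y" "A_equivalent \<gamma> 0 (\<lambda>s. (s ^ i, Y s)) 0"
    "\<forall>\<^sub>F s in nhds 0. (Y has_real_derivative s ^ (i - 1) * (- (real i * \<sigma>) * T s)) (at s)"
    using straightened_graph[OF assms] unfolding T_def by blast
  have D: "(deriv ^^ n) (\<lambda>s. - (real i * \<sigma>) * T s) 0 = - (real i * \<sigma>) * (deriv ^^ n) T 0" for n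
    by (rule higher_deriv_cmult[OF T(1)])
  show ?thesis
    using Y T D[of 1] D[of 2] D[of 3] higher_deriv_shift[OF Y(3)]
    by (intro exI[of _ Y] exI[of _ "\<lambda>s. - (real i * \<sigma>) * T s"] conjI allI) (auto intro!: smooth_intros)
qed

lemma diffeo_germ_real_deriv:
  fixes \<phi> \<psi> :: "real \<Rightarrow> real"
  assumes "diffeo_germ p q \<phi> \<psi>" shows "deriv \<phi> p \<noteq> 0"
proof -
  note d = diffeo_germD[OF assms]
  have "deriv (\<lambda>x. \<psi> (\<phi> x)) p = deriv \<psi> q * deriv \<phi> p"
    using deriv_compose_at[OF d(3), of \<psi>] d(1,4) by simp
  moreover have "deriv (\<lambda>x. \<psi> (\<phi> x)) p = deriv (\<lambda>x. x) p"
    using d(5) by (rule deriv_cong_ev) simp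
  ultimately show ?thesis by auto
qed

lemma higher_deriv_translate: "(deriv ^^ k) (\<lambda>s. f (a + s)) = (\<lambda>s. (deriv ^^ k) (f :: real \<Rightarrow> real) (a + s))"
proof (induction k)
  case (Suc k)
  have "deriv (\<lambda>s. g (a + s)) = (\<lambda>s. deriv g (a + s))" for g :: "real \<Rightarrow> real"
    unfolding deriv_def using DERIV_shift[of g _ _ a] by (simp add: add.commute)
  then show ?case using Suc by simp
qed simp

lemma straighten_at:
  assumes "legendre_germ a \<gamma> \<phi> \<beta>" "\<beta> a = 0" "i > 0"
    and "\<And>k. k < i - 1 \<Longrightarrow> (deriv ^^ k) \<beta> a = 0" "(deriv ^^ (i - 1)) \<beta> a \<noteq> 0"
  shows "\<exists>\<delta> \<phi>' \<beta>' \<sigma>. A_equivalent \<gamma> a \<delta> 0 \<and> legendre_germ 0 \<delta> \<phi>' \<beta>' \<and> \<beta>' 0 = 0 \<and>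
    (\<forall>C\<in>criteria. C \<beta>' \<phi>' 0 \<longleftrightarrow> C \<beta> \<phi> a) \<and> \<sigma> \<noteq> 0 \<and>
    (\<forall>\<^sub>F s in nhds 0. (\<delta> s - \<delta> 0) \<bullet> (- sin (\<phi>' 0), cos (\<phi>' 0)) = \<sigma> * s ^ i)"
proof -
  define \<tau> where "\<tau> s = a + s" for s
  have \<tau>: "smooth_at 0 \<tau>" "\<tau> 0 = a" unfolding \<tau>_def[abs_def] by (intro smooth_intros) simp
  have d\<tau>: "deriv \<tau> s = 1" for s
    unfolding \<tau>_def[abs_def] by (rule DERIV_imp_deriv) (auto intro!: derivative_eq_intros)
  obtain \<tau>' where \<tau>': "diffeo_germ 0 a \<tau> \<tau>'" using diffeo_germ_real[OF \<tau>(1)] d\<tau> \<tau>(2) by auto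
  have "legendre_germ 0 (\<lambda>s. \<gamma> (\<tau> s)) (\<lambda>s. \<phi> (\<tau> s)) (\<lambda>s. \<beta> (\<tau> s) * deriv \<tau> s)"
    by (rule legendre_germ_reparametrize[OF assms(1) \<tau>])
  then have "legendre_germ 0 (\<lambda>s. \<gamma> (\<tau> s)) (\<lambda>s. \<phi> (\<tau> s)) (\<lambda>s. \<beta> (\<tau> s))" by (simp add: d\<tau>)
  moreover have "(deriv ^^ k) (\<lambda>s. \<beta> (\<tau> s)) 0 = (deriv ^^ k) \<beta> a" for k
    unfolding \<tau>_def higher_deriv_translate by simp
  ultimately obtain \<kappa>\<^sub>0 \<kappa>' \<sigma> where \<kappa>0: "diffeo_germ 0 0 \<kappa>\<^sub>0 \<kappa>'" "\<sigma> \<noteq> 0"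
    "\<forall>\<^sub>F s in nhds 0. (\<gamma> (\<tau> (\<kappa>\<^sub>0 s)) - \<gamma> (\<tau> 0)) \<bullet> (- sin (\<phi> (\<tau> 0)), cos (\<phi> (\<tau> 0))) = \<sigma> * s ^ i"
    using straighten[of "\<lambda>s. \<gamma> (\<tau> s)" "\<lambda>s. \<phi> (\<tau> s)" "\<lambda>s. \<beta> (\<tau> s)" i] assms(3-5) by auto
  define \<kappa> where "\<kappa> = (\<lambda>s. \<tau> (\<kappa>\<^sub>0 s))"
  have comp: "diffeo_germ 0 a \<kappa> (\<kappa>' \<circ> \<tau>')"
    using diffeo_germ_trans[OF \<kappa>0(1) \<tau>'] by (simp add: comp_def \<kappa>_def)
  note \<kappa> = diffeo_germD(3,1)[OF comp] diffeo_germ_real_deriv[OF comp]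
  have sm: "smooth_at a \<phi>" "smooth_at a \<beta>" using assms(1) by (auto simp: legendre_germ_def)
  have "A_equivalent \<gamma> a (\<lambda>s. \<gamma> (\<kappa> s)) 0"
    by (rule A_equivalent_source[OF comp]) simp
  then show ?thesis
    using legendre_germ_reparametrize[OF assms(1) \<kappa>(1,2)] criteria_reparametrize[OF sm assms(2) \<kappa>]
      \<kappa>0(2,3) diffeo_germD(1)[OF \<kappa>0(1)] assms(2) \<kappa>(2)
    by (intro exI[of _ "\<lambda>s. \<gamma> (\<kappa> s)"] exI[of _ "\<lambda>s. \<phi> (\<kappa> s)"] exI[of _ "\<lambda>s. \<beta> (\<kappa> s) * deriv \<kappa> s"] exI[of _ \<sigma>])
       (simp add: \<kappa>_def)
qed

text \<open>
  Here \<open>Y' = s M\<close>, so that the third and fifth derivatives of \<open>Y\<close> at the origin are \<open>2 M'\<close> and \<open>4 M'''\<close>,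
  which are multiples of \<open>\<phi>'\<close> and (if \<open>\<phi>' = 0\<close>) of \<open>\<phi>'''\<close>. In the straightened parameter
  \<open>\<beta> cos (\<phi> - \<phi> 0) = 2 \<sigma> s\<close> forces \<open>\<beta>'' = 0\<close> when \<open>\<phi>' = 0\<close>, and the condition for a \<open>5/2\<close>-cusp reduces to
  \<open>\<phi>''' \<noteq> 0\<close>.
\<close>
lemma criterion_imp_cusp_order_2:
  assumes "legendre_germ a \<gamma> \<phi> \<beta>" "\<beta> a = 0" "deriv \<beta> a \<noteq> 0"
  shows "criterion_3_2 \<beta> \<phi> a \<Longrightarrow> cusp 3 2 \<gamma> a" "criterion_5_2 \<beta> \<phi> a \<Longrightarrow> cusp 5 2 \<gamma> a"
proof -
  obtain \<delta> \<phi>' \<beta>' \<sigma> where \<delta>: "A_equivalent \<gamma> a \<delta> 0" and leg: "legendre_germ 0 \<delta> \<phi>' \<beta>'" "\<beta>' 0 = 0"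
    and crit: "\<forall>C\<in>criteria. C \<beta>' \<phi>' 0 \<longleftrightarrow> C \<beta> \<phi> a" and \<sigma>: "\<sigma> \<noteq> 0"
      "\<forall>\<^sub>F s in nhds 0. (\<delta> s - \<delta> 0) \<bullet> (- sin (\<phi>' 0), cos (\<phi>' 0)) = \<sigma> * s ^ 2"
    using straighten_at[OF assms(1,2), of 2] assms(2,3) by auto
  obtain Y M where Y: "smooth_at 0 Y" "A_equivalent \<delta> 0 (\<lambda>s. (s ^ 2, Y s)) 0"
    and M: "smooth_at 0 M" "M 0 = 0" "deriv M 0 = - (2 * \<sigma>) * deriv \<phi>' 0"
      "deriv \<phi>' 0 = 0 \<longrightarrow> (deriv ^^ 3) M 0 = - (2 * \<sigma>) * (deriv ^^ 3) \<phi>' 0"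
    and YM: "\<And>n. (deriv ^^ Suc n) Y 0 = (deriv ^^ n) (\<lambda>s. s * M s) 0"
    using straightened_derivatives[OF leg(1) _ \<sigma>] by auto
  have Y_derivs: "(deriv ^^ 1) Y 0 = 0" "(deriv ^^ 3) Y 0 = 2 * deriv M 0" "(deriv ^^ 5) Y 0 = 4 * (deriv ^^ 3) M 0"
    using YM[of 0] YM[of 2] YM[of 4] higher_deriv_times_id[OF M(1), of 1] higher_deriv_times_id[OF M(1), of 3]
    by (simp_all add: eval_nat_numeral)
  note trans = A_equivalent_trans[OF \<delta> A_equivalent_trans[OF Y(2)]]
  show "cusp 3 2 \<gamma> a" if "criterion_3_2 \<beta> \<phi> a"
  proof -
    have "deriv \<phi>' 0 \<noteq> 0" using bspec[OF crit, of criterion_3_2] that by (simp add: criteria_def criterion_3_2_def)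
    then have "(deriv ^^ 3) Y 0 \<noteq> 0" using Y_derivs M \<sigma>(1) by simp
    with Y_derivs show ?thesis unfolding cusp_def by (intro trans normal_form_3_2 Y)
  qed
  show "cusp 5 2 \<gamma> a" if "criterion_5_2 \<beta> \<phi> a"
  proof -
    have c: "deriv \<phi>' 0 = 0" "deriv \<beta>' 0 \<noteq> 0"
      "(deriv ^^ 2) \<beta>' 0 * (deriv ^^ 2) \<phi>' 0 - deriv \<beta>' 0 * (deriv ^^ 3) \<phi>' 0 \<noteq> 0"
      using bspec[OF crit, of criterion_5_2] that by (auto simp: criteria_def criterion_5_2_def)
    have s': "smooth_at 0 \<phi>'" "smooth_at 0 \<beta>'" using leg(1) by (auto simp: legendre_germ_def)
    define C where "C s = cos (\<phi>' s - \<phi>' 0)" for s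
    have C: "smooth_at 0 C" unfolding C_def[abs_def] by (intro smooth_intros s')
    have C': "deriv C 0 = 0" "C 0 = 1"
    proof -
      have "(C has_real_derivative - sin (\<phi>' 0 - \<phi>' 0) * deriv \<phi>' 0) (at 0)"
        unfolding C_def[abs_def] using smooth_at_has_real_derivative[OF s'(1)]
        by (auto intro!: derivative_eq_intros)
      then show "deriv C 0 = 0" using DERIV_imp_deriv by fastforce
    qed (simp add: C_def)
    have "\<forall>\<^sub>F s in nhds 0. \<beta>' s * C s = s * (2 * \<sigma>)"
      using straightened_graph[OF leg(1) _ \<sigma>] unfolding C_def by (auto simp: mult_ac)
    then have "(deriv ^^ 2) (\<lambda>s. \<beta>' s * C s) 0 = (deriv ^^ Suc 1) (\<lambda>s. s * (2 * \<sigma>)) 0"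
      using higher_deriv_cong[of "\<lambda>s. \<beta>' s * C s" _ 0 2] by (simp add: numeral_2_eq_2)
    also have "\<dots> = 2 * deriv (\<lambda>s. 2 * \<sigma>) 0"
      using higher_deriv_times_id[OF smooth_at_const[of 0 "2 * \<sigma>"], of 1] by simp
    finally have "(deriv ^^ 2) \<beta>' 0 = 0"
      using C' leg(2) by (simp add: deriv2_mult_at[OF s'(2) C])
    with c have "(deriv ^^ 3) \<phi>' 0 \<noteq> 0" by simp
    then have "(deriv ^^ 3) Y 0 = 0" "(deriv ^^ 5) Y 0 \<noteq> 0" using Y_derivs M \<sigma>(1) c(1) by simp_all
    with Y_derivs(1) show ?thesis unfolding cusp_def by (intro trans normal_form_5_2 Y)
  qed
qed

text \<open>
  Here \<open>Y' = s\<^sup>2 M\<close>, so that the fourth and fifth derivatives of \<open>Y\<close> at the origin are \<open>6 M'\<close> and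
  \<open>12 M''\<close>.
\<close>
lemma criterion_imp_cusp_order_3:
  assumes "legendre_germ a \<gamma> \<phi> \<beta>" "\<beta> a = 0" "deriv \<beta> a = 0" "(deriv ^^ 2) \<beta> a \<noteq> 0"
  shows "criterion_4_3 \<beta> \<phi> a \<Longrightarrow> cusp 4 3 \<gamma> a" "criterion_5_3 \<beta> \<phi> a \<Longrightarrow> cusp 5 3 \<gamma> a"
proof -
  have "(deriv ^^ k) \<beta> a = 0" if "k < 2" for k using that assms(2,3) by (auto simp: less_2_cases_iff)
  then obtain \<delta> \<phi>' \<beta>' \<sigma> where \<delta>: "A_equivalent \<gamma> a \<delta> 0" and leg: "legendre_germ 0 \<delta> \<phi>' \<beta>'"
    and crit: "\<forall>C\<in>criteria. C \<beta>' \<phi>' 0 \<longleftrightarrow> C \<beta> \<phi> a" and \<sigma>: "\<sigma> \<noteq> 0"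
      "\<forall>\<^sub>F s in nhds 0. (\<delta> s - \<delta> 0) \<bullet> (- sin (\<phi>' 0), cos (\<phi>' 0)) = \<sigma> * s ^ 3"
    using straighten_at[OF assms(1,2), of 3] assms(4) by auto
  obtain Y M where Y: "smooth_at 0 Y" "A_equivalent \<delta> 0 (\<lambda>s. (s ^ 3, Y s)) 0"
    and M: "smooth_at 0 M" "M 0 = 0" "deriv M 0 = - (3 * \<sigma>) * deriv \<phi>' 0"
      "deriv \<phi>' 0 = 0 \<longrightarrow> (deriv ^^ 2) M 0 = - (3 * \<sigma>) * (deriv ^^ 2) \<phi>' 0"
    and YM: "\<And>n. (deriv ^^ Suc n) Y 0 = (deriv ^^ n) (\<lambda>s. s ^ 2 * M s) 0"
    using straightened_derivatives[OF leg _ \<sigma>] by auto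
  have sM: "smooth_at 0 (\<lambda>s. s * M s)" by (intro smooth_intros M)
  have YM': "(deriv ^^ Suc (Suc n)) Y 0 = real (Suc n) * (deriv ^^ n) (\<lambda>s. s * M s) 0" for n
    using YM[of "Suc n"] higher_deriv_times_id[OF sM, of n]
    by (simp add: power2_eq_square mult.assoc del: funpow.simps)
  have Y_derivs: "(deriv ^^ 1) Y 0 = 0" "(deriv ^^ 2) Y 0 = 0" "(deriv ^^ 4) Y 0 = 6 * deriv M 0"
    "(deriv ^^ 5) Y 0 = 12 * (deriv ^^ 2) M 0"
    using YM[of 0] YM'[of 0] YM'[of 2] YM'[of 3] higher_deriv_times_id[OF M(1), of 1] higher_deriv_times_id[OF M(1), of 2]
    by (simp_all add: eval_nat_numeral)
  note trans = A_equivalent_trans[OF \<delta> A_equivalent_trans[OF Y(2)]]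
  show "cusp 4 3 \<gamma> a" if "criterion_4_3 \<beta> \<phi> a"
  proof -
    have "deriv \<phi>' 0 \<noteq> 0" using bspec[OF crit, of criterion_4_3] that by (simp add: criteria_def criterion_4_3_def)
    then have "(deriv ^^ 4) Y 0 \<noteq> 0" using Y_derivs M \<sigma>(1) by simp
    with Y_derivs show ?thesis unfolding cusp_def by (intro trans normal_form_4_3 Y)
  qed
  show "cusp 5 3 \<gamma> a" if "criterion_5_3 \<beta> \<phi> a"
  proof -
    have "deriv \<phi>' 0 = 0" "(deriv ^^ 2) \<phi>' 0 \<noteq> 0" using bspec[OF crit, of criterion_5_3] that by (auto simp: criteria_def criterion_5_3_def)
    then have "(deriv ^^ 4) Y 0 = 0" "(deriv ^^ 5) Y 0 \<noteq> 0" using Y_derivs M \<sigma>(1) by simp_all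
    with Y_derivs show ?thesis unfolding cusp_def by (intro trans normal_form_5_3 Y)
  qed
qed

section \<open>The conditions are necessary\<close>

lemma monomial_curve_derivative:
  fixes H :: "real \<times> real \<Rightarrow> real \<times> real"
  assumes "smooth_at (0, 0) H" "i > 0" "j > 0"
  shows "smooth_at 0 (\<lambda>s. H (s ^ i, s ^ j))"
    and "\<forall>\<^sub>F s in nhds 0. ((\<lambda>s. H (s ^ i, s ^ j)) has_vector_derivative
      (real i * s ^ (i - 1)) *\<^sub>R frechet_derivative H (at (s ^ i, s ^ j)) (1, 0) +
      (real j * s ^ (j - 1)) *\<^sub>R frechet_derivative H (at (s ^ i, s ^ j)) (0, 1)) (at s)"
proof -
  have m: "smooth_at 0 (\<lambda>s::real. (s ^ i, s ^ j))" by (intro smooth_intros)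
  have H: "smooth_at ((0::real) ^ i, (0::real) ^ j) H" using assms by (simp add: zero_power)
  show "smooth_at 0 (\<lambda>s. H (s ^ i, s ^ j))" by (rule smooth_at_compose[OF m H])
  have "\<forall>\<^sub>F s in nhds 0. smooth_at (s ^ i, s ^ j) H"
    by (rule smooth_at_eventually_compose[OF m eventually_smooth_at[OF H]])
  then show "\<forall>\<^sub>F s in nhds 0. ((\<lambda>s. H (s ^ i, s ^ j)) has_vector_derivative
      (real i * s ^ (i - 1)) *\<^sub>R frechet_derivative H (at (s ^ i, s ^ j)) (1, 0) +
      (real j * s ^ (j - 1)) *\<^sub>R frechet_derivative H (at (s ^ i, s ^ j)) (0, 1)) (at s)"
  proof eventually_elim
    case (elim s)
    let ?D = "frechet_derivative H (at (s ^ i, s ^ j))"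
    have D: "(H has_derivative ?D) (at (s ^ i, s ^ j))" by (rule smooth_at_has_derivative[OF elim])
    have "((\<lambda>s. (s ^ i, s ^ j)) has_derivative (\<lambda>h. (h * (real i * s ^ (i - 1)), h * (real j * s ^ (j - 1))))) (at s)"
      by (auto intro!: derivative_eq_intros simp: mult_ac)
    from has_derivative_compose[OF this D]
    have "((\<lambda>s. H (s ^ i, s ^ j)) has_derivative
        (\<lambda>h. ?D (h * (real i * s ^ (i - 1)), h * (real j * s ^ (j - 1))))) (at s)" .
    moreover have "?D (h * (real i * s ^ (i - 1)), h * (real j * s ^ (j - 1))) =
        h *\<^sub>R ((real i * s ^ (i - 1)) *\<^sub>R ?D (1, 0) + (real j * s ^ (j - 1)) *\<^sub>R ?D (0, 1))" for h
      using linear_plane[OF has_derivative_linear[OF D], of "(h * (real i * s ^ (i - 1)), h * (real j * s ^ (j - 1)))"]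
      by (simp add: scaleR_add_right)
    ultimately show ?case unfolding has_vector_derivative_def by simp
  qed
qed

text \<open>
  The determinant does not change when both vectors are expressed in the orthonormal frame
  \<open>((c, s), (- s, c))\<close>.
\<close>
lemma det2_frame:
  assumes "c * c + s * s = (1::real)"
  shows "det2 u w = (u \<bullet> (c, s)) * (w \<bullet> (- s, c)) - (u \<bullet> (- s, c)) * (w \<bullet> (c, s))"
  unfolding det2_def inner_prod_def fst_conv snd_conv inner_real_def using assms by algebra

text \<open>
  The velocity is \<open>s\<^sup>i\<^sup>-\<^sup>1 w\<close> with \<open>w = i \<Psi>\<^sub>u + j s\<^sup>j\<^sup>-\<^sup>i \<Psi>\<^sub>v\<close>, and \<open>w\<close> does not vanish at the origin. So \<open>w = \<rho> \<mu>\<close>,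
  and differentiating \<open>w \<bullet> \<nu> = 0\<close> gives \<open>\<rho> \<phi>' = - w' \<bullet> \<nu>\<close>. The functions \<open>f\<close>, \<open>g\<close>, \<open>h\<close> come from the three
  terms of \<open>w'\<close>. The value \<open>g 0\<close> is a multiple of \<open>\<Psi>\<^sub>v \<bullet> \<nu>\<close>, which is nonzero because \<open>\<Psi>\<^sub>u\<close> and \<open>\<Psi>\<^sub>v\<close> are
  independent and \<open>\<Psi>\<^sub>u\<close> is orthogonal to \<open>\<nu>\<close>. The last clause says that \<open>\<rho>\<close> and \<open>f\<close> are stationary: all
  factors depend on \<open>s\<close> through \<open>s\<^sup>i\<close>, \<open>s\<^sup>j\<close>, \<open>s\<^sup>j\<^sup>-\<^sup>i\<close> and the frame, all of which are stationary at the origin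
  if \<open>i\<close> and \<open>j - i\<close> exceed one.
\<close>
lemma standard_cusp_data:
  assumes leg: "legendre_germ 0 \<delta> \<phi> \<beta>" and \<Psi>: "smooth_at (0, 0) \<Psi>"
    and det: "det2 (frechet_derivative \<Psi> (at (0, 0)) (1, 0)) (frechet_derivative \<Psi> (at (0, 0)) (0, 1)) \<noteq> 0"
    and ij: "1 < i" "i < j" and \<delta>: "\<forall>\<^sub>F s in nhds 0. \<delta> s = \<Psi> (s ^ i, s ^ j)"
  shows "\<exists>\<rho> f g h. smooth_at 0 \<rho> \<and> smooth_at 0 f \<and> smooth_at 0 g \<and> smooth_at 0 h \<and> \<rho> 0 \<noteq> 0 \<and> g 0 \<noteq> 0 \<and>
    (\<forall>\<^sub>F s in nhds 0. \<beta> s = s ^ (i - 1) * \<rho> s) \<and>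
    (\<forall>\<^sub>F s in nhds 0. \<rho> s * deriv \<phi> s = s ^ (i - 1) * f s + s ^ (j - i - 1) * g s + s ^ (j - 1) * h s) \<and>
    (i + 1 < j \<longrightarrow> deriv \<rho> 0 = 0 \<and> deriv f 0 = 0)"
proof -
  define \<Psi>\<^sub>u \<Psi>\<^sub>v where "\<Psi>\<^sub>u p = frechet_derivative \<Psi> (at p) (1, 0)" and "\<Psi>\<^sub>v p = frechet_derivative \<Psi> (at p) (0, 1)" for p
  have uv: "smooth_at (0, 0) \<Psi>\<^sub>u" "smooth_at (0, 0) \<Psi>\<^sub>v"
    unfolding \<Psi>\<^sub>u_def[abs_def] \<Psi>\<^sub>v_def[abs_def] by (intro smooth_at_partial \<Psi>)+
  define \<Psi>\<^sub>u\<^sub>u \<Psi>\<^sub>u\<^sub>v where "\<Psi>\<^sub>u\<^sub>u p = frechet_derivative \<Psi>\<^sub>u (at p) (1, 0)" and "\<Psi>\<^sub>u\<^sub>v p = frechet_derivative \<Psi>\<^sub>u (at p) (0, 1)" for p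
  define \<Psi>\<^sub>v\<^sub>u \<Psi>\<^sub>v\<^sub>v where "\<Psi>\<^sub>v\<^sub>u p = frechet_derivative \<Psi>\<^sub>v (at p) (1, 0)" and "\<Psi>\<^sub>v\<^sub>v p = frechet_derivative \<Psi>\<^sub>v (at p) (0, 1)" for p
  have uu: "smooth_at (0, 0) \<Psi>\<^sub>u\<^sub>u" "smooth_at (0, 0) \<Psi>\<^sub>u\<^sub>v" "smooth_at (0, 0) \<Psi>\<^sub>v\<^sub>u" "smooth_at (0, 0) \<Psi>\<^sub>v\<^sub>v"
    unfolding \<Psi>\<^sub>u\<^sub>u_def[abs_def] \<Psi>\<^sub>u\<^sub>v_def[abs_def] \<Psi>\<^sub>v\<^sub>u_def[abs_def] \<Psi>\<^sub>v\<^sub>v_def[abs_def] by (intro smooth_at_partial uv)+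
  have pos: "i > 0" "j > 0" using ij by auto
  obtain n m where n: "i = Suc (Suc n)" "j = i + Suc m"
    using ij by (metis less_natE add_Suc_right plus_1_eq_Suc One_nat_def Suc_lessE less_imp_Suc_add)
  note curve = monomial_curve_derivative[OF _ pos]
  define F G where "F s = \<Psi>\<^sub>u (s ^ i, s ^ j)" and "G s = \<Psi>\<^sub>v (s ^ i, s ^ j)" for s
  have FG: "smooth_at 0 F" "smooth_at 0 G" unfolding F_def[abs_def] G_def[abs_def] by (intro curve uv)+
  define F\<^sub>1 where "F\<^sub>1 s = real i *\<^sub>R \<Psi>\<^sub>u\<^sub>u (s ^ i, s ^ j) + (real j * s ^ (j - i)) *\<^sub>R \<Psi>\<^sub>u\<^sub>v (s ^ i, s ^ j)" for s
  define G\<^sub>1 where "G\<^sub>1 s = real i *\<^sub>R \<Psi>\<^sub>v\<^sub>u (s ^ i, s ^ j) + (real j * s ^ (j - i)) *\<^sub>R \<Psi>\<^sub>v\<^sub>v (s ^ i, s ^ j)" for s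
  have FG1: "smooth_at 0 F\<^sub>1" "smooth_at 0 G\<^sub>1" unfolding F\<^sub>1_def[abs_def] G\<^sub>1_def[abs_def]
    by (intro smooth_at_add smooth_at_scaleR smooth_at_mult smooth_at_power smooth_at_const smooth_at_id curve uu)+
  have pow: "s ^ (j - 1) = s ^ (i - 1) * s ^ (j - i)" for s :: real
    using n by (simp flip: power_add)
  have F': "\<forall>\<^sub>F s in nhds 0. (F has_vector_derivative s ^ (i - 1) *\<^sub>R F\<^sub>1 s) (at s)"
    using curve(2)[OF uv(1)] unfolding F_def F\<^sub>1_def \<Psi>\<^sub>u\<^sub>u_def \<Psi>\<^sub>u\<^sub>v_def
    by eventually_elim (simp add: pow scaleR_add_right mult_ac del: One_nat_def)
  have G': "\<forall>\<^sub>F s in nhds 0. (G has_vector_derivative s ^ (i - 1) *\<^sub>R G\<^sub>1 s) (at s)"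
    using curve(2)[OF uv(2)] unfolding G_def G\<^sub>1_def \<Psi>\<^sub>v\<^sub>u_def \<Psi>\<^sub>v\<^sub>v_def
    by eventually_elim (simp add: pow scaleR_add_right mult_ac del: One_nat_def)
  define w where "w s = real i *\<^sub>R F s + (real j * s ^ (j - i)) *\<^sub>R G s" for s
  define w' where "w' s = s ^ (i - 1) *\<^sub>R (real i *\<^sub>R F\<^sub>1 s) + s ^ (j - i - 1) *\<^sub>R ((real j * real (j - i)) *\<^sub>R G s)
      + s ^ (j - 1) *\<^sub>R (real j *\<^sub>R G\<^sub>1 s)" for s
  have w: "smooth_at 0 w" unfolding w_def[abs_def]
    by (intro smooth_at_add smooth_at_scaleR smooth_at_mult smooth_at_power smooth_at_const smooth_at_id FG)
  have w': "\<forall>\<^sub>F s in nhds 0. (w has_vector_derivative w' s) (at s)"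
    using F' G'
  proof eventually_elim
    case (elim s)
    have "((\<lambda>s. real j * s ^ (j - i)) has_real_derivative real j * (real (j - i) * s ^ (j - i - 1))) (at s)"
      by (auto intro!: derivative_eq_intros)
    then have "(w has_vector_derivative real i *\<^sub>R (s ^ (i - 1) *\<^sub>R F\<^sub>1 s) +
        ((real j * s ^ (j - i)) *\<^sub>R (s ^ (i - 1) *\<^sub>R G\<^sub>1 s) + (real j * (real (j - i) * s ^ (j - i - 1))) *\<^sub>R G s)) (at s)"
      unfolding w_def[abs_def]
      by (intro has_vector_derivative_add has_vector_derivative_scaleR elim bounded_linear.has_vector_derivative[OF bounded_linear_scaleR_right])
    then show ?case unfolding w'_def by (simp add: pow mult_ac add_ac del: One_nat_def)
  qed
  define \<nu> \<mu> where "\<nu> s = (cos (\<phi> s), sin (\<phi> s))" and "\<mu> s = (- sin (\<phi> s), cos (\<phi> s))" for s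
  have sm: "smooth_at 0 \<phi>" "smooth_at 0 \<beta>" using leg by (auto simp: legendre_germ_def)
  have frame: "smooth_at 0 \<nu>" "smooth_at 0 \<mu>" unfolding \<nu>_def[abs_def] \<mu>_def[abs_def] by (intro smooth_intros sm)+
  have frame': "\<forall>\<^sub>F s in nhds 0. (\<nu> has_vector_derivative deriv \<phi> s *\<^sub>R \<mu> s) (at s) \<and>
      (\<mu> has_vector_derivative (- deriv \<phi> s) *\<^sub>R \<nu> s) (at s)"
    using eventually_has_real_derivative[OF sm(1)]
  proof eventually_elim
    case (elim s)
    then have "((\<lambda>s. cos (\<phi> s)) has_vector_derivative - sin (\<phi> s) * deriv \<phi> s) (at s)"
      "((\<lambda>s. sin (\<phi> s)) has_vector_derivative cos (\<phi> s) * deriv \<phi> s) (at s)"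
      "((\<lambda>s. - sin (\<phi> s)) has_vector_derivative - (cos (\<phi> s) * deriv \<phi> s)) (at s)"
      unfolding has_real_derivative_iff_has_vector_derivative[symmetric]
      by (auto intro!: derivative_eq_intros)
    from has_vector_derivative_Pair[OF this(1,2)] has_vector_derivative_Pair[OF this(3,1)]
    show ?case unfolding \<nu>_def \<mu>_def by (simp add: mult.commute)
  qed
  have sc: "cos (\<phi> s) * cos (\<phi> s) + sin (\<phi> s) * sin (\<phi> s) = 1" for s
    using sin_cos_squared_add3[of "\<phi> s"] by simp
  have \<mu>\<nu>: "\<mu> s \<bullet> \<nu> s = 0" "\<mu> s \<bullet> \<mu> s = 1" "\<nu> s \<bullet> \<nu> s = 1" for s
    using trans[OF add.commute sc[of s]] by (simp_all add: \<mu>_def \<nu>_def inner_prod_def)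
  have "\<forall>\<^sub>F s in nhds 0. \<forall>\<^sub>F s in nhds s. \<delta> s = \<Psi> (s ^ i, s ^ j)"
    using \<delta> by (simp add: eventually_eventually)
  moreover have "\<forall>\<^sub>F s in nhds 0. (\<delta> has_vector_derivative \<beta> s *\<^sub>R \<mu> s) (at s)"
    using leg by (simp add: legendre_germ_def \<mu>_def)
  ultimately have \<beta>w: "\<forall>\<^sub>F s in nhds 0. \<beta> s *\<^sub>R \<mu> s = s ^ (i - 1) *\<^sub>R w s"
    using curve(2)[OF \<Psi>]
  proof eventually_elim
    case (elim s)
    have "((\<lambda>s. \<Psi> (s ^ i, s ^ j)) has_vector_derivative s ^ (i - 1) *\<^sub>R w s) (at s)"
      using elim(3) unfolding w_def F_def G_def \<Psi>\<^sub>u_def \<Psi>\<^sub>v_def by (simp add: pow scaleR_add_right mult_ac del: One_nat_def)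
    moreover have "((\<lambda>s. \<Psi> (s ^ i, s ^ j)) has_vector_derivative \<beta> s *\<^sub>R \<mu> s) (at s)"
      using elim(1,2) has_vector_derivative_cong_ev[of UNIV \<delta> "\<lambda>s. \<Psi> (s ^ i, s ^ j)" s "\<beta> s *\<^sub>R \<mu> s"]
        eventually_nhds_x_imp_x[OF elim(1)] by simp
    ultimately show ?case by (rule vector_derivative_unique_at[symmetric])
  qed
  define \<rho> where "\<rho> s = w s \<bullet> \<mu> s" for s
  have \<rho>: "smooth_at 0 \<rho>" unfolding \<rho>_def[abs_def] by (intro smooth_at_inner w frame)
  have \<beta>\<rho>: "\<forall>\<^sub>F s in nhds 0. \<beta> s = s ^ (i - 1) * \<rho> s"
    using \<beta>w
  proof eventually_elim
    case (elim s)
    then have "(\<beta> s *\<^sub>R \<mu> s) \<bullet> \<mu> s = (s ^ (i - 1) *\<^sub>R w s) \<bullet> \<mu> s" by simp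
    then show ?case by (simp add: \<mu>\<nu> \<rho>_def)
  qed
  have "\<forall>\<^sub>F s in nhds 0. s ^ (i - 1) * (w s \<bullet> \<nu> s) = s ^ (i - 1) * 0"
    using \<beta>w
  proof eventually_elim
    case (elim s)
    then have "(\<beta> s *\<^sub>R \<mu> s) \<bullet> \<nu> s = (s ^ (i - 1) *\<^sub>R w s) \<bullet> \<nu> s" by simp
    then show ?case by (simp add: \<mu>\<nu>)
  qed
  then have w\<nu>: "\<forall>\<^sub>F s in nhds 0. w s \<bullet> \<nu> s = 0"
    by (rule eventually_mult_power_cancel[rotated 2]) (intro smooth_at_inner w frame smooth_at_const)+
  then have "\<forall>\<^sub>F s in nhds 0. \<forall>\<^sub>F s in nhds s. w s \<bullet> \<nu> s = 0" by (simp add: eventually_eventually)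
  with w' frame' have \<rho>\<phi>: "\<forall>\<^sub>F s in nhds 0. \<rho> s * deriv \<phi> s = - (w' s \<bullet> \<nu> s)"
  proof eventually_elim
    case (elim s)
    have "((\<lambda>s. w s \<bullet> \<nu> s) has_vector_derivative w s \<bullet> (deriv \<phi> s *\<^sub>R \<mu> s) + w' s \<bullet> \<nu> s) (at s)"
      using elim by (intro bounded_bilinear.has_vector_derivative[OF bounded_bilinear_inner]) auto
    then have "((\<lambda>s. w s \<bullet> \<nu> s) has_real_derivative \<rho> s * deriv \<phi> s + w' s \<bullet> \<nu> s) (at s)"
      by (simp add: has_real_derivative_iff_has_vector_derivative \<rho>_def mult.commute)
    moreover have "((\<lambda>s. w s \<bullet> \<nu> s) has_real_derivative 0) (at s)"
      using DERIV_cong_ev[OF refl elim(3) refl] by simp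
    ultimately have "\<rho> s * deriv \<phi> s + w' s \<bullet> \<nu> s = 0" by (rule DERIV_unique)
    then show ?case by simp
  qed
  define f g h where "f s = - (real i * (F\<^sub>1 s \<bullet> \<nu> s))"
    and "g s = - (real j * real (j - i) * (G s \<bullet> \<nu> s))" and "h s = - (real j * (G\<^sub>1 s \<bullet> \<nu> s))" for s
  have fgh: "smooth_at 0 f" "smooth_at 0 g" "smooth_at 0 h"
    unfolding f_def[abs_def] g_def[abs_def] h_def[abs_def]
    by (intro smooth_at_minus smooth_at_mult smooth_at_const smooth_at_inner FG FG1 frame)+
  have \<rho>\<phi>': "\<forall>\<^sub>F s in nhds 0. \<rho> s * deriv \<phi> s = s ^ (i - 1) * f s + s ^ (j - i - 1) * g s + s ^ (j - 1) * h s"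
    using \<rho>\<phi> by eventually_elim (simp add: w'_def f_def g_def h_def inner_add_left)
  have F0: "F 0 = frechet_derivative \<Psi> (at (0, 0)) (1, 0)" "G 0 = frechet_derivative \<Psi> (at (0, 0)) (0, 1)"
    using pos by (simp_all add: F_def G_def \<Psi>\<^sub>u_def \<Psi>\<^sub>v_def zero_power)
  have w0: "w 0 = real i *\<^sub>R F 0" using ij by (simp add: w_def zero_power)
  then have F\<nu>: "F 0 \<bullet> \<nu> 0 = 0" using eventually_nhds_x_imp_x[OF w\<nu>] pos by simp
  have "det2 (F 0) (G 0) = - (F 0 \<bullet> \<mu> 0) * (G 0 \<bullet> \<nu> 0)"
    using det2_frame[OF sc, of "F 0" "G 0" 0] F\<nu> by (simp add: \<nu>_def \<mu>_def)
  then have ne: "F 0 \<bullet> \<mu> 0 \<noteq> 0" "G 0 \<bullet> \<nu> 0 \<noteq> 0" using det F0 by auto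
  have "\<rho> 0 \<noteq> 0" using ne(1) w0 pos by (simp add: \<rho>_def)
  moreover have "g 0 \<noteq> 0" using ne(2) ij by (simp add: g_def)
  moreover have "deriv \<rho> 0 = 0 \<and> deriv f 0 = 0" if "i + 1 < j"
  proof -
    have exps: "i - 1 > 0" "j - i - 1 > 0" "j - i > 0" "j - 1 > 0" using that ij by auto
    then have w'0: "w' 0 = 0" by (simp add: w'_def zero_power)
    then have "deriv \<phi> 0 = 0" using eventually_nhds_x_imp_x[OF \<rho>\<phi>] \<open>\<rho> 0 \<noteq> 0\<close> by simp
    then have \<nu>'0: "(\<nu> has_vector_derivative 0) (at 0)" "(\<mu> has_vector_derivative 0) (at 0)"
      using eventually_nhds_x_imp_x[OF frame'] by auto
    have "(w has_vector_derivative 0) (at 0)" using eventually_nhds_x_imp_x[OF w'] w'0 by simp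
    from bounded_bilinear.has_vector_derivative[OF bounded_bilinear_inner this \<nu>'0(2)]
    have "(\<rho> has_real_derivative 0) (at 0)"
      by (simp add: \<rho>_def[abs_def] has_real_derivative_iff_has_vector_derivative)
    moreover have "(F\<^sub>1 has_vector_derivative 0) (at 0)"
    proof -
      have "((\<lambda>s. \<Psi>\<^sub>u\<^sub>u (s ^ i, s ^ j)) has_vector_derivative 0) (at 0)"
        using eventually_nhds_x_imp_x[OF curve(2)[OF uu(1)]] exps by (simp add: zero_power)
      moreover obtain D where "((\<lambda>s. \<Psi>\<^sub>u\<^sub>v (s ^ i, s ^ j)) has_vector_derivative D) (at 0)"
        using eventually_nhds_x_imp_x[OF curve(2)[OF uu(2)]] by blast
      moreover have "((\<lambda>s. real j * s ^ (j - i)) has_real_derivative 0) (at 0)"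
        using exps by (auto intro!: derivative_eq_intros simp: zero_power)
      ultimately have "(F\<^sub>1 has_vector_derivative real i *\<^sub>R 0 + ((real j * 0 ^ (j - i)) *\<^sub>R D + 0 *\<^sub>R \<Psi>\<^sub>u\<^sub>v (0 ^ i, 0 ^ j))) (at 0)"
        unfolding F\<^sub>1_def[abs_def]
        by (intro has_vector_derivative_add has_vector_derivative_scaleR bounded_linear.has_vector_derivative[OF bounded_linear_scaleR_right])
      then show ?thesis using exps by (simp add: zero_power)
    qed
    from bounded_bilinear.has_vector_derivative[OF bounded_bilinear_inner this \<nu>'0(1)]
    have "((\<lambda>s. F\<^sub>1 s \<bullet> \<nu> s) has_real_derivative 0) (at 0)"
      by (simp add: has_real_derivative_iff_has_vector_derivative)
    then have "(f has_real_derivative 0) (at 0)"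
      unfolding f_def[abs_def] by (auto intro!: derivative_eq_intros)
    ultimately show ?thesis by (auto intro: DERIV_imp_deriv)
  qed
  ultimately show ?thesis using \<rho> fgh \<beta>\<rho> \<rho>\<phi>' by blast
qed

lemma diffeo_germ_plane_det2:
  fixes \<Phi> \<Psi> :: "real \<times> real \<Rightarrow> real \<times> real"
  assumes "diffeo_germ p q \<Phi> \<Psi>"
  shows "det2 (frechet_derivative \<Phi> (at p) (1, 0)) (frechet_derivative \<Phi> (at p) (0, 1)) \<noteq> 0"
proof -
  note d = diffeo_germD[OF assms]
  let ?D = "frechet_derivative \<Phi> (at p)" and ?E = "frechet_derivative \<Psi> (at q)"
  have D: "(\<Phi> has_derivative ?D) (at p)" using smooth_at_has_derivative[OF d(3)] .
  have "(\<Psi> has_derivative ?E) (at (\<Phi> p))" using smooth_at_has_derivative[OF d(4)] d(1) by simp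
  from has_derivative_compose[OF D this] have "((\<lambda>x. \<Psi> (\<Phi> x)) has_derivative (\<lambda>x. ?E (?D x))) (at p)" .
  moreover have "((\<lambda>x. \<Psi> (\<Phi> x)) has_derivative (\<lambda>x. x)) (at p)"
  proof -
    obtain U where "open U" "p \<in> U" "\<And>x. x \<in> U \<Longrightarrow> \<Psi> (\<Phi> x) = x"
      using d(5) unfolding eventually_nhds by blast
    then show ?thesis
      using has_derivative_transform_within_open[where t=UNIV, OF has_derivative_ident] by metis
  qed
  ultimately have "(\<lambda>x. ?E (?D x)) = (\<lambda>x. x)" by (rule has_derivative_unique)
  then have "inj ?D" by (metis injI)
  then show ?thesis using inj_linear_plane_iff[OF has_derivative_linear[OF D]] by blast
qed

text \<open>
  Reading \<open>\<A>\<close>-equivalence backwards: in the parameter of the model, the curve is the image of the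
  model under the inverse of the target diffeomorphism.
\<close>
lemma cusp_parametrization:
  assumes "cusp j i \<gamma> a" "legendre_germ a \<gamma> \<phi> \<beta>" "i > 0" "j > 0"
  shows "\<exists>\<kappa> \<Psi>. smooth_at 0 \<kappa> \<and> \<kappa> 0 = a \<and> deriv \<kappa> 0 \<noteq> 0 \<and> smooth_at (0, 0) \<Psi> \<and>
    det2 (frechet_derivative \<Psi> (at (0, 0)) (1, 0)) (frechet_derivative \<Psi> (at (0, 0)) (0, 1)) \<noteq> 0 \<and>
    (\<forall>\<^sub>F s in nhds 0. \<gamma> (\<kappa> s) = \<Psi> (s ^ i, s ^ j))"
proof -
  have zero: "((0::real) ^ i, (0::real) ^ j) = (0, 0)" using assms(3,4) by (simp add: zero_power)
  obtain \<tau> \<kappa> \<Phi> \<Psi> where *: "diffeo_germ a (0::real) \<tau> \<kappa>" "diffeo_germ (\<gamma> a) (0::real, 0::real) \<Phi> \<Psi>"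
    "\<forall>\<^sub>F s in nhds 0. (s ^ i, s ^ j) = \<Phi> (\<gamma> (\<kappa> s))"
    using assms(1) unfolding cusp_def A_equivalent_def zero by auto
  note \<kappa> = diffeo_germD[OF *(1)]
  have "legendre_germ 0 (\<lambda>s. \<gamma> (\<kappa> s)) (\<lambda>s. \<phi> (\<kappa> s)) (\<lambda>s. \<beta> (\<kappa> s) * deriv \<kappa> s)"
    by (rule legendre_germ_reparametrize[OF assms(2) \<kappa>(4,2)])
  then have "isCont (\<lambda>s. \<gamma> (\<kappa> s)) 0"
    unfolding legendre_germ_def
    by (auto dest!: eventually_nhds_x_imp_x intro: has_vector_derivative_continuous)
  then have "filterlim (\<lambda>s. \<gamma> (\<kappa> s)) (nhds (\<gamma> (\<kappa> 0))) (nhds 0)"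
    using tendsto_at_iff_tendsto_nhds[of "\<lambda>s. \<gamma> (\<kappa> s)" 0] by (simp add: isCont_def)
  then have "\<forall>\<^sub>F s in nhds 0. \<Psi> (\<Phi> (\<gamma> (\<kappa> s))) = \<gamma> (\<kappa> s)"
    using diffeo_germD(5)[OF *(2)] unfolding \<kappa>(2) filterlim_iff by blast
  with *(3) have "\<forall>\<^sub>F s in nhds 0. \<gamma> (\<kappa> s) = \<Psi> (s ^ i, s ^ j)"
    by eventually_elim simp
  then show ?thesis
    using \<kappa>(2,4) diffeo_germ_real_deriv[OF diffeo_germ_sym[OF *(1)]] diffeo_germD(4)[OF *(2)]
      diffeo_germ_plane_det2[OF diffeo_germ_sym[OF *(2)]] by blast
qed

text \<open>
  The exponents are variables tied by equations so that they are numerals once \<open>i\<close> and \<open>j\<close> are.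
\<close>
lemma cusp_data:
  assumes "legendre_germ a \<gamma> \<phi> \<beta>" "\<beta> a = 0" "C \<in> criteria"
    and "cusp j i \<gamma> a" "1 < i" "i < j" "n = i - 1" "m = j - i - 1" "p = j - 1"
  shows "\<exists>\<phi>' \<beta>' \<rho> f g h. (C \<beta>' \<phi>' 0 \<longleftrightarrow> C \<beta> \<phi> a) \<and> smooth_at 0 \<phi>' \<and>
    smooth_at 0 \<rho> \<and> smooth_at 0 f \<and> smooth_at 0 g \<and> smooth_at 0 h \<and> \<rho> 0 \<noteq> 0 \<and> g 0 \<noteq> 0 \<and>
    (\<forall>\<^sub>F s in nhds 0. \<beta>' s = s ^ n * \<rho> s) \<and>
    (\<forall>\<^sub>F s in nhds 0. \<rho> s * deriv \<phi>' s = s ^ n * f s + s ^ m * g s + s ^ p * h s) \<and>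
    (i + 1 < j \<longrightarrow> deriv \<rho> 0 = 0 \<and> deriv f 0 = 0)"
proof -
  obtain \<kappa> \<Psi> where \<kappa>: "smooth_at 0 \<kappa>" "\<kappa> 0 = a" "deriv \<kappa> 0 \<noteq> 0" and \<Psi>: "smooth_at (0, 0) \<Psi>"
    "det2 (frechet_derivative \<Psi> (at (0, 0)) (1, 0)) (frechet_derivative \<Psi> (at (0, 0)) (0, 1)) \<noteq> 0"
    "\<forall>\<^sub>F s in nhds 0. \<gamma> (\<kappa> s) = \<Psi> (s ^ i, s ^ j)"
    using cusp_parametrization[OF assms(4,1)] assms(5,6) by auto
  have sm: "smooth_at a \<phi>" "smooth_at a \<beta>" using assms(1) by (auto simp: legendre_germ_def)
  have "smooth_at 0 (\<lambda>s. \<phi> (\<kappa> s))" using smooth_at_compose[OF \<kappa>(1)] sm(1) \<kappa>(2) by simp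
  then show ?thesis
    using standard_cusp_data[OF legendre_germ_reparametrize[OF assms(1) \<kappa>(1,2)] \<Psi>(1,2) assms(5,6) \<Psi>(3)]
    unfolding assms(7-9)
    by (rule_tac x="\<lambda>s. \<phi> (\<kappa> s)" in exI, rule_tac x="\<lambda>s. \<beta> (\<kappa> s) * deriv \<kappa> s" in exI)
       (simp add: criteria_reparametrize[OF sm assms(2) \<kappa> assms(3)])
qed

lemma cusp_imp_criterion_3_2:
  assumes "cusp 3 2 \<gamma> a" "legendre_germ a \<gamma> \<phi> \<beta>" "\<beta> a = 0"
  shows "criterion_3_2 \<beta> \<phi> a"
proof -
  have "criterion_3_2 \<in> criteria" "1 < (2::nat)" "2 < (3::nat)" "(1::nat) = 2 - 1" "(0::nat) = 3 - 2 - 1"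
    "(2::nat) = 3 - 1" by (simp_all add: criteria_def)
  from cusp_data[OF assms(2,3) this(1) assms(1) this(2-)]
  obtain \<phi>' \<beta>' \<rho> f g h where "criterion_3_2 \<beta>' \<phi>' 0 \<longleftrightarrow> criterion_3_2 \<beta> \<phi> a" and \<phi>': "smooth_at 0 \<phi>'"
    and \<rho>: "smooth_at 0 \<rho>" "\<rho> 0 \<noteq> 0" "g 0 \<noteq> 0" "\<forall>\<^sub>F s in nhds 0. \<beta>' s = s ^ 1 * \<rho> s"
    "\<forall>\<^sub>F s in nhds 0. \<rho> s * deriv \<phi>' s = s ^ 1 * f s + s ^ 0 * g s + s ^ 2 * h s"
    and fgh: "smooth_at 0 f" "smooth_at 0 g" "smooth_at 0 h"
    by blast
  moreover have "deriv \<beta>' 0 \<noteq> 0" using higher_deriv_power_factor(2)[OF \<rho>(1,4)] \<rho>(2) by simp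
  moreover have "deriv \<phi>' 0 \<noteq> 0" using eventually_nhds_x_imp_x[OF \<rho>(5)] \<rho>(3) by auto
  ultimately show ?thesis by (simp add: criterion_3_2_def)
qed

lemma cusp_imp_criterion_4_3:
  assumes "cusp 4 3 \<gamma> a" "legendre_germ a \<gamma> \<phi> \<beta>" "\<beta> a = 0"
  shows "criterion_4_3 \<beta> \<phi> a"
proof -
  have "criterion_4_3 \<in> criteria" "1 < (3::nat)" "3 < (4::nat)" "(2::nat) = 3 - 1" "(0::nat) = 4 - 3 - 1"
    "(3::nat) = 4 - 1" by (simp_all add: criteria_def)
  from cusp_data[OF assms(2,3) this(1) assms(1) this(2-)]
  obtain \<phi>' \<beta>' \<rho> f g h where "criterion_4_3 \<beta>' \<phi>' 0 \<longleftrightarrow> criterion_4_3 \<beta> \<phi> a" and \<phi>': "smooth_at 0 \<phi>'"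
    and \<rho>: "smooth_at 0 \<rho>" "\<rho> 0 \<noteq> 0" "g 0 \<noteq> 0" "\<forall>\<^sub>F s in nhds 0. \<beta>' s = s ^ 2 * \<rho> s"
    "\<forall>\<^sub>F s in nhds 0. \<rho> s * deriv \<phi>' s = s ^ 2 * f s + s ^ 0 * g s + s ^ 3 * h s"
    and fgh: "smooth_at 0 f" "smooth_at 0 g" "smooth_at 0 h"
    by blast
  moreover have "deriv \<beta>' 0 = 0" "(deriv ^^ 2) \<beta>' 0 \<noteq> 0"
    using higher_deriv_power_factor(1)[OF \<rho>(1,4), of 1] higher_deriv_power_factor(2)[OF \<rho>(1,4)] \<rho>(2) by simp_all
  moreover have "deriv \<phi>' 0 \<noteq> 0" using eventually_nhds_x_imp_x[OF \<rho>(5)] \<rho>(3) by auto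
  ultimately show ?thesis by (simp add: criterion_4_3_def)
qed

lemma cusp_imp_criterion_5_3:
  assumes "cusp 5 3 \<gamma> a" "legendre_germ a \<gamma> \<phi> \<beta>" "\<beta> a = 0"
  shows "criterion_5_3 \<beta> \<phi> a"
proof -
  have "criterion_5_3 \<in> criteria" "1 < (3::nat)" "3 < (5::nat)" "(2::nat) = 3 - 1" "(1::nat) = 5 - 3 - 1"
    "(4::nat) = 5 - 1" by (simp_all add: criteria_def)
  from cusp_data[OF assms(2,3) this(1) assms(1) this(2-)]
  obtain \<phi>' \<beta>' \<rho> f g h where "criterion_5_3 \<beta>' \<phi>' 0 \<longleftrightarrow> criterion_5_3 \<beta> \<phi> a" and \<phi>': "smooth_at 0 \<phi>'"
    and \<rho>: "smooth_at 0 \<rho>" "\<rho> 0 \<noteq> 0" "g 0 \<noteq> 0" "\<forall>\<^sub>F s in nhds 0. \<beta>' s = s ^ 2 * \<rho> s"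
    "\<forall>\<^sub>F s in nhds 0. \<rho> s * deriv \<phi>' s = s ^ 2 * f s + s ^ 1 * g s + s ^ 4 * h s"
    and fgh: "smooth_at 0 f" "smooth_at 0 g" "smooth_at 0 h"
    by blast
  moreover have "deriv \<beta>' 0 = 0" "(deriv ^^ 2) \<beta>' 0 \<noteq> 0"
    using higher_deriv_power_factor(1)[OF \<rho>(1,4), of 1] higher_deriv_power_factor(2)[OF \<rho>(1,4)] \<rho>(2) by simp_all
  moreover have \<phi>0: "deriv \<phi>' 0 = 0" using eventually_nhds_x_imp_x[OF \<rho>(5)] \<rho>(2) by simp
  moreover have "(deriv ^^ 2) \<phi>' 0 \<noteq> 0"
  proof -
    have ev: "\<forall>\<^sub>F s in nhds 0. \<rho> s * deriv \<phi>' s = s ^ 1 * (s * f s + g s + s ^ 3 * h s)"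
      using \<rho>(5) by eventually_elim (simp add: eval_nat_numeral algebra_simps)
    have "smooth_at 0 (\<lambda>s. s * f s + g s + s ^ 3 * h s)" by (intro smooth_intros fgh)
    from higher_deriv_power_factor(2)[OF this ev]
    have "deriv (\<lambda>s. \<rho> s * deriv \<phi>' s) 0 = g 0" by simp
    then show ?thesis
      using deriv_mult_at[OF \<rho>(1) smooth_at_deriv[OF \<phi>']] \<phi>0 \<rho>(3) by (auto simp: numeral_2_eq_2)
  qed
  ultimately show ?thesis by (simp add: criterion_5_3_def)
qed

text \<open>
  Since \<open>\<rho>\<close> and \<open>f\<close> are stationary, \<open>\<beta>'' = 0\<close> and \<open>\<rho> \<phi>''' = 2 g \<noteq> 0\<close> at the origin.
\<close>
lemma cusp_imp_criterion_5_2: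
  assumes "cusp 5 2 \<gamma> a" "legendre_germ a \<gamma> \<phi> \<beta>" "\<beta> a = 0"
  shows "criterion_5_2 \<beta> \<phi> a"
proof -
  have "criterion_5_2 \<in> criteria" "1 < (2::nat)" "2 < (5::nat)" "(1::nat) = 2 - 1" "(2::nat) = 5 - 2 - 1"
    "(4::nat) = 5 - 1" by (simp_all add: criteria_def)
  from cusp_data[OF assms(2,3) this(1) assms(1) this(2-)]
  obtain \<phi>' \<beta>' \<rho> f g h where crit: "criterion_5_2 \<beta>' \<phi>' 0 \<longleftrightarrow> criterion_5_2 \<beta> \<phi> a" and \<phi>': "smooth_at 0 \<phi>'"
    and \<rho>: "smooth_at 0 \<rho>" "\<rho> 0 \<noteq> 0" "g 0 \<noteq> 0" "\<forall>\<^sub>F s in nhds 0. \<beta>' s = s ^ 1 * \<rho> s"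
    "\<forall>\<^sub>F s in nhds 0. \<rho> s * deriv \<phi>' s = s ^ 1 * f s + s ^ 2 * g s + s ^ 4 * h s"
    and fgh: "smooth_at 0 f" "smooth_at 0 g" "smooth_at 0 h"
    and "(2::nat) + 1 < 5 \<longrightarrow> deriv \<rho> 0 = 0 \<and> deriv f 0 = 0"
    by blast
  then have d0: "deriv \<rho> 0 = 0" "deriv f 0 = 0" by simp_all
  have \<beta>0: "deriv \<beta>' 0 \<noteq> 0" using higher_deriv_power_factor(2)[OF \<rho>(1,4)] \<rho>(2) by simp
  moreover have \<beta>2: "(deriv ^^ 2) \<beta>' 0 = 0"
    using higher_deriv_cong[OF \<rho>(4), of 2] higher_deriv_times_id[OF \<rho>(1), of 1] d0(1)
    by (simp add: numeral_2_eq_2)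
  moreover have \<phi>0: "deriv \<phi>' 0 = 0" using eventually_nhds_x_imp_x[OF \<rho>(5)] \<rho>(2) by simp
  moreover have "(deriv ^^ 3) \<phi>' 0 \<noteq> 0"
  proof -
    define k where "k s = f s + s * (g s + s ^ 2 * h s)" for s
    have gh: "smooth_at 0 (\<lambda>s. g s + s ^ 2 * h s)" by (intro smooth_intros fgh)
    have k: "smooth_at 0 k" unfolding k_def[abs_def] by (intro smooth_intros fgh)
    have "deriv k 0 = deriv f 0 + deriv (\<lambda>s. s * (g s + s ^ 2 * h s)) 0"
      unfolding k_def by (rule deriv_add_at[OF fgh(1)]) (intro smooth_intros fgh)
    also have "\<dots> = g 0" using deriv_mult_at[OF smooth_at_id gh] d0(2) by simp
    finally have k': "deriv k 0 = g 0" .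
    have "\<forall>\<^sub>F s in nhds 0. \<rho> s * deriv \<phi>' s = s * k s"
      using \<rho>(5) by eventually_elim (simp add: k_def eval_nat_numeral algebra_simps)
    from higher_deriv_cong[OF this, of 2] have "(deriv ^^ 2) (\<lambda>s. \<rho> s * deriv \<phi>' s) 0 = 2 * g 0"
      using higher_deriv_times_id[OF k, of 1] k' by (simp add: numeral_2_eq_2)
    then show ?thesis
      using deriv2_mult_at[OF \<rho>(1) smooth_at_deriv[OF \<phi>']] \<phi>0 d0(1) \<rho>(3)
      by (auto simp: numeral_2_eq_2 numeral_3_eq_3)
  qed
  ultimately show ?thesis using crit \<beta>0 by (simp add: criterion_5_2_def)
qed

section \<open>Legendre curves\<close>

lemma smooth_on_interior:
  assumes "smooth_on S f" "x \<in> interior S"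
  shows "smooth_at x f"
proof -
  have "x \<in> S" using assms(2) interior_subset by blast
  then obtain U g where U: "open U" "x \<in> U" "\<forall>k. C_k_on k U g" "\<forall>y\<in>S \<inter> U. f y = g y"
    using assms(1) unfolding smooth_on_def by blast
  have "\<forall>\<^sub>F y in nhds x. y \<in> interior S \<inter> U"
    by (rule eventually_nhds_in_open) (use U assms(2) in auto)
  then have "\<forall>\<^sub>F y in nhds x. g y = f y"
    by eventually_elim (use U(4) interior_subset[of S] in auto)
  then show ?thesis using smooth_at_cong smooth_atI[OF U(1,2)] U(3) by blast
qed

text \<open>
  At interior points of \<open>I\<close> the derivatives within \<open>I\<close> are ordinary ones. Expanding \<open>\<gamma>'\<close> in the orthonormal
  frame given by \<open>\<nu>\<close> and its rotation leaves only the component \<open>\<beta>\<close>.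
\<close>
lemma legendre_curve_germ:
  assumes "legendre_curve I \<gamma> \<nu>" "smooth_on I \<phi>" "\<And>t. t \<in> I \<Longrightarrow> \<nu> t = (cos (\<phi> t), sin (\<phi> t))"
    and "\<And>t. t \<in> I \<Longrightarrow> snd (legendre_curvature I \<gamma> \<nu> t) = \<beta> t" and "t\<^sub>0 \<in> interior I"
  shows "legendre_germ t\<^sub>0 \<gamma> \<phi> \<beta>"
proof -
  define v where "v t = frechet_derivative \<gamma> (at t) 1" for t
  have \<gamma>: "smooth_at t \<gamma>" if "t \<in> interior I" for t
    using assms(1) smooth_on_interior that by (auto simp: legendre_curve_def)
  have \<phi>: "smooth_at t\<^sub>0 \<phi>" using smooth_on_interior assms(2,5) by blast
  have int: "\<forall>\<^sub>F t in nhds t\<^sub>0. t \<in> interior I"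
    by (rule eventually_nhds_in_open[OF open_interior assms(5)])
  have v: "(\<gamma> has_vector_derivative v t) (at t)" if "t \<in> interior I" for t
  proof -
    have D: "(\<gamma> has_derivative frechet_derivative \<gamma> (at t)) (at t)"
      using smooth_at_has_derivative[OF \<gamma>[OF that]] .
    have "frechet_derivative \<gamma> (at t) h = h *\<^sub>R v t" for h
      using linear_scale[OF has_derivative_linear[OF D], of h 1] by (simp add: v_def)
    then have "frechet_derivative \<gamma> (at t) = (\<lambda>h. h *\<^sub>R v t)" by (rule ext)
    with D show ?thesis unfolding has_vector_derivative_def by (rule subst[rotated])
  qed
  have \<beta>: "\<beta> t = v t \<bullet> (- sin (\<phi> t), cos (\<phi> t))" "v t \<bullet> (cos (\<phi> t), sin (\<phi> t)) = 0"
    if t: "t \<in> interior I" for t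
  proof -
    have tI: "t \<in> I" using t interior_subset by blast
    have "vector_derivative \<gamma> (at t within I) = v t"
      using at_within_interior[OF t] vector_derivative_at[OF v[OF t]] by simp
    then show "\<beta> t = v t \<bullet> (- sin (\<phi> t), cos (\<phi> t))" "v t \<bullet> (cos (\<phi> t), sin (\<phi> t)) = 0"
      using assms(1) assms(4)[OF tI] tI assms(3)[OF tI]
      by (auto simp: legendre_curve_def legendre_curvature_def rot90_def)
  qed
  have "smooth_at t\<^sub>0 (\<lambda>t. v t \<bullet> (- sin (\<phi> t), cos (\<phi> t)))"
    unfolding v_def[abs_def] using smooth_at_partial[OF \<gamma>[OF assms(5)]]
    by (intro smooth_at_inner smooth_intros \<phi>)
  moreover have "\<forall>\<^sub>F t in nhds t\<^sub>0. v t \<bullet> (- sin (\<phi> t), cos (\<phi> t)) = \<beta> t"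
    using int by eventually_elim (simp add: \<beta>)
  ultimately have "smooth_at t\<^sub>0 \<beta>" by (rule smooth_at_cong)
  moreover have "\<forall>\<^sub>F t in nhds t\<^sub>0. (\<gamma> has_vector_derivative \<beta> t *\<^sub>R (- sin (\<phi> t), cos (\<phi> t))) (at t)"
    using int
  proof eventually_elim
    case (elim t)
    have sc: "cos (\<phi> t) * cos (\<phi> t) + sin (\<phi> t) * sin (\<phi> t) = 1" by simp
    have "v t = \<beta> t *\<^sub>R (- sin (\<phi> t), cos (\<phi> t))"
      using \<beta>[OF elim] sc unfolding prod_eq_iff inner_prod_def fst_conv snd_conv fst_scaleR snd_scaleR
        inner_real_def real_scaleR_def by algebra
    then show ?case using v[OF elim] by simp
  qed
  ultimately show ?thesis using \<phi> unfolding legendre_germ_def by blast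
qed

theorem theorem3p19:
  fixes I :: "real set" and t\<^sub>0 :: real
    and \<gamma> \<nu> :: "real \<Rightarrow> real \<times> real"
    and x z \<phi> \<beta> :: "real \<Rightarrow> real"
  assumes "is_interval I" and "t\<^sub>0 \<in> interior I"
    and "legendre_curve I \<gamma> \<nu>"
    and "\<And>t. t \<in> I \<Longrightarrow> \<gamma> t = (x t, z t)"
    and "smooth_on I \<phi>"
    and "\<And>t. t \<in> I \<Longrightarrow> \<nu> t = (cos (\<phi> t), sin (\<phi> t))"
    and "\<And>t. t \<in> I \<Longrightarrow>
           legendre_curvature I \<gamma> \<nu> t = (vector_derivative \<phi> (at t within I), \<beta> t)"
    and "\<beta> t\<^sub>0 = 0"
  shows "(cusp 3 2 \<gamma> t\<^sub>0 \<longleftrightarrow> deriv \<beta> t\<^sub>0 * deriv \<phi> t\<^sub>0 \<noteq> 0) \<and>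
    (cusp 5 2 \<gamma> t\<^sub>0 \<longleftrightarrow>
        deriv \<beta> t\<^sub>0 \<noteq> 0 \<and> deriv \<phi> t\<^sub>0 = 0 \<and>
        (deriv ^^ 2) \<beta> t\<^sub>0 * (deriv ^^ 2) \<phi> t\<^sub>0 - deriv \<beta> t\<^sub>0 * (deriv ^^ 3) \<phi> t\<^sub>0 \<noteq> 0) \<and>
    (cusp 4 3 \<gamma> t\<^sub>0 \<longleftrightarrow>
        deriv \<beta> t\<^sub>0 = 0 \<and> (deriv ^^ 2) \<beta> t\<^sub>0 * deriv \<phi> t\<^sub>0 \<noteq> 0) \<and>
    (cusp 5 3 \<gamma> t\<^sub>0 \<longleftrightarrow>
        deriv \<beta> t\<^sub>0 = 0 \<and> deriv \<phi> t\<^sub>0 = 0 \<and> (deriv ^^ 2) \<beta> t\<^sub>0 * (deriv ^^ 2) \<phi> t\<^sub>0 \<noteq> 0)"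
proof -
  have leg: "legendre_germ t\<^sub>0 \<gamma> \<phi> \<beta>"
    by (rule legendre_curve_germ[OF assms(3,5,6) _ assms(2)]) (simp_all add: assms(7))
  have "cusp 3 2 \<gamma> t\<^sub>0 \<longleftrightarrow> criterion_3_2 \<beta> \<phi> t\<^sub>0"
    using cusp_imp_criterion_3_2[OF _ leg assms(8)] criterion_imp_cusp_order_2(1)[OF leg assms(8)]
    by (auto simp: criterion_3_2_def)
  moreover have "cusp 5 2 \<gamma> t\<^sub>0 \<longleftrightarrow> criterion_5_2 \<beta> \<phi> t\<^sub>0"
    using cusp_imp_criterion_5_2[OF _ leg assms(8)] criterion_imp_cusp_order_2(2)[OF leg assms(8)]
    by (auto simp: criterion_5_2_def)
  moreover have "cusp 4 3 \<gamma> t\<^sub>0 \<longleftrightarrow> criterion_4_3 \<beta> \<phi> t\<^sub>0"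
    using cusp_imp_criterion_4_3[OF _ leg assms(8)] criterion_imp_cusp_order_3(1)[OF leg assms(8)]
    by (auto simp: criterion_4_3_def)
  moreover have "cusp 5 3 \<gamma> t\<^sub>0 \<longleftrightarrow> criterion_5_3 \<beta> \<phi> t\<^sub>0"
    using cusp_imp_criterion_5_3[OF _ leg assms(8)] criterion_imp_cusp_order_3(2)[OF leg assms(8)]
    by (auto simp: criterion_5_3_def)
  ultimately show ?thesis
    unfolding criterion_3_2_def criterion_5_2_def criterion_4_3_def criterion_5_3_def by blast
qed

end
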